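(* Let $E$ be a real JB$^*$-triple. Then a subspace of $E$ is an $M$-ideal of $E$ if and only if it is a triple ideal of $E$.
   Context: A real JB$^*$-triple is a norm-closed real subspace $E$ of a complex JB$^*$-triple with $\{E,E,E\}\subseteq E$, equipped with the restricted triple product. A triple ideal of $E$ is a norm-closed subspace $I$ with $\{E,E,I\}+\{E,I,E\}\subseteq I$. A projection $Q$ on a Banach space $X$ is an $L$-projection if $\|x\|=\|Qx\|+\|x-Qx\|$ for all $x\in X$. A closed subspace $M$ of a Banach space $V$ is an $M$-ideal if its polar $M^{\circ}=\{\varphi\in V^*:\varphi|_M\equiv 0\}$ is the image of an $L$-projection on $V^*$. *)

theory Defs
  imports "HOL-Analysis.Analysis"
begin

text \<open>A complex Banach space is modelled as a real Banach space (type class banach)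
together with a complex structure J (multiplication by the imaginary unit):
J is real-linear, J (J x) = - x, and the norm is invariant under all rotations
e^{it}, i.e. the norm of (cos t x + sin t J x) equals the norm of x.
The complex scalar a + ib then acts as x maps to a x + b J x.\<close>

definition complex_structure :: "('a::banach \<Rightarrow> 'a) \<Rightarrow> bool" where
  "complex_structure J \<longleftrightarrow> linear J \<and> (\<forall>x. J (J x) = - x) \<and>
     (\<forall>t x. norm (cos t *\<^sub>R x + sin t *\<^sub>R J x) = norm x)"

definition expit :: "('a::banach \<Rightarrow> 'a) \<Rightarrow> ('a \<Rightarrow> 'a) \<Rightarrow> real \<Rightarrow> 'a \<Rightarrow> 'a" where
  "expit J T t x = (\<Sum>n. (t ^ n / fact n) *\<^sub>R (J ^^ n) ((T ^^ n) x))"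

text \<open>A bounded (complex-)linear operator T is hermitian if exp(itT) has norm at most 1
(equivalently, norm 1) for every real t.\<close>
definition hermitian :: "('a::banach \<Rightarrow> 'a) \<Rightarrow> ('a \<Rightarrow> 'a) \<Rightarrow> bool" where
  "hermitian J T \<longleftrightarrow> (\<forall>t x. norm (expit J T t x) \<le> norm x)"

text \<open>The spectrum of T is contained in [0,\<infinity>): for every complex number a + ib
outside [0,\<infinity>) the operator T - (a + ib) is invertible (bijective; boundedness of
the inverse is automatic by the open mapping theorem).\<close>
definition nonneg_spectrum :: "('a::banach \<Rightarrow> 'a) \<Rightarrow> ('a \<Rightarrow> 'a) \<Rightarrow> bool" where
  "nonneg_spectrum J T \<longleftrightarrow>
     (\<forall>a b::real. (b \<noteq> 0 \<or> a < 0) \<longrightarrow> bij (\<lambda>x. T x - a *\<^sub>R x - b *\<^sub>R J x))"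

definition L_op :: "('a \<Rightarrow> 'a \<Rightarrow> 'a \<Rightarrow> 'a) \<Rightarrow> 'a \<Rightarrow> 'a \<Rightarrow> 'a \<Rightarrow> 'a" where
  "L_op tp a b = (\<lambda>x. tp a b x)"

definition complex_JBstar_triple :: "('a::banach \<Rightarrow> 'a) \<Rightarrow> ('a \<Rightarrow> 'a \<Rightarrow> 'a \<Rightarrow> 'a) \<Rightarrow> bool" where
  "complex_JBstar_triple J tp \<longleftrightarrow>
     complex_structure J \<and>
     (\<forall>y z. linear (\<lambda>x. tp x y z)) \<and>
     (\<forall>x z. linear (\<lambda>y. tp x y z)) \<and>
     (\<forall>x y. linear (\<lambda>z. tp x y z)) \<and>
     (\<forall>x y z. tp (J x) y z = J (tp x y z)) \<and>
     (\<forall>x y z. tp x (J y) z = - J (tp x y z)) \<and>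
     (\<forall>x y z. tp x y z = tp z y x) \<and>
     (\<exists>K. \<forall>x y z. norm (tp x y z) \<le> K * norm x * norm y * norm z) \<and>
     (\<forall>a b x y z. tp a b (tp x y z) =
         tp (tp a b x) y z - tp x (tp b a y) z + tp x y (tp a b z)) \<and>
     (\<forall>a. hermitian J (L_op tp a a) \<and> nonneg_spectrum J (L_op tp a a)) \<and>
     (\<forall>a. norm (tp a a a) = norm a ^ 3)"

definition real_JBstar_triple :: "('a::banach \<Rightarrow> 'a) \<Rightarrow> ('a \<Rightarrow> 'a \<Rightarrow> 'a \<Rightarrow> 'a) \<Rightarrow> 'a set \<Rightarrow> bool" where
  "real_JBstar_triple J tp E \<longleftrightarrow> complex_JBstar_triple J tp \<and> subspace E \<and> closed E \<and>
     (\<forall>x\<in>E. \<forall>y\<in>E. \<forall>z\<in>E. tp x y z \<in> E)"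

definition triple_ideal :: "('a::banach \<Rightarrow> 'a \<Rightarrow> 'a \<Rightarrow> 'a) \<Rightarrow> 'a set \<Rightarrow> 'a set \<Rightarrow> bool" where
  "triple_ideal tp E I \<longleftrightarrow> subspace I \<and> closed I \<and> I \<subseteq> E \<and>
     (\<forall>a\<in>E. \<forall>b\<in>E. \<forall>x\<in>I. tp a b x \<in> I \<and> tp a x b \<in> I)"

text \<open>The (real) dual space of the real Banach space E (a closed subspace of 'a):
bounded real-linear functionals on E, represented canonically as functions on 'a
vanishing outside E.\<close>
definition dual_space :: "'a::real_normed_vector set \<Rightarrow> ('a \<Rightarrow> real) set" where
  "dual_space E = {f. (\<forall>x\<in>E. \<forall>y\<in>E. f (x + y) = f x + f y) \<and>
      (\<forall>c. \<forall>x\<in>E. f (c *\<^sub>R x) = c * f x) \<and>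
      (\<exists>K. \<forall>x\<in>E. \<bar>f x\<bar> \<le> K * norm x) \<and>
      (\<forall>x. x \<notin> E \<longrightarrow> f x = 0)}"

definition dual_norm :: "'a::real_normed_vector set \<Rightarrow> ('a \<Rightarrow> real) \<Rightarrow> real" where
  "dual_norm E f = (SUP x\<in>{x\<in>E. norm x \<le> 1}. \<bar>f x\<bar>)"

definition polar :: "'a::real_normed_vector set \<Rightarrow> 'a set \<Rightarrow> ('a \<Rightarrow> real) set" where
  "polar E M = {f \<in> dual_space E. \<forall>m\<in>M. f m = 0}"

definition L_projection :: "'a::real_normed_vector set \<Rightarrow> (('a \<Rightarrow> real) \<Rightarrow> ('a \<Rightarrow> real)) \<Rightarrow> bool" where
  "L_projection E Q \<longleftrightarrow>
     (\<forall>f\<in>dual_space E. Q f \<in> dual_space E) \<and>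
     (\<forall>f\<in>dual_space E. \<forall>g\<in>dual_space E. Q (\<lambda>x. f x + g x) = (\<lambda>x. Q f x + Q g x)) \<and>
     (\<forall>c. \<forall>f\<in>dual_space E. Q (\<lambda>x. c * f x) = (\<lambda>x. c * Q f x)) \<and>
     (\<forall>f\<in>dual_space E. Q (Q f) = Q f) \<and>
     (\<forall>f\<in>dual_space E. dual_norm E f = dual_norm E (Q f) + dual_norm E (\<lambda>x. f x - Q f x))"

definition M_ideal :: "'a::real_normed_vector set \<Rightarrow> 'a set \<Rightarrow> bool" where
  "M_ideal E M \<longleftrightarrow> subspace M \<and> closed M \<and> M \<subseteq> E \<and>
     (\<exists>Q. L_projection E Q \<and> Q ` dual_space E = polar E M)"

end

theory Submission
  imports Defs "HOL-Complex_Analysis.Complex_Analysis"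
begin

text \<open>For n in a JB*-triple the box operator D = L(n, n) is hermitian with nonnegative spectrum, so
  R n t = exp (- t D) is a contraction semigroup; moreover D R n t = O(1 / t), and R n t n tends to 0.
  It follows that R n t y becomes orthogonal to n as t grows, uniformly on the unit ball. This
  replaces the Peirce projections of tripotents, so that no bidual is needed.

  Let M be a closed triple ideal. For n in M the vector R n t y lies in y + M, and the norm of n + R n t y is
  nearly the maximum of the two norms. Hence a functional that attains its norm on M and a
  functional that vanishes on M have additive norms, and norm preserving extensions from M are unique.
  They form a subspace because the error of additivity vanishes on all triple products.

  Let M be an M-ideal, let g be a norm one functional that vanishes on M, and let m be in the unit ball of M. There is
  x with g x = 1 such that x + m and x - m have norm almost 1. The maps 1 + s (L(a, b) - L(b, a))
  and u + s (u - {u, u, u}) increase norms only by O(s^2); at u = x + t m this forces g to vanish on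
  derivations of m and on {m, m, m}, and almost on {m, m, x}. The last fact shows that composition with R m t does
  not decrease the norm of g, whereas g D R m t tends to 0; hence g D = 0.\<close>

section \<open>The Hahn--Banach theorem\<close>

text \<open>The model is a triple of functions, where L(n, n) is multiplication by |n|^2: exp (- t
  |n|^2) y concentrates on the zero set of n as t grows, and n exp (- t |n|^2) tends to 0 uniformly.
  In general the decay only says that \<open>tp n n z\<close> and \<open>tp n z n\<close> are small
  for z = \<open>R n t y\<close>; passing from these two vectors to the operators L(n, z) and L(z,
  n) is the hard point of the orthogonality theorem. The shape of the converse comes from E being
  real. The groups exp (i t L(a, a)) live in the ambient complex triple and need not leave E
  invariant, so inside E only the derivations L(a, b) - L(b, a) are available, and these merely show
  that products such as \<open>tp m m a\<close> and \<open>tp m a m\<close> agree modulo M. The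
  missing information comes from the flow of u - {u, u, u}, which stays in E. One choice of scale
  controls the errors: the two balls are enlarged by s^2 when the flow runs for time s, so a
  second-order error divided by s still tends to 0.\<close>

lemma Hahn_Banach_sublinear:
  fixes p :: "'v::real_vector \<Rightarrow> real"
  assumes p_add: "\<And>x y. p (x + y) \<le> p x + p y"
    and p_scale: "\<And>c x. 0 \<le> c \<Longrightarrow> p (c *\<^sub>R x) = c * p x"
    and S: "subspace S"
    and f_add: "\<And>x y. x \<in> S \<Longrightarrow> y \<in> S \<Longrightarrow> f (x + y) = f x + f y"
    and f_scale: "\<And>c x. x \<in> S \<Longrightarrow> f (c *\<^sub>R x) = c * f x"
    and f_le: "\<And>x. x \<in> S \<Longrightarrow> f x \<le> p x"
  obtains F where "linear F" "\<And>x. x \<in> S \<Longrightarrow> F x = f x" "\<And>x. F x \<le> p x"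
proof -
  \<comment> \<open>Partial extensions are encoded as subspaces of the product with the reals. That
    they are graphs of functions is a consequence: lying below p, together with p 0 = 0, forces
    single values.\<close>
  define \<G> where "\<G> = {g :: ('v \<times> real) set. subspace g \<and> (\<lambda>x. (x, f x)) ` S \<subseteq> g \<and> (\<forall>(x, a)\<in>g. a \<le> p x)}"
  have "subspace ((\<lambda>x. (x, f x)) ` S)"
    unfolding subspace_def
  proof (intro conjI ballI allI)
    have "(0, f 0) \<in> (\<lambda>x. (x, f x)) ` S" using subspace_0[OF S] by blast
    moreover have "f 0 = 0" using f_scale[of 0 0] subspace_0[OF S] by simp
    ultimately show "0 \<in> (\<lambda>x. (x, f x)) ` S" by (simp add: zero_prod_def)
  next
    fix u v assume "u \<in> (\<lambda>x. (x, f x)) ` S" "v \<in> (\<lambda>x. (x, f x)) ` S"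
    then obtain x y where "x \<in> S" "y \<in> S" "u = (x, f x)" "v = (y, f y)" by blast
    then have "u + v = (x + y, f (x + y))" "x + y \<in> S" using f_add S by (auto simp: subspace_add)
    then show "u + v \<in> (\<lambda>x. (x, f x)) ` S" by blast
  next
    fix c :: real and u assume "u \<in> (\<lambda>x. (x, f x)) ` S"
    then obtain x where "x \<in> S" "u = (x, f x)" by blast
    then have "c *\<^sub>R u = (c *\<^sub>R x, f (c *\<^sub>R x))" "c *\<^sub>R x \<in> S" using f_scale S by (auto simp: subspace_scale)
    then show "c *\<^sub>R u \<in> (\<lambda>x. (x, f x)) ` S" by blast
  qed
  then have ne: "\<G> \<noteq> {}" unfolding \<G>_def using f_le by blast
  have "\<exists>g\<in>\<G>. \<forall>h\<in>\<G>. g \<subseteq> h \<longrightarrow> h = g"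
  proof (rule subset_Zorn_nonempty[OF ne])
    fix C assume C: "C \<noteq> {}" "subset.chain \<G> C"
    have sub: "C \<subseteq> \<G>" and tot: "\<And>a b. a \<in> C \<Longrightarrow> b \<in> C \<Longrightarrow> a \<subseteq> b \<or> b \<subseteq> a"
      using C(2) by (auto simp: subset.chain_def)
    have "subspace (\<Union>C)"
      unfolding subspace_def
    proof (intro conjI ballI allI)
      show "0 \<in> \<Union>C" using C(1) sub unfolding \<G>_def by (blast intro: subspace_0)
    next
      fix u v assume "u \<in> \<Union>C" "v \<in> \<Union>C"
      then obtain a b where ab: "a \<in> C" "b \<in> C" "u \<in> a" "v \<in> b" by blast
      then obtain c where "c \<in> C" "u \<in> c" "v \<in> c" using tot by blast
      then show "u + v \<in> \<Union>C" using sub unfolding \<G>_def by (blast intro: subspace_add)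
    next
      fix c :: real and u assume "u \<in> \<Union>C"
      then show "c *\<^sub>R u \<in> \<Union>C" using sub unfolding \<G>_def by (blast intro: subspace_scale)
    qed
    moreover have "(\<lambda>x. (x, f x)) ` S \<subseteq> \<Union>C" using C(1) sub unfolding \<G>_def by blast
    moreover have "\<forall>(x, a)\<in>\<Union>C. a \<le> p x" using sub unfolding \<G>_def by fast
    ultimately show "\<Union>C \<in> \<G>" unfolding \<G>_def by blast
  qed
  then obtain g where gG: "g \<in> \<G>" and max: "\<And>h. h \<in> \<G> \<Longrightarrow> g \<subseteq> h \<Longrightarrow> h = g" by blast
  have g: "subspace g" and gS: "\<And>x. x \<in> S \<Longrightarrow> (x, f x) \<in> g" and gp: "\<And>x a. (x, a) \<in> g \<Longrightarrow> a \<le> p x"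
    using gG unfolding \<G>_def by auto
  have total: "\<exists>a. (x0, a) \<in> g" for x0
  proof (rule ccontr)
    assume no: "\<nexists>a. (x0, a) \<in> g"
    have sep: "a - p (y - x0) \<le> p (z + x0) - b" if "(y, a) \<in> g" "(z, b) \<in> g" for y a z b
    proof -
      have "(y, a) + (z, b) \<in> g" using that g by (blast intro: subspace_add)
      then have "a + b \<le> p (y + z)" using gp by simp
      also have "\<dots> = p ((y - x0) + (z + x0))" by simp
      also have "\<dots> \<le> p (y - x0) + p (z + x0)" by (rule p_add)
      finally show ?thesis by simp
    qed
    have z0: "(0, 0) \<in> g" using subspace_0[OF g] by (simp add: zero_prod_def)
    define a0 where "a0 = (SUP (y, a)\<in>g. a - p (y - x0))"
    have bdd: "bdd_above ((\<lambda>(y, a). a - p (y - x0)) ` g)"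
      using sep[OF _ z0] by (intro bdd_aboveI[where M = "p (0 + x0) - 0"]) auto
    have lo: "a - p (y - x0) \<le> a0" if "(y, a) \<in> g" for y a
      unfolding a0_def using cSUP_upper[OF that bdd] by simp
    have hi: "a0 \<le> p (z + x0) - b" if "(z, b) \<in> g" for z b
      unfolding a0_def using z0 sep that by (intro cSUP_least) auto
    define g' where "g' = {u + c *\<^sub>R (x0, a0) | u c. u \<in> g}"
    have "subspace g'"
      unfolding subspace_def
    proof (intro conjI ballI allI)
      have "0 + 0 *\<^sub>R (x0, a0) \<in> g'" unfolding g'_def using subspace_0[OF g] by blast
      then show "0 \<in> g'" by (simp add: zero_prod_def)
    next
      fix u v assume "u \<in> g'" "v \<in> g'"
      then obtain u' c v' d where "u' \<in> g" "v' \<in> g" and e: "u = u' + c *\<^sub>R (x0, a0)" "v = v' + d *\<^sub>R (x0, a0)"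
        unfolding g'_def by blast
      then have "u' + v' \<in> g" using g by (blast intro: subspace_add)
      moreover have "u + v = (u' + v') + (c + d) *\<^sub>R (x0, a0)"
        unfolding e scaleR_add_left by (simp only: ac_simps)
      ultimately show "u + v \<in> g'" unfolding g'_def by blast
    next
      fix d :: real and u assume "u \<in> g'"
      then obtain u' c where "u' \<in> g" and e: "u = u' + c *\<^sub>R (x0, a0)" unfolding g'_def by blast
      then have "d *\<^sub>R u' \<in> g" using g by (blast intro: subspace_scale)
      moreover have "d *\<^sub>R u = d *\<^sub>R u' + (d * c) *\<^sub>R (x0, a0)" unfolding e by (simp only: scaleR_add_right scaleR_scaleR)
      ultimately show "d *\<^sub>R u \<in> g'" unfolding g'_def by blast
    qed
    moreover have gg': "g \<subseteq> g'"
    proof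
      fix u assume "u \<in> g"
      then have "u + 0 *\<^sub>R (x0, a0) \<in> g'" unfolding g'_def by blast
      then show "u \<in> g'" by (simp add: zero_prod_def[symmetric])
    qed
    moreover have "\<forall>(x, a)\<in>g'. a \<le> p x"
    proof (clarify)
      fix x a assume "(x, a) \<in> g'"
      then obtain y b c where yb: "(y, b) \<in> g" and e: "x = y + c *\<^sub>R x0" "a = b + c * a0"
        unfolding g'_def by auto
      have sc: "(y /\<^sub>R d, b / d) \<in> g" for d
        using subspace_scale[OF g yb, of "1 / d"] by (simp add: divide_inverse mult.commute)
      consider "c = 0" | "c > 0" | "c < 0" by linarith
      then show "a \<le> p x"
      proof cases
        case 1 then show ?thesis using gp yb e by simp
      next
        case 2
        have "c * a0 \<le> c * (p (y /\<^sub>R c + x0) - b / c)" using hi[OF sc[of c]] 2 by simp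
        also have "\<dots> = p (c *\<^sub>R (y /\<^sub>R c + x0)) - b" using 2 p_scale[of c "y /\<^sub>R c + x0"] by (simp only: right_diff_distrib less_imp_le) simp
        also have "c *\<^sub>R (y /\<^sub>R c + x0) = x" using 2 e by (simp add: algebra_simps)
        finally show ?thesis using e by simp
      next
        case 3
        have "(-c) * (b / (-c) - p (y /\<^sub>R (-c) - x0)) \<le> (-c) * a0" using lo[OF sc[of "-c"]] 3
          by (intro mult_left_mono) auto
        moreover have "(-c) * (b / (-c) - p (y /\<^sub>R (-c) - x0)) = b - p ((-c) *\<^sub>R (y /\<^sub>R (-c) - x0))"
          using 3 by (subst p_scale) (auto simp: algebra_simps)
        moreover have "(-c) *\<^sub>R (y /\<^sub>R (-c) - x0) = x" using 3 e by (simp add: algebra_simps)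
        ultimately show ?thesis using e by simp
      qed
    qed
    ultimately have "g' \<in> \<G>" unfolding \<G>_def using gS by auto
    then have "g' = g" using max gg' by blast
    moreover have "(0, 0) + 1 *\<^sub>R (x0, a0) \<in> g'" unfolding g'_def using z0 by blast
    ultimately show False using no by auto
  qed
  have uniq: "a = b" if "(x, a) \<in> g" "(x, b) \<in> g" for x a b
  proof -
    have z: "p 0 = 0" using p_scale[of 0 0] by simp
    have "(x, a) - (x, b) \<in> g" "(x, b) - (x, a) \<in> g" using that g by (blast intro: subspace_diff)+
    then show ?thesis using gp[of 0 "a - b"] gp[of 0 "b - a"] z by simp
  qed
  define F where "F x = (THE a. (x, a) \<in> g)" for x
  have F: "(x, F x) \<in> g" for x
    unfolding F_def using total[of x] uniq by (metis theI)
  have Feq: "F x = a" if "(x, a) \<in> g" for x a using F uniq that by blast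
  have "linear F"
  proof (rule linearI)
    show "F (x + y) = F x + F y" for x y using subspace_add[OF g F[of x] F[of y]] by (intro Feq) simp
    show "F (c *\<^sub>R x) = c *\<^sub>R F x" for c x using subspace_scale[OF g F[of x], of c] by (intro Feq) simp
  qed
  then show thesis using that[of F] Feq gS gp F by blast
qed

lemma Hahn_Banach_norm:
  fixes f :: "'v::real_normed_vector \<Rightarrow> real"
  assumes S: "subspace S"
    and f_add: "\<And>x y. x \<in> S \<Longrightarrow> y \<in> S \<Longrightarrow> f (x + y) = f x + f y"
    and f_scale: "\<And>c x. x \<in> S \<Longrightarrow> f (c *\<^sub>R x) = c * f x"
    and f_le: "\<And>x. x \<in> S \<Longrightarrow> \<bar>f x\<bar> \<le> B * norm x" and "0 \<le> B"
  obtains F where "linear F" "\<And>x. x \<in> S \<Longrightarrow> F x = f x" "\<And>x. \<bar>F x\<bar> \<le> B * norm x"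
proof -
  obtain F where F: "linear F" "\<And>x. x \<in> S \<Longrightarrow> F x = f x" "\<And>x. F x \<le> B * norm x"
  proof (rule Hahn_Banach_sublinear[where p = "\<lambda>x. B * norm x" and S = S and f = f])
    show "B * norm (x + y) \<le> B * norm x + B * norm y" for x y :: 'v
      using mult_left_mono[OF norm_triangle_ineq \<open>0 \<le> B\<close>, of x y] by (simp add: algebra_simps)
    show "f x \<le> B * norm x" if "x \<in> S" for x using f_le[OF that] by simp
  qed (use S f_add f_scale in \<open>auto simp: algebra_simps\<close>)
  have "- F x \<le> B * norm x" for x using F(3)[of "- x"] F(1) by (simp add: linear_neg)
  then have "\<bar>F x\<bar> \<le> B * norm x" for x using F(3)[of x] by (simp add: abs_le_iff)
  then show thesis using that F by blast
qed

lemma norming_functional: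
  fixes x :: "'v::real_normed_vector"
  obtains F where "linear F" "F x = norm x" "\<And>y. \<bar>F y\<bar> \<le> norm y"
proof -
  have "subspace (span {x})" by simp
  define f where "f y = (if x = 0 then 0 else (THE c. y = c *\<^sub>R x) * norm x)" for y
  have f: "f (c *\<^sub>R x) = c * norm x" for c
    by (auto simp: f_def intro!: the_equality)
  obtain F where "linear F" "\<And>y. y \<in> span {x} \<Longrightarrow> F y = f y" "\<And>y. \<bar>F y\<bar> \<le> 1 * norm y"
  proof (rule Hahn_Banach_norm[where S = "span {x}" and f = f and B = 1])
    show "f (u + v) = f u + f v" if "u \<in> span {x}" "v \<in> span {x}" for u v
    proof -
      obtain c d where "u = c *\<^sub>R x" "v = d *\<^sub>R x" using \<open>u \<in> _\<close> \<open>v \<in> _\<close> by (auto simp: span_singleton)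
      then show ?thesis using f[of "c + d"] f by (simp add: algebra_simps)
    qed
    show "f (c *\<^sub>R u) = c * f u" if "u \<in> span {x}" for c u
    proof -
      obtain d where "u = d *\<^sub>R x" using \<open>u \<in> _\<close> by (auto simp: span_singleton)
      then show ?thesis using f[of "c * d"] f by simp
    qed
    show "\<bar>f u\<bar> \<le> 1 * norm u" if "u \<in> span {x}" for u
      using that f by (auto simp: span_singleton abs_mult)
  qed auto
  then show thesis using that[of F] f[of 1] by (metis mult_1 scaleR_one span_base singletonI)
qed

text \<open>If no point of S is closer to x than e, then the coefficient of x on the span of x and S
  is bounded by 1 / e; such an e exists because S is closed.\<close>

lemma separating_functional:
  fixes x :: "'v::real_normed_vector"
  assumes S: "subspace S" "closed S" and "x \<notin> S"
  obtains F B where "linear F" "F x \<noteq> 0" "\<And>y. y \<in> S \<Longrightarrow> F y = 0" "\<And>y. \<bar>F y\<bar> \<le> B * norm y"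
proof -
  obtain e where e: "e > 0" "\<And>y. y \<in> S \<Longrightarrow> e \<le> dist y x"
    using assms by (metis closed_approachable not_le)
  have dec: "\<exists>c s. u = c *\<^sub>R x + s \<and> s \<in> S" if "u \<in> span (insert x S)" for u
    using that S by (metis span_breakdown_eq span_eq_iff diff_add_cancel add.commute)
  have uniq: "c = d" if "c *\<^sub>R x + s = d *\<^sub>R x + t" "s \<in> S" "t \<in> S" for c d s t
  proof (rule ccontr)
    assume "c \<noteq> d"
    have "(c - d) *\<^sub>R x = t - s" using that by (simp add: algebra_simps)
    then have "(1 / (c - d)) *\<^sub>R (t - s) = x" using \<open>c \<noteq> d\<close> by (metis divide_self_if eq_divide_eq right_minus_eq scaleR_one scaleR_scaleR times_divide_eq_left mult_1)
    then have "x \<in> S" using that S(1) by (metis subspace_diff subspace_scale)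
    then show False using assms by simp
  qed
  define f where "f u = (THE c. \<exists>s\<in>S. u = c *\<^sub>R x + s)" for u
  have f: "f (c *\<^sub>R x + s) = c" if "s \<in> S" for c s
    unfolding f_def using that uniq by (intro the_equality) blast+
  obtain F where F: "linear F" "\<And>y. y \<in> span (insert x S) \<Longrightarrow> F y = f y" "\<And>y. \<bar>F y\<bar> \<le> (1 / e) * norm y"
  proof (rule Hahn_Banach_norm[where S = "span (insert x S)" and f = f and B = "1 / e"])
    show "f (u + v) = f u + f v" if "u \<in> span (insert x S)" "v \<in> span (insert x S)" for u v
    proof -
      obtain c s d t where "u = c *\<^sub>R x + s" "v = d *\<^sub>R x + t" "s \<in> S" "t \<in> S" using dec \<open>u \<in> _\<close> \<open>v \<in> _\<close> by blast
      moreover have "s + t \<in> S" using calculation S by (simp add: subspace_add)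
      ultimately show ?thesis using f[of "s + t" "c + d"] f by (simp add: algebra_simps)
    qed
    show "f (c *\<^sub>R u) = c * f u" if u: "u \<in> span (insert x S)" for c u
    proof -
      obtain d t where "u = d *\<^sub>R x + t" "t \<in> S" using dec u by blast
      moreover have "c *\<^sub>R t \<in> S" using calculation S by (simp add: subspace_scale)
      ultimately show ?thesis using f[of "c *\<^sub>R t" "c * d"] f by (simp add: algebra_simps)
    qed
    show "\<bar>f u\<bar> \<le> (1 / e) * norm u" if u: "u \<in> span (insert x S)" for u
    proof -
      obtain d t where u': "u = d *\<^sub>R x + t" "t \<in> S" using dec u by blast
      show ?thesis
      proof (cases "d = 0")
        case False
        have "(- (1 / d)) *\<^sub>R t \<in> S" using u' S by (blast intro: subspace_scale)
        then have "e \<le> norm ((- (1 / d)) *\<^sub>R t - x)" using e by (metis dist_norm)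
        then have "\<bar>d\<bar> * e \<le> \<bar>d\<bar> * norm ((- (1 / d)) *\<^sub>R t - x)" by (simp add: mult_left_mono)
        also have "\<dots> = norm (d *\<^sub>R ((- (1 / d)) *\<^sub>R t - x))" by simp
        also have "d *\<^sub>R ((- (1 / d)) *\<^sub>R t - x) = - u" using False u' by (simp add: algebra_simps)
        also have "norm (- u) = norm u" by simp
        finally have "\<bar>d\<bar> * e \<le> norm u" .
        moreover have "f u = d" using f u' by simp
        ultimately show ?thesis using e by (simp add: field_simps)
      next
        case True
        then have "f u = 0" using u' f[of t 0] by simp
        then show ?thesis using e by simp
      qed
    qed
  qed (use e in auto)
  have "F x = 1" using F(2)[of x] f[of 0 1] S by (simp add: span_base subspace_0)
  moreover have "F y = 0" if "y \<in> S" for y using F(2)[of y] f[of y 0] that by (simp add: span_base)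
  ultimately show thesis using that[of F "1 / e"] F by simp
qed

section \<open>The unitized operator algebra\<close>

interpretation blinfun_compose: bounded_bilinear "(o\<^sub>L)"
  by (rule bounded_bilinear_blinfun_compose)

lemma blinfun_compose_assoc: "(a o\<^sub>L b) o\<^sub>L c = a o\<^sub>L (b o\<^sub>L c)"
  by (rule blinfun_eqI) simp

text \<open>A unit is adjoined because real_normed_algebra_1 demands norm 1 = 1, which fails for the
  operators on the zero space.\<close>

typedef (overloaded) 'a uop = "UNIV :: (real \<times> ('a::banach \<Rightarrow>\<^sub>L 'a)) set" by simp

setup_lifting type_definition_uop

instantiation uop :: (banach) real_vector
begin
lift_definition zero_uop :: "'a uop" is "0" .
lift_definition plus_uop :: "'a uop \<Rightarrow> 'a uop \<Rightarrow> 'a uop" is "(+)" .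
lift_definition minus_uop :: "'a uop \<Rightarrow> 'a uop \<Rightarrow> 'a uop" is "(-)" .
lift_definition uminus_uop :: "'a uop \<Rightarrow> 'a uop" is "uminus" .
lift_definition scaleR_uop :: "real \<Rightarrow> 'a uop \<Rightarrow> 'a uop" is "scaleR" .
instance by standard (transfer; simp add: algebra_simps)+
end

instantiation uop :: (banach) real_normed_algebra_1
begin
lift_definition one_uop :: "'a uop" is "(1, 0)" .
lift_definition times_uop :: "'a uop \<Rightarrow> 'a uop \<Rightarrow> 'a uop"
  is "\<lambda>(c, T) (d, S). (c * d, c *\<^sub>R S + d *\<^sub>R T + (T o\<^sub>L S))" .
lift_definition norm_uop :: "'a uop \<Rightarrow> real" is "\<lambda>(c, T). \<bar>c\<bar> + norm T" .
definition dist_uop :: "'a uop \<Rightarrow> 'a uop \<Rightarrow> real" where "dist_uop x y = norm (x - y)"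
definition sgn_uop :: "'a uop \<Rightarrow> 'a uop" where "sgn_uop x = x /\<^sub>R norm x"
definition uniformity_uop :: "('a uop \<times> 'a uop) filter"
  where "uniformity_uop = (INF e\<in>{0 <..}. principal {(x, y). dist x y < e})"
definition open_uop :: "'a uop set \<Rightarrow> bool"
  where "open_uop S = (\<forall>x\<in>S. \<forall>\<^sub>F (x', y) in uniformity. x' = x \<longrightarrow> y \<in> S)"
instance
proof
  fix a b c :: "'a uop" and r :: real
  show "a * b * c = a * (b * c)"
    by transfer (auto simp: algebra_simps blinfun_compose.add_left blinfun_compose.add_right blinfun_compose.scaleR_left blinfun_compose.scaleR_right blinfun_compose_assoc)
  show "(a + b) * c = a * c + b * c"
    by transfer (auto simp: algebra_simps blinfun_compose.add_left)
  show "a * (b + c) = a * b + a * c"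
    by transfer (auto simp: algebra_simps blinfun_compose.add_right)
  show "1 * a = a" "a * 1 = a" by (transfer; auto)+
  show "(0::'a uop) \<noteq> 1" by transfer (simp add: zero_prod_def)
  show "r *\<^sub>R a * b = r *\<^sub>R (a * b)" "a * r *\<^sub>R b = r *\<^sub>R (a * b)"
    by (transfer; auto simp: algebra_simps blinfun_compose.scaleR_left blinfun_compose.scaleR_right)+
  show "dist a b = norm (a - b)" by (rule dist_uop_def)
  show "sgn a = a /\<^sub>R norm a" by (rule sgn_uop_def)
  show "(uniformity :: ('a uop \<times> 'a uop) filter) = (INF e\<in>{0 <..}. principal {(x, y). dist x y < e})"
    by (rule uniformity_uop_def)
  show "open S = (\<forall>x\<in>S. \<forall>\<^sub>F (x', y) in uniformity. x' = x \<longrightarrow> y \<in> S)" for S :: "'a uop set"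
    by (rule open_uop_def)
  show "(norm a = 0) = (a = 0)" by transfer (auto simp: zero_prod_def add_nonneg_eq_0_iff)
  show "norm (a + b) \<le> norm a + norm b"
  proof transfer
    fix a b :: "real \<times> ('a \<Rightarrow>\<^sub>L 'a)"
    show "(case a + b of (c, T) \<Rightarrow> \<bar>c\<bar> + norm T) \<le> (case a of (c, T) \<Rightarrow> \<bar>c\<bar> + norm T) + (case b of (c, T) \<Rightarrow> \<bar>c\<bar> + norm T)"
      using abs_triangle_ineq[of "fst a" "fst b"] norm_triangle_ineq[of "snd a" "snd b"] by (simp add: case_prod_beta)
  qed
  show "norm (r *\<^sub>R a) = \<bar>r\<bar> * norm a" by transfer (auto simp: abs_mult algebra_simps)
  show "norm (a * b) \<le> norm a * norm b"
  proof transfer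
    fix a b :: "real \<times> ('a \<Rightarrow>\<^sub>L 'a)"
    obtain c T d S where [simp]: "a = (c, T)" "b = (d, S)" by fastforce
    have "norm (c *\<^sub>R S + d *\<^sub>R T + (T o\<^sub>L S)) \<le> norm (c *\<^sub>R S) + norm (d *\<^sub>R T) + norm (T o\<^sub>L S)"
      by (metis add_right_mono norm_triangle_ineq order_trans)
    also have "\<dots> \<le> \<bar>c\<bar> * norm S + \<bar>d\<bar> * norm T + norm T * norm S"
      using norm_blinfun_compose[of T S] by simp
    finally show "(case (case a of (c, T) \<Rightarrow> \<lambda>(d, S). (c * d, c *\<^sub>R S + d *\<^sub>R T + (T o\<^sub>L S))) b of (c, T) \<Rightarrow> \<bar>c\<bar> + norm T)
      \<le> (case a of (c, T) \<Rightarrow> \<bar>c\<bar> + norm T) * (case b of (c, T) \<Rightarrow> \<bar>c\<bar> + norm T)"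
      by (auto simp: algebra_simps abs_mult)
  qed
  show "norm (1::'a uop) = 1" by transfer simp
qed
end

instance uop :: (banach) banach
proof
  fix X :: "nat \<Rightarrow> 'a uop" assume X: "Cauchy X"
  define c where "c n = fst (Rep_uop (X n))" for n
  define T where "T n = snd (Rep_uop (X n))" for n
  have nrm: "norm (X m - X n) = \<bar>c m - c n\<bar> + norm (T m - T n)" for m n
    unfolding c_def T_def by (simp add: norm_uop.rep_eq minus_uop.rep_eq case_prod_beta)
  have "Cauchy c"
  proof (rule CauchyI)
    fix e :: real assume "0 < e"
    then obtain M where M: "\<And>m n. m \<ge> M \<Longrightarrow> n \<ge> M \<Longrightarrow> norm (X m - X n) < e" using CauchyD[OF X] by blast
    have "norm (c m - c n) < e" if "m \<ge> M" "n \<ge> M" for m n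
      using M[OF that] unfolding nrm real_norm_def by (smt (verit) norm_ge_zero)
    then show "\<exists>M. \<forall>m\<ge>M. \<forall>n\<ge>M. norm (c m - c n) < e" by blast
  qed
  moreover have "Cauchy T"
  proof (rule CauchyI)
    fix e :: real assume "0 < e"
    then obtain M where M: "\<And>m n. m \<ge> M \<Longrightarrow> n \<ge> M \<Longrightarrow> norm (X m - X n) < e" using CauchyD[OF X] by blast
    have "norm (T m - T n) < e" if "m \<ge> M" "n \<ge> M" for m n
      using M[OF that] unfolding nrm by (smt (verit) abs_ge_zero)
    then show "\<exists>M. \<forall>m\<ge>M. \<forall>n\<ge>M. norm (T m - T n) < e" by blast
  qed
  ultimately obtain c0 T0 where lim: "c \<longlonglongrightarrow> c0" "T \<longlonglongrightarrow> T0"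
    by (meson Cauchy_convergent convergent_def)
  have "norm (X n - Abs_uop (c0, T0)) = \<bar>c n - c0\<bar> + norm (T n - T0)" for n
    unfolding c_def T_def by (simp add: norm_uop.rep_eq minus_uop.rep_eq Abs_uop_inverse case_prod_beta)
  moreover have "(\<lambda>n. \<bar>c n - c0\<bar> + norm (T n - T0)) \<longlonglongrightarrow> 0"
    using lim by (intro tendsto_add_zero tendsto_rabs_zero tendsto_norm_zero) (auto simp: LIM_zero_iff)
  ultimately have "X \<longlonglongrightarrow> Abs_uop (c0, T0)"
    by (subst LIM_zero_iff[symmetric], subst tendsto_norm_zero_iff[symmetric]) simp
  then show "convergent X" by (auto simp: convergent_def)
qed

section \<open>The action of the operator algebra on the space\<close>

lift_definition app :: "'a::banach uop \<Rightarrow> 'a \<Rightarrow> 'a" is "\<lambda>(c, T) x. c *\<^sub>R x + blinfun_apply T x" .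

lift_definition emb :: "('a::banach \<Rightarrow> 'a) \<Rightarrow> 'a uop" is "\<lambda>f. (0, Blinfun f)" .

lemma bounded_bilinear_app: "bounded_bilinear app"
proof
  show "app (a + a') b = app a b + app a' b" for a a' :: "'a uop" and b
    by transfer (auto simp: algebra_simps blinfun.add_left)
  show "app a (b + b') = app a b + app a b'" for a :: "'a uop" and b b'
    by transfer (auto simp: algebra_simps blinfun.add_right)
  show "app (r *\<^sub>R a) b = r *\<^sub>R app a b" for r and a :: "'a uop" and b
    by transfer (auto simp: algebra_simps blinfun.scaleR_left)
  show "app a (r *\<^sub>R b) = r *\<^sub>R app a b" for r and a :: "'a uop" and b
    by transfer (auto simp: algebra_simps blinfun.scaleR_right)
  have "norm (app a b) \<le> norm a * norm b * 1" for a :: "'a uop" and b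
  proof transfer
    fix a :: "real \<times> ('a \<Rightarrow>\<^sub>L 'a)" and b :: 'a
    obtain c T where a: "a = (c, T)" by fastforce
    have "norm (c *\<^sub>R b + blinfun_apply T b) \<le> \<bar>c\<bar> * norm b + norm T * norm b"
      using norm_triangle_ineq[of "c *\<^sub>R b" "blinfun_apply T b"] norm_blinfun[of T b] by simp
    then show "norm ((case a of (c, T) \<Rightarrow> \<lambda>x. c *\<^sub>R x + blinfun_apply T x) b) \<le> (case a of (c, T) \<Rightarrow> \<bar>c\<bar> + norm T) * norm b * 1"
      by (simp add: a algebra_simps)
  qed
  then show "\<exists>K. \<forall>(a::'a uop) b. norm (app a b) \<le> norm a * norm b * K" by blast
qed

interpretation app: bounded_bilinear app by (rule bounded_bilinear_app)

lemma norm_app_le: "norm (app T x) \<le> norm T * norm x"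
proof transfer
  fix a :: "real \<times> ('a \<Rightarrow>\<^sub>L 'a)" and b :: 'a
  obtain c T where a: "a = (c, T)" by fastforce
  have "norm (c *\<^sub>R b + blinfun_apply T b) \<le> \<bar>c\<bar> * norm b + norm T * norm b"
    using norm_triangle_ineq[of "c *\<^sub>R b" "blinfun_apply T b"] norm_blinfun[of T b] by simp
  then show "norm ((case a of (c, T) \<Rightarrow> \<lambda>x. c *\<^sub>R x + blinfun_apply T x) b) \<le> (case a of (c, T) \<Rightarrow> \<bar>c\<bar> + norm T) * norm b"
    by (simp add: a algebra_simps)
qed

lemma app_one [simp]: "app 1 x = x"
  by transfer simp

lemma app_mult [simp]: "app (S * T) x = app S (app T x)"
  by transfer (auto simp: algebra_simps blinfun.add_right blinfun.scaleR_right blinfun.add_left blinfun.scaleR_left)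

lemma app_emb: "bounded_linear f \<Longrightarrow> app (emb f) x = f x"
  by transfer (simp add: bounded_linear_Blinfun_apply)

lemma emb_mult: "bounded_linear f \<Longrightarrow> bounded_linear g \<Longrightarrow> emb f * emb g = emb (\<lambda>x. f (g x))"
  by transfer (auto intro!: blinfun_eqI simp: bounded_linear_Blinfun_apply bounded_linear_compose)

lemma emb_add: "bounded_linear f \<Longrightarrow> bounded_linear g \<Longrightarrow> emb f + emb g = emb (\<lambda>x. f x + g x)"
  by transfer (auto intro!: blinfun_eqI simp: bounded_linear_Blinfun_apply bounded_linear_add blinfun.add_left)

lemma emb_diff: "bounded_linear f \<Longrightarrow> bounded_linear g \<Longrightarrow> emb f - emb g = emb (\<lambda>x. f x - g x)"
  by transfer (auto intro!: blinfun_eqI simp: bounded_linear_Blinfun_apply bounded_linear_sub blinfun.diff_left)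

lemma emb_scaleR: "bounded_linear f \<Longrightarrow> r *\<^sub>R emb f = emb (\<lambda>x. r *\<^sub>R f x)"
  by transfer (auto intro!: blinfun_eqI simp: bounded_linear_Blinfun_apply bounded_linear_const_scaleR blinfun.scaleR_left)

lemma norm_emb_le:
  assumes "bounded_linear f" "0 \<le> B" "\<And>x. norm (f x) \<le> B * norm x"
  shows "norm (emb f) \<le> B"
  using assms by transfer (auto intro!: norm_blinfun_bound simp: bounded_linear_Blinfun_apply)

section \<open>Uniform boundedness, three lines, exponentials\<close>

lemma uniform_boundedness:
  fixes T :: "'i \<Rightarrow> 'a::banach \<Rightarrow> 'b::real_normed_vector"
  assumes T: "\<And>i. bounded_linear (T i)" and pw: "\<And>x. \<exists>K. \<forall>i. norm (T i x) \<le> K"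
  shows "\<exists>C. \<forall>i x. norm (T i x) \<le> C * norm x"
proof -
  define A where "A n = {x. \<forall>i. norm (T i x) \<le> real n}" for n :: nat
  have cl: "closed (A n)" for n
  proof -
    have "A n = (\<Inter>i. {x. norm (T i x) \<le> real n})" unfolding A_def by blast
    moreover have "closed {x. norm (T i x) \<le> real n}" for i
      by (intro closed_Collect_le continuous_intros bounded_linear.continuous_on[OF T])
    ultimately show ?thesis by auto
  qed
  have cover: "(\<Union>n. A n) = UNIV"
  proof -
    have "\<exists>n. x \<in> A n" for x
    proof -
      obtain K where "\<And>i. norm (T i x) \<le> K" using pw by blast
      then have "x \<in> A (nat \<lceil>K\<rceil>)" unfolding A_def using real_nat_ceiling_ge[of K] by (auto intro: order_trans)
      then show ?thesis ..
    qed
    then show ?thesis by blast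
  qed
  have "\<exists>n. interior (A n) \<noteq> {}"
  proof (rule ccontr)
    assume "\<not> ?thesis"
    then have "(euclidean :: 'a topology) interior_of (\<Union>(range A)) = {}"
    proof (intro Baire_category_alt)
      show "completely_metrizable_space (euclidean :: 'a topology) \<or> locally_compact_space (euclidean :: 'a topology) \<and> regular_space (euclidean :: 'a topology)"
        using completely_metrizable_space_euclidean by blast
      show "closedin euclidean T \<and> euclidean interior_of T = {}" if "T \<in> range A" for T :: "'a set"
        using that cl \<open>\<not> (\<exists>n. interior (A n) \<noteq> {})\<close> by auto
    qed simp
    then show False using cover by simp
  qed
  then obtain n x0 where "x0 \<in> interior (A n)" by blast
  then obtain e where e: "e > 0" "ball x0 e \<subseteq> A n" by (meson interior_subset mem_interior subset_trans)
  have "norm (T i x) \<le> (4 * n / e) * norm x" for i x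
  proof (cases "x = 0")
    case True then show ?thesis using linear_0[OF bounded_linear.linear[OF T]] by simp
  next
    case False
    define y where "y = (e / (2 * norm x)) *\<^sub>R x"
    have "norm y < e" using False e by (simp add: y_def)
    then have "x0 + y \<in> A n" "x0 \<in> A n" using e by (auto simp: subset_iff dist_norm)
    then have "norm (T i (x0 + y)) \<le> n" "norm (T i x0) \<le> n" unfolding A_def by auto
    moreover have "T i y = T i (x0 + y) - T i x0" by (simp add: bounded_linear.linear[OF T] linear_add)
    ultimately have "norm (T i y) \<le> 2 * n" using norm_triangle_ineq4[of "T i (x0 + y)" "T i x0"] by simp
    moreover have "norm (T i y) = (e / (2 * norm x)) * norm (T i x)"
      unfolding y_def using e by (simp add: bounded_linear.linear[OF T] linear_scale)
    ultimately show ?thesis using e False by (simp add: field_simps)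
  qed
  then show ?thesis by blast
qed

text \<open>The factor exp (d (z^2 - 1)) has modulus at most 1 on the strip and decays like exp (- d
  (Im z)^2), so the maximum principle applies on a tall rectangle; afterwards d tends to 0.\<close>

lemma three_lines_unit:
  assumes hol: "F holomorphic_on UNIV"
    and bd: "\<And>z. 0 \<le> Re z \<Longrightarrow> Re z \<le> 1 \<Longrightarrow> norm (F z) \<le> B"
    and F0: "\<And>z. Re z = 0 \<Longrightarrow> norm (F z) \<le> 1" and F1: "\<And>z. Re z = 1 \<Longrightarrow> norm (F z) \<le> 1"
    and \<xi>: "0 \<le> Re \<xi>" "Re \<xi> \<le> 1"
  shows "norm (F \<xi>) \<le> 1"
proof -
  have main: "norm (F \<xi>) * exp (d * Re (\<xi>\<^sup>2 - 1)) \<le> 1" if d: "d > 0" for d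
  proof -
    define G where "G z = F z * exp (complex_of_real d * (z\<^sup>2 - 1))" for z
    have nG: "norm (G z) = norm (F z) * exp (d * Re (z\<^sup>2 - 1))" for z
      unfolding G_def by (simp add: norm_mult norm_exp_eq_Re)
    have re: "Re (z\<^sup>2 - 1) \<le> - (Im z)\<^sup>2" if "0 \<le> Re z" "Re z \<le> 1" for z
    proof -
      have "Re (z\<^sup>2 - 1) = (Re z)\<^sup>2 - 1 - (Im z)\<^sup>2" by (simp add: Re_power2)
      moreover have "(Re z)\<^sup>2 \<le> 1" using that by (simp add: power_le_one)
      ultimately show ?thesis by simp
    qed
    \<comment> \<open>At this height the damping beats the bound B on the horizontal sides: |B|
      \<le> d R and R \<ge> 1 give |B| \<le> exp (d R^2).\<close>
    define R where "R = \<bar>Im \<xi>\<bar> + 1 + \<bar>B\<bar> / d"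
    have R1: "R \<ge> 1" "\<bar>Im \<xi>\<bar> \<le> R" "\<bar>B\<bar> \<le> d * R" unfolding R_def using d by (auto simp: field_simps)
    have BR: "\<bar>B\<bar> * exp (- d * R\<^sup>2) \<le> 1"
    proof -
      have "\<bar>B\<bar> \<le> d * R * 1" using R1 by simp
      also have "\<dots> \<le> d * R * R" using R1 d by (intro mult_left_mono) auto
      also have "d * R * R = d * R\<^sup>2" by (simp add: power2_eq_square)
      also have "d * R\<^sup>2 \<le> 1 + d * R\<^sup>2" by simp
      also have "\<dots> \<le> exp (d * R\<^sup>2)" by (rule exp_ge_add_one_self)
      finally show ?thesis by (simp add: exp_minus field_simps)
    qed
    have "norm (G \<xi>) \<le> 1"
    proof (rule maximum_modulus_frontier[of G "cbox (Complex 0 (-R)) (Complex 1 R)"])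
      have hG: "G holomorphic_on UNIV" unfolding G_def using hol by (intro holomorphic_intros)
      show "G holomorphic_on interior (cbox (Complex 0 (- R)) (Complex 1 R))"
        using hG holomorphic_on_subset by blast
      show "continuous_on (closure (cbox (Complex 0 (- R)) (Complex 1 R))) G"
        using hG holomorphic_on_imp_continuous_on continuous_on_subset by blast
      show "bounded (cbox (Complex 0 (- R)) (Complex 1 R))" by (rule bounded_cbox)
      show "\<xi> \<in> cbox (Complex 0 (- R)) (Complex 1 R)" using R1 \<xi> by (auto simp: in_cbox_complex_iff)
      fix z assume z: "z \<in> frontier (cbox (Complex 0 (- R)) (Complex 1 R))"
      then have z1: "0 \<le> Re z" "Re z \<le> 1" and z2: "Re z = 0 \<or> Re z = 1 \<or> \<bar>Im z\<bar> = R"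
        by (auto simp: frontier_cbox in_cbox_complex_iff in_box_complex_iff)
      have le1: "exp (d * Re (z\<^sup>2 - 1)) \<le> 1"
      proof -
        have "Re (z\<^sup>2 - 1) \<le> 0" using re[OF z1] by (meson order_trans neg_le_0_iff_le zero_le_power2)
        then show ?thesis using d by (simp add: mult_nonneg_nonpos)
      qed
      consider "norm (F z) \<le> 1" | "\<bar>Im z\<bar> = R" using z2 F0 F1 by blast
      then show "norm (G z) \<le> 1"
      proof cases
        case 1 then show ?thesis unfolding nG using le1 by (simp add: mult_le_one)
      next
        case 2
        then have "(Im z)\<^sup>2 = R\<^sup>2" by (metis power2_abs)
        then have "d * Re (z\<^sup>2 - 1) \<le> d * (- R\<^sup>2)" using re[OF z1] d by (intro mult_left_mono) auto
        then have "d * Re (z\<^sup>2 - 1) \<le> - d * R\<^sup>2" by simp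
        then have "norm (G z) \<le> \<bar>B\<bar> * exp (- d * R\<^sup>2)"
          unfolding nG using bd[OF z1] by (intro mult_mono) auto
        then show ?thesis using BR by simp
      qed
    qed
    then show ?thesis unfolding nG .
  qed
  have "((\<lambda>d. norm (F \<xi>) * exp (d * Re (\<xi>\<^sup>2 - 1))) \<longlongrightarrow> norm (F \<xi>) * exp (0 * Re (\<xi>\<^sup>2 - 1))) (at_right 0)"
    by (intro tendsto_intros)
  moreover have "eventually (\<lambda>d. norm (F \<xi>) * exp (d * Re (\<xi>\<^sup>2 - 1)) \<le> 1) (at_right 0)"
    using main by (auto simp: eventually_at_right_less eventually_at_filter)
  ultimately have "norm (F \<xi>) * exp (0 * Re (\<xi>\<^sup>2 - 1)) \<le> 1"
    by (rule tendsto_upperbound) simp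
  then show ?thesis by simp
qed

text \<open>After rescaling the strip to width 1, division by a b^z brings the boundary values down
  to 1.\<close>

lemma three_lines:
  assumes hol: "F holomorphic_on UNIV" and t: "t > 0" and b: "b > 0" and a: "a > 0"
    and bd: "\<And>z. 0 \<le> Re z \<Longrightarrow> Re z \<le> t \<Longrightarrow> norm (F z) \<le> B"
    and F0: "\<And>z. Re z = 0 \<Longrightarrow> norm (F z) \<le> a" and F1: "\<And>z. Re z = t \<Longrightarrow> norm (F z) \<le> a * b"
    and s: "0 \<le> s" "s \<le> t"
  shows "norm (F (of_real s)) \<le> a * exp (ln b * (s / t))"
proof -
  define G where "G z = F (of_real t * z) * exp (- of_real (ln b) * z) / of_real a" for z
  have nG: "norm (G z) = norm (F (of_real t * z)) * exp (- ln b * Re z) / a" for z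
    unfolding G_def using a by (simp add: norm_mult norm_divide norm_exp_eq_Re)
  have hF: "(\<lambda>z. F (of_real t * z)) holomorphic_on UNIV"
    using holomorphic_on_compose[of "\<lambda>z. of_real t * z" UNIV F] hol holomorphic_on_subset
    by (auto simp: o_def intro!: holomorphic_intros)
  have "norm (G (of_real (s / t))) \<le> 1"
  proof (rule three_lines_unit[of G "\<bar>B\<bar> * exp \<bar>ln b\<bar> / a"])
    show "G holomorphic_on UNIV" unfolding G_def using hF a by (intro holomorphic_intros) auto
    show "norm (G z) \<le> \<bar>B\<bar> * exp \<bar>ln b\<bar> / a" if "0 \<le> Re z" "Re z \<le> 1" for z
    proof -
      have "norm (F (of_real t * z)) \<le> \<bar>B\<bar>" using bd[of "of_real t * z"] that t by (simp add: mult_le_cancel_left2)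
      moreover have "- ln b * Re z \<le> \<bar>ln b\<bar>"
      proof -
        have "- ln b * Re z \<le> \<bar>ln b\<bar> * Re z" using that by (intro mult_right_mono) auto
        also have "\<dots> \<le> \<bar>ln b\<bar> * 1" using that by (intro mult_left_mono) auto
        finally show ?thesis by simp
      qed
      ultimately show ?thesis unfolding nG using a by (intro divide_right_mono mult_mono) auto
    qed
    show "norm (G z) \<le> 1" if "Re z = 0" for z
      unfolding nG using F0[of "of_real t * z"] that a by simp
    show "norm (G z) \<le> 1" if "Re z = 1" for z
      unfolding nG using F1[of "of_real t * z"] that a b by (simp add: exp_minus field_simps)
    show "0 \<le> Re (of_real (s / t) :: complex)" "Re (of_real (s / t) :: complex) \<le> 1" using s t by auto
  qed
  moreover have "of_real t * of_real (s / t) = (of_real s :: complex)" using t by simp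
  ultimately show ?thesis unfolding nG using a by (simp add: exp_minus field_simps)
qed

lemma exp_commutes:
  fixes X Y :: "'b::{real_normed_algebra_1, banach}"
  assumes "X * Y = Y * X"
  shows "exp X * Y = Y * exp X"
  unfolding exp_def
  by (simp add: suminf_mult[symmetric] suminf_mult2 summable_exp_generic power_commuting_commutes[OF assms])

lemma norm_exp_remainder:
  fixes X :: "'b::{real_normed_algebra_1, banach}"
  shows "norm (exp X - 1 - X) \<le> (norm X)\<^sup>2 * exp (norm X)"
proof -
  let ?g = "\<lambda>n. X ^ n /\<^sub>R fact n"
  let ?h = "\<lambda>n. norm X ^ n /\<^sub>R fact n"
  have s: "summable ?g" by (rule summable_exp_generic)
  have h: "summable ?h" by (rule summable_exp_generic)
  have "exp X = (\<Sum>n. ?g (n + 2)) + (\<Sum>n<2. ?g n)"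
    unfolding exp_def by (rule suminf_split_initial_segment[OF s])
  then have eq: "exp X - 1 - X = (\<Sum>n. ?g (n + 2))" by (simp add: numeral_2_eq_2)
  have bnd: "norm (?g (n + 2)) \<le> (norm X)\<^sup>2 * ?h n" for n
  proof -
    have "norm (?g (n + 2)) \<le> norm X ^ (n + 2) / fact (n + 2)"
      using norm_power_ineq[of X "n + 2"] by (simp add: divide_inverse mult.commute mult_left_mono)
    also have "\<dots> \<le> norm X ^ (n + 2) / fact n" by (intro divide_left_mono fact_mono) auto
    also have "\<dots> = (norm X)\<^sup>2 * ?h n" by (simp add: divide_inverse power_add power2_eq_square ac_simps)
    finally show ?thesis .
  qed
  have sm: "summable (\<lambda>n. (norm X)\<^sup>2 * ?h n)" using h by (rule summable_mult)
  have "norm (\<Sum>n. ?g (n + 2)) \<le> (\<Sum>n. (norm X)\<^sup>2 * ?h n)"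
    by (rule norm_suminf_le[OF bnd sm])
  also have "\<dots> = (norm X)\<^sup>2 * exp (norm X)" unfolding exp_def by (rule suminf_mult[OF h])
  finally show ?thesis unfolding eq .
qed

section \<open>Hermitian operators with nonnegative spectrum\<close>

locale complex_banach =
  fixes J :: "'a::banach \<Rightarrow> 'a"
  assumes J: "complex_structure J"
begin

lemma linear_J: "linear J" and JJ: "J (J x) = - x"
  and norm_rot: "norm (cos t *\<^sub>R x + sin t *\<^sub>R J x) = norm x"
  using J by (auto simp: complex_structure_def)

lemma norm_J: "norm (J x) = norm x"
  using norm_rot[of "pi / 2" x] by simp

lemma bounded_linear_J: "bounded_linear J"
  using linear_J norm_J by (intro bounded_linear_intro[where K = 1]) (auto simp: linear_add linear_scale)

text \<open>The complex-linear functional with real part \<phi>; compatibility with multiplication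
  by i is \<open>cphi_J\<close>.\<close>

definition cphi :: "('a \<Rightarrow> real) \<Rightarrow> 'a \<Rightarrow> complex" where
  "cphi \<phi> x = Complex (\<phi> x) (- \<phi> (J x))"

lemma cphi_J: "linear \<phi> \<Longrightarrow> cphi \<phi> (J x) = \<i> * cphi \<phi> x"
  by (simp add: cphi_def complex_eq_iff JJ linear_neg)

text \<open>Rotating x by minus the argument of its value makes the value real and nonnegative, so
  that \<phi> alone computes it; rotations are isometric.\<close>

lemma norm_cphi_le:
  assumes "linear \<phi>" "\<And>y. \<bar>\<phi> y\<bar> \<le> norm y"
  shows "norm (cphi \<phi> x) \<le> norm x"
proof -
  define w where "w = cphi \<phi> x"
  define \<theta> where "\<theta> = Arg w"
  have re: "Re w = norm w * cos \<theta>" "Im w = norm w * sin \<theta>"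
    using rcis_cmod_Arg[of w] unfolding \<theta>_def by (metis Re_rcis, metis Im_rcis)
  have "\<phi> (cos (-\<theta>) *\<^sub>R x + sin (-\<theta>) *\<^sub>R J x) = cos \<theta> * Re w + sin \<theta> * Im w"
    using assms(1) by (simp add: linear_add linear_scale linear_diff w_def cphi_def)
  also have "\<dots> = norm w * ((cos \<theta>)\<^sup>2 + (sin \<theta>)\<^sup>2)" unfolding re by (simp only: power2_eq_square distrib_left mult_ac)
  also have "\<dots> = norm w" by simp
  finally have "norm w \<le> norm (cos (-\<theta>) *\<^sub>R x + sin (-\<theta>) *\<^sub>R J x)"
    using assms(2) by (metis abs_ge_self order_trans)
  then show ?thesis unfolding norm_rot w_def .
qed

lemma cphi_bounded_linear:
  assumes "linear \<phi>" "\<And>y. \<bar>\<phi> y\<bar> \<le> norm y"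
  shows "bounded_linear (cphi \<phi>)"
proof (rule bounded_linear_intro[where K = 1])
  show "cphi \<phi> (x + y) = cphi \<phi> x + cphi \<phi> y" for x y
    using assms(1) linear_J by (simp add: cphi_def complex_eq_iff linear_add)
  show "cphi \<phi> (r *\<^sub>R x) = r *\<^sub>R cphi \<phi> x" for r x
    using assms(1) linear_J by (simp add: cphi_def complex_eq_iff linear_scale)
  show "norm (cphi \<phi> x) \<le> norm x * 1" for x using norm_cphi_le[OF assms] by simp
qed

end

lemma emb_power_app: "bounded_linear f \<Longrightarrow> app (emb f ^ n) x = (f ^^ n) x"
  by (induction n) (auto simp: app_emb)

lemma app_exp_series: "app (exp X) x = (\<Sum>n. (1 / fact n) *\<^sub>R app (X ^ n) x)"
proof -
  have "app (exp X) x = (\<Sum>n. app (X ^ n /\<^sub>R fact n) x)"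
    unfolding exp_def by (rule bounded_linear.suminf[OF app.bounded_linear_left summable_exp_generic])
  then show ?thesis by (simp add: app.scaleR_left divide_inverse)
qed

section \<open>The entire operator function generated by a hermitian operator\<close>

locale hermitian_op = complex_banach +
  fixes D :: "'a \<Rightarrow> 'a"
  assumes bl_D: "bounded_linear D" and DJ: "D (J x) = J (D x)"
    and herm: "hermitian J D" and nonneg: "nonneg_spectrum J D"
begin

abbreviation "T \<equiv> emb D"
abbreviation "JT \<equiv> emb (\<lambda>x. J (D x))"

lemma bl_JD: "bounded_linear (\<lambda>x. J (D x))"
  using bounded_linear_compose[OF bounded_linear_J bl_D] .

lemma T_JT: "T * JT = JT * T"
  by (simp add: emb_mult bl_D bl_JD DJ)

lemma norm_exp_JT: "norm (app (exp (t *\<^sub>R JT)) x) \<le> norm x"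
proof -
  have comm: "(J ^^ n) ((D ^^ n) x) = ((\<lambda>x. J (D x)) ^^ n) x" for n x
  proof -
    have "(J ^^ n) (D y) = D ((J ^^ n) y)" for n y by (induction n) (auto simp: DJ)
    then show ?thesis
      by (induction n) auto
  qed
  have "app (exp (t *\<^sub>R JT)) x = expit J D t x"
    unfolding app_exp_series expit_def
    by (simp add: scaleR_power app.scaleR_left emb_power_app[OF bl_JD] comm)
  then show ?thesis using herm by (simp add: hermitian_def)
qed

text \<open>This is exp (z D). Multiplication by i is J, so the imaginary part of z acts through
  \<open>JT\<close>, which commutes with \<open>T\<close>.\<close>

definition U :: "complex \<Rightarrow> 'a uop" where
  "U z = exp (Re z *\<^sub>R T) * exp (Im z *\<^sub>R JT)"

lemma U_add: "U (z + w) = U z * U w"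
proof -
  have c: "exp (Im z *\<^sub>R JT) * exp (Re w *\<^sub>R T) = exp (Re w *\<^sub>R T) * exp (Im z *\<^sub>R JT)"
  proof -
    have "(Im z *\<^sub>R JT) * (Re w *\<^sub>R T) = (Re w *\<^sub>R T) * (Im z *\<^sub>R JT)" by (simp add: T_JT mult.commute)
    then have "exp (Im z *\<^sub>R JT) * (Re w *\<^sub>R T) = (Re w *\<^sub>R T) * exp (Im z *\<^sub>R JT)" by (rule exp_commutes)
    from exp_commutes[OF this[symmetric]] show ?thesis by simp
  qed
  have "U (z + w) = (exp (Re z *\<^sub>R T) * exp (Re w *\<^sub>R T)) * (exp (Im z *\<^sub>R JT) * exp (Im w *\<^sub>R JT))"
    unfolding U_def by (simp add: scaleR_add_left exp_add_commuting)
  also have "\<dots> = exp (Re z *\<^sub>R T) * (exp (Re w *\<^sub>R T) * exp (Im z *\<^sub>R JT)) * exp (Im w *\<^sub>R JT)" by (simp add: mult.assoc)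
  also have "\<dots> = U z * U w" unfolding c[symmetric] U_def by (simp add: mult.assoc)
  finally show ?thesis .
qed

lemma U_of_real: "U (of_real t) = exp (t *\<^sub>R T)"
  by (simp add: U_def)

lemma U_imag: "Re z = 0 \<Longrightarrow> U z = exp (Im z *\<^sub>R JT)"
  by (simp add: U_def)

text \<open>The imaginary part of z contributes a factor exp (i r D), a contraction because D is
  hermitian. Bounds on the real axis thereby hold on whole vertical lines, as Cauchy's inequality
  and the three lines theorem require.\<close>

lemma norm_U_vertical: "norm (app (U z) x) \<le> norm (app (U (of_real (Re z))) x)"
proof -
  have "z = \<i> * of_real (Im z) + of_real (Re z)" by (simp add: complex_eq_iff)
  then have "U z = U (\<i> * of_real (Im z)) * U (of_real (Re z))" using U_add by metis
  then show ?thesis using norm_exp_JT by (simp add: U_imag)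
qed

text \<open>The real derivative in direction w is U z (Re w D + Im w J D), and \<open>cphi\<close>
  turns J into multiplication by i. So the derivative is multiplication by the complex number w,
  which is the Cauchy-Riemann condition.\<close>

lemma U_derivative:
  assumes "linear \<phi>" "\<And>y. \<bar>\<phi> y\<bar> \<le> norm y"
  shows "((\<lambda>z. cphi \<phi> (app (U z) x)) has_field_derivative cphi \<phi> (app (U z) (D x))) (at z)"
proof -
  have d1: "((\<lambda>z. exp (Re z *\<^sub>R T)) has_derivative (\<lambda>w. Re w *\<^sub>R (exp (Re z *\<^sub>R T) * T))) (at z)"
    using has_derivative_compose[OF bounded_linear_imp_has_derivative[OF bounded_linear_Re, of "at z"]
        exp_scaleR_has_vector_derivative_right[of T "Re z" UNIV, unfolded has_vector_derivative_def]] .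
  have d2: "((\<lambda>z. exp (Im z *\<^sub>R JT)) has_derivative (\<lambda>w. Im w *\<^sub>R (exp (Im z *\<^sub>R JT) * JT))) (at z)"
    using has_derivative_compose[OF bounded_linear_imp_has_derivative[OF bounded_linear_Im, of "at z"]
        exp_scaleR_has_vector_derivative_right[of JT "Im z" UNIV, unfolded has_vector_derivative_def]] .
  have dU: "(U has_derivative (\<lambda>w. exp (Re z *\<^sub>R T) * (Im w *\<^sub>R (exp (Im z *\<^sub>R JT) * JT))
      + (Re w *\<^sub>R (exp (Re z *\<^sub>R T) * T)) * exp (Im z *\<^sub>R JT))) (at z)"
    unfolding U_def using has_derivative_mult[OF d1 d2] .
  have c: "T * exp (Im z *\<^sub>R JT) = exp (Im z *\<^sub>R JT) * T"
  proof -
    have "T * (Im z *\<^sub>R JT) = (Im z *\<^sub>R JT) * T" by (simp add: T_JT)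
    from exp_commutes[OF this[symmetric]] show ?thesis by simp
  qed
  have dU': "(U has_derivative (\<lambda>w. Im w *\<^sub>R (U z * JT) + Re w *\<^sub>R (U z * T))) (at z)"
    using dU unfolding U_def by (simp add: mult.assoc c)
  have bl: "bounded_linear (\<lambda>X. cphi \<phi> (app X x))"
    using bounded_linear_compose[OF cphi_bounded_linear[OF assms] app.bounded_linear_left] .
  have "((\<lambda>z. cphi \<phi> (app (U z) x)) has_derivative
      (\<lambda>w. cphi \<phi> (app (Im w *\<^sub>R (U z * JT) + Re w *\<^sub>R (U z * T)) x))) (at z)"
    using has_derivative_compose[OF dU' bounded_linear_imp_has_derivative[OF bl]] .
  moreover have "cphi \<phi> (app (Im w *\<^sub>R (U z * JT) + Re w *\<^sub>R (U z * T)) x) = cphi \<phi> (app (U z) (D x)) * w" for w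
  proof -
    have cJ: "app (U z) (J y) = J (app (U z) y)" for y
    proof -
      have "emb J * T = T * emb J" "emb J * JT = JT * emb J"
        by (simp_all add: emb_mult bl_D bl_JD bounded_linear_J DJ)
      then have "emb J * (Re z *\<^sub>R T) = (Re z *\<^sub>R T) * emb J" "emb J * (Im z *\<^sub>R JT) = (Im z *\<^sub>R JT) * emb J" by simp_all
      then have "emb J * U z = U z * emb J"
        unfolding U_def using exp_commutes by (metis mult.assoc)
      then have "app (emb J * U z) y = app (U z * emb J) y" by simp
      then show ?thesis by (simp add: app_emb bounded_linear_J)
    qed
    have "cphi \<phi> (app (Im w *\<^sub>R (U z * JT) + Re w *\<^sub>R (U z * T)) x)
        = Im w *\<^sub>R cphi \<phi> (J (app (U z) (D x))) + Re w *\<^sub>R cphi \<phi> (app (U z) (D x))"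
      using bounded_linear.linear[OF cphi_bounded_linear[OF assms]]
      by (simp add: app.add_left app.scaleR_left app_emb bl_D bl_JD cJ linear_add linear_scale)
    also have "\<dots> = cphi \<phi> (app (U z) (D x)) * w"
      unfolding cphi_J[OF assms(1)] by (simp add: complex_eq_iff algebra_simps)
    finally show ?thesis .
  qed
  ultimately show ?thesis by (simp add: has_field_derivative_def)
qed

end

lemma entireI: "(\<And>z. (f has_field_derivative f' z) (at z)) \<Longrightarrow> f holomorphic_on UNIV"
  by (auto simp: holomorphic_on_open)

section \<open>The semigroup exp (- t D)\<close>

context hermitian_op begin

definition S :: "real \<Rightarrow> 'a \<Rightarrow> 'a" where "S t x = app (exp ((- t) *\<^sub>R T)) x"

lemma S_0 [simp]: "S 0 x = x"
  by (simp add: S_def)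

lemma S_add: "S (s + t) x = S s (S t x)"
proof -
  have "exp ((- (s + t)) *\<^sub>R T) = exp ((- s) *\<^sub>R T) * exp ((- t) *\<^sub>R T)"
    unfolding minus_add_distrib scaleR_add_left by (rule exp_add_commuting) simp
  then show ?thesis by (simp add: S_def)
qed

lemma linear_S: "linear (S t)"
  unfolding S_def by (rule bounded_linear.linear[OF app.bounded_linear_right])

lemma bounded_linear_S: "bounded_linear (S t)"
  unfolding S_def by (rule app.bounded_linear_right)

lemma S_D: "S t (D x) = D (S t x)"
proof -
  have "exp ((- t) *\<^sub>R T) * T = T * exp ((- t) *\<^sub>R T)" by (rule exp_commutes) simp
  then have "app (exp ((- t) *\<^sub>R T) * T) x = app (T * exp ((- t) *\<^sub>R T)) x" by simp
  then show ?thesis by (simp add: S_def app_emb bl_D)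
qed

lemma norm_S_growth: "0 \<le> t \<Longrightarrow> norm (S t x) \<le> exp (norm T * t) * norm x"
proof -
  assume t: "0 \<le> t"
  have "norm (exp ((- t) *\<^sub>R T)) \<le> exp (norm ((- t) *\<^sub>R T))" by (rule norm_exp)
  also have "\<dots> = exp (norm T * t)" using t by (simp add: mult.commute)
  finally show ?thesis unfolding S_def using norm_app_le[of "exp ((- t) *\<^sub>R T)" x]
    by (meson mult_right_mono norm_ge_zero order_trans)
qed

lemma U_neg: "U (- of_real t) = exp ((- t) *\<^sub>R T)"
  using U_of_real[of "- t"] by simp

lemma norm_U_neg: "norm (app (U (- z)) x) \<le> norm (S (Re z) x)"
  using norm_U_vertical[of "- z" x] U_neg[of "Re z"] by (simp add: S_def)

text \<open>The factor exp (- w z) compensates growth of rate w. Each differentiation applies - (D +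
  w) to the vector, so all derivatives are again orbits of this form.\<close>

lemma orbit_holomorphic:
  assumes "linear \<phi>" "\<And>y. \<bar>\<phi> y\<bar> \<le> norm y"
  shows "((\<lambda>z. exp (- (of_real w * z)) * cphi \<phi> (app (U (- z)) x)) has_field_derivative
     - (exp (- (of_real w * z)) * cphi \<phi> (app (U (- z)) (D x + w *\<^sub>R x)))) (at z)"
proof -
  have "((\<lambda>z. cphi \<phi> (app (U (- z)) x)) has_field_derivative cphi \<phi> (app (U (- z)) (D x)) * (- 1)) (at z)"
    by (rule DERIV_chain2[OF U_derivative[OF assms]]) (auto intro!: derivative_eq_intros)
  moreover have "cphi \<phi> (app (U (- z)) (D x + w *\<^sub>R x)) = cphi \<phi> (app (U (- z)) (D x)) + of_real w * cphi \<phi> (app (U (- z)) x)"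
    using bounded_linear.linear[OF cphi_bounded_linear[OF assms]]
    by (simp add: app.add_right app.scaleR_right linear_add linear_scale scaleR_conv_of_real)
  ultimately show ?thesis
    by (auto intro!: derivative_eq_intros simp: algebra_simps)
qed

text \<open>Cauchy's inequality on the circle of radius t about t, which stays in the right half-plane.\<close>

lemma decay_aux:
  assumes w: "\<And>t x. 0 \<le> t \<Longrightarrow> norm (S t x) \<le> exp (w * t) * norm x" and t: "t > 0"
  shows "norm (S t (((\<lambda>x. D x + w *\<^sub>R x) ^^ n) x)) \<le> exp (w * t) * (fact n / t ^ n * norm x)"
proof -
  define H where "H x = D x + w *\<^sub>R x" for x
  obtain \<phi> where \<phi>: "linear \<phi>" "\<phi> (S t ((H ^^ n) x)) = norm (S t ((H ^^ n) x))" "\<And>y. \<bar>\<phi> y\<bar> \<le> norm y"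
    using norming_functional by metis
  define f :: "nat \<Rightarrow> complex \<Rightarrow> complex" where "f m z = (-1) ^ m * (exp (- (of_real w * z)) * cphi \<phi> (app (U (- z)) ((H ^^ m) x)))" for m z
  have der: "(f m has_field_derivative f (Suc m) z) (at z)" for m z
    unfolding f_def using DERIV_cmult[OF orbit_holomorphic[OF \<phi>(1,3), of w "(H ^^ m) x" z], of "(- 1) ^ m"]
    by (simp add: H_def)
  have "(deriv ^^ m) (f 0) = f m" for m
    by (induction m) (auto intro!: ext DERIV_imp_deriv der)
  moreover have "norm ((deriv ^^ n) (f 0) (of_real t)) \<le> fact n * norm x / t ^ n"
  proof (rule Cauchy_inequality)
    have hol: "f 0 holomorphic_on UNIV"
      by (rule entireI[OF der])
    show "f 0 holomorphic_on ball (of_real t) t" using hol holomorphic_on_subset by blast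
    show "continuous_on (cball (of_real t) t) (f 0)"
      using hol holomorphic_on_imp_continuous_on continuous_on_subset by blast
    fix z :: complex assume "norm (of_real t - z) = t"
    then have re: "0 \<le> Re z" using abs_Re_le_cmod[of "of_real t - z"] by simp
    have "norm (f 0 z) = exp (- (w * Re z)) * norm (cphi \<phi> (app (U (- z)) x))"
      unfolding f_def by (simp add: norm_mult norm_exp_eq_Re)
    also have "\<dots> \<le> exp (- (w * Re z)) * norm (S (Re z) x)"
      by (intro mult_left_mono order_trans[OF norm_cphi_le[OF \<phi>(1,3)] norm_U_neg]) simp
    also have "\<dots> \<le> exp (- (w * Re z)) * (exp (w * Re z) * norm x)" using w[OF re] by (intro mult_left_mono) auto
    also have "\<dots> = norm x" by (simp add: exp_minus)
    finally show "norm (f 0 z) \<le> norm x" .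
  qed (use t in auto)
  ultimately have "norm (f n (of_real t)) \<le> fact n / t ^ n * norm x" by simp
  moreover have "norm (f n (of_real t)) = exp (- (w * t)) * norm (cphi \<phi> (S t ((H ^^ n) x)))"
    unfolding f_def S_def U_neg by (simp add: norm_mult norm_power norm_exp_eq_Re)
  moreover have "norm (S t ((H ^^ n) x)) \<le> norm (cphi \<phi> (S t ((H ^^ n) x)))"
    using abs_Re_le_cmod[of "cphi \<phi> (S t ((H ^^ n) x))"] \<phi>(2) by (simp add: cphi_def)
  ultimately have "exp (- (w * t)) * norm (S t ((H ^^ n) x)) \<le> fact n / t ^ n * norm x"
    by (smt (verit) exp_ge_zero mult_left_mono)
  then have "norm (S t ((H ^^ n) x)) \<le> exp (w * t) * (fact n / t ^ n * norm x)"
    by (simp add: exp_minus field_simps)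
  moreover have "H = (\<lambda>x. D x + w *\<^sub>R x)" by (simp add: H_def fun_eq_iff)
  ultimately show ?thesis by simp
qed

text \<open>Logarithmic convexity of the norm along an orbit: on the line Re z = r the orbit is
  bounded by \<open>norm (S r x)\<close>, so the three lines theorem interpolates between r = 0 and
  r = t.\<close>

lemma S_interpolation:
  assumes s: "0 \<le> s" "s \<le> t" and t: "0 < t" and a: "0 < a" and b: "0 < b"
    and x: "norm x \<le> a" "norm (S t x) \<le> a * b"
  shows "norm (S s x) \<le> a * exp (ln b * (s / t))"
proof -
  obtain \<phi> where \<phi>: "linear \<phi>" "\<phi> (S s x) = norm (S s x)" "\<And>y. \<bar>\<phi> y\<bar> \<le> norm y"
    using norming_functional by metis
  define F where "F z = exp (- (of_real 0 * z)) * cphi \<phi> (app (U (- z)) x)" for z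
  have nF: "norm (F z) \<le> norm (S (Re z) x)" for z
    using order_trans[OF norm_cphi_le[OF \<phi>(1,3)] norm_U_neg, of z x] by (simp add: F_def)
  have "norm (F (of_real s)) \<le> a * exp (ln b * (s / t))"
  proof (rule three_lines[of F t b a "exp (norm T * t) * norm x" s])
    show "F holomorphic_on UNIV" unfolding F_def
      by (rule entireI[OF orbit_holomorphic[OF \<phi>(1,3)]])
    show "norm (F z) \<le> exp (norm T * t) * norm x" if "0 \<le> Re z" "Re z \<le> t" for z
    proof -
      have "exp (norm T * Re z) \<le> exp (norm T * t)" using that by (simp add: mult_left_mono)
      then have "exp (norm T * Re z) * norm x \<le> exp (norm T * t) * norm x" by (intro mult_right_mono) auto
      then show ?thesis using nF[of z] norm_S_growth[OF that(1), of x] by linarith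
    qed
    show "norm (F z) \<le> a" if "Re z = 0" for z using nF[of z] that x by simp
    show "norm (F z) \<le> a * b" if "Re z = t" for z using nF[of z] that x by simp
  qed (use assms in auto)
  moreover have "norm (F (of_real s)) = norm (cphi \<phi> (S s x))"
    unfolding F_def S_def U_neg by simp
  moreover have "norm (S s x) \<le> norm (cphi \<phi> (S s x))"
    using abs_Re_le_cmod[of "cphi \<phi> (S s x)"] \<phi>(2) by (simp add: cphi_def)
  ultimately show ?thesis by linarith
qed

text \<open>The growth exponent is attained; were it positive, invertibility of D + w would force decay
  at one time, and the three lines theorem would propagate this to all times.\<close>

theorem contraction:
  assumes "0 \<le> t" shows "norm (S t x) \<le> norm x"
proof -
  define W where "W = {w. 0 \<le> w \<and> (\<forall>t\<ge>0. \<forall>x. norm (S t x) \<le> exp (w * t) * norm x)}"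
  have "norm T \<in> W" unfolding W_def using norm_S_growth by auto
  then have ne: "W \<noteq> {}" by blast
  have bdd: "bdd_below W" unfolding W_def by (rule bdd_belowI[of _ 0]) auto
  have "closed W"
  proof -
    have "W = {0..} \<inter> (\<Inter>t\<in>{0..}. \<Inter>x. {w. norm (S t x) \<le> exp (w * t) * norm x})" unfolding W_def by auto
    moreover have "closed {w. norm (S t x) \<le> exp (w * t) * norm x}" for t x
      by (intro closed_Collect_le continuous_intros)
    ultimately show ?thesis by (auto intro!: closed_INT closed_Int)
  qed
  then have \<omega>: "Inf W \<in> W" using closed_contains_Inf ne bdd by blast
  define w where "w = Inf W"
  have w0: "0 \<le> w" and w: "\<And>t x. 0 \<le> t \<Longrightarrow> norm (S t x) \<le> exp (w * t) * norm x"
    using \<omega> unfolding w_def W_def by auto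
  have "w = 0"
  proof (rule ccontr)
    assume "w \<noteq> 0"
    then have wp: "w > 0" using w0 by simp
    define H where "H x = D x + w *\<^sub>R x" for x
    have "bij (\<lambda>x. D x - (- w) *\<^sub>R x - 0 *\<^sub>R J x)"
      using nonneg wp unfolding nonneg_spectrum_def by (metis neg_less_0_iff_less)
    then have surj: "surj H" unfolding H_def by (simp add: bij_is_surj)
    \<comment> \<open>Since D + w is onto, \<open>decay_aux\<close> with n = 1 bounds these
      operators on every vector, and uniform boundedness yields a bound of order exp (w t) / t for
      \<open>S t\<close>. The cut-off at 0 lets the index run over all reals.\<close>
    define A where "A t x = (max 0 t * exp (- (w * max 0 t))) *\<^sub>R S (max 0 t) x" for t x
    have "\<exists>C. \<forall>t x. norm (A t x) \<le> C * norm x"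
    proof (rule uniform_boundedness)
      show "bounded_linear (A t)" for t
        unfolding A_def by (rule bounded_linear_compose[OF bounded_linear_scaleR_right bounded_linear_S])
      fix y
      obtain x where y: "y = H x" using surj by (metis surjD)
      have "norm (A t y) \<le> norm x" for t
      proof (cases "t > 0")
        case True
        have "norm (S t y) \<le> exp (w * t) * (1 / t * norm x)"
          using decay_aux[OF w True, of 1 x] unfolding y H_def by simp
        then have "t * exp (- (w * t)) * norm (S t y) \<le> t * exp (- (w * t)) * (exp (w * t) * (1 / t * norm x))"
          using True by (intro mult_left_mono) auto
        also have "\<dots> = norm x" using True by (simp add: exp_minus)
        finally show ?thesis using True by (simp add: A_def)
      qed (simp add: A_def)
      then show "\<exists>K. \<forall>t. norm (A t y) \<le> K" by blast
    qed
    then obtain C where C: "\<And>t x. norm (A t x) \<le> C * norm x" by blast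
    \<comment> \<open>At this time the factor |C| / \<open>t0\<close> is below 1 / 2.\<close>
    define t0 where "t0 = 2 * \<bar>C\<bar> + 1"
    have t0: "t0 > 0" unfolding t0_def by simp
    have half: "norm (S t0 x) \<le> exp (w * t0) * (1 / 2 * norm x)" for x
    proof -
      have "t0 * exp (- (w * t0)) * norm (S t0 x) \<le> \<bar>C\<bar> * norm x"
        using C[of t0 x] t0 unfolding A_def by (simp add: mult_right_mono order_trans[OF _ mult_right_mono[OF abs_ge_self]])
      also have "\<dots> \<le> (t0 / 2) * norm x" unfolding t0_def by (intro mult_right_mono) auto
      finally show ?thesis using t0 by (simp add: exp_minus field_simps)
    qed
    \<comment> \<open>Gaining a factor 1 / 2 over time \<open>t0\<close> lowers the growth rate by
      ln 2 / \<open>t0\<close>.\<close>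
    define c where "c = ln 2 / t0"
    have c: "c > 0" unfolding c_def using t0 by simp
    have short: "norm (S s x) \<le> exp ((w - c) * s) * norm x" if s: "0 \<le> s" "s \<le> t0" for s x
    proof (cases "x = 0")
      case True then show ?thesis using linear_0[OF linear_S] by simp
    next
      case False
      have "norm (S s x) \<le> norm x * exp (ln (exp (w * t0) / 2) * (s / t0))"
        using False t0 s half[of x] by (intro S_interpolation) (auto simp: mult_ac)
      also have "ln (exp (w * t0) / 2) * (s / t0) = (w - c) * s"
        unfolding c_def using t0 by (simp add: ln_div field_simps)
      finally show ?thesis by (simp add: mult.commute)
    qed
    have long: "norm (S (real k * t0 + s) x) \<le> exp ((w - c) * (real k * t0 + s)) * norm x" if s: "0 \<le> s" "s \<le> t0" for k s x
    proof (induction k arbitrary: x)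
      case 0 then show ?case using short s by simp
    next
      case (Suc k)
      have "norm (S (real (Suc k) * t0 + s) x) = norm (S (real k * t0 + s) (S t0 x))"
        by (simp add: S_add[symmetric] algebra_simps)
      also have "\<dots> \<le> exp ((w - c) * (real k * t0 + s)) * norm (S t0 x)" by (rule Suc.IH)
      also have "\<dots> \<le> exp ((w - c) * (real k * t0 + s)) * (exp ((w - c) * t0) * norm x)"
        using short[of t0 x] t0 by (intro mult_left_mono) auto
      also have "\<dots> = exp ((w - c) * (real (Suc k) * t0 + s)) * norm x"
        by (simp add: exp_add[symmetric] algebra_simps)
      finally show ?case .
    qed
    have all: "norm (S t x) \<le> exp ((w - c) * t) * norm x" if "0 \<le> t" for t x
    proof -
      define k where "k = nat \<lfloor>t / t0\<rfloor>"
      have "real k \<le> t / t0" "t / t0 < real k + 1" unfolding k_def using that t0 by auto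
      then have "0 \<le> t - real k * t0" "t - real k * t0 \<le> t0" using t0 by (auto simp: field_simps)
      then show ?thesis using long[of "t - real k * t0" k x] by simp
    qed
    define w' where "w' = max 0 (w - c)"
    have "norm (S t x) \<le> exp (w' * t) * norm x" if "0 \<le> t" for t x
    proof -
      have "(w - c) * t \<le> w' * t" unfolding w'_def using that by (intro mult_right_mono) auto
      then show ?thesis using all[OF that, of x] by (meson exp_le_cancel_iff mult_right_mono norm_ge_zero order_trans)
    qed
    then have "w' \<in> W" unfolding W_def w'_def by auto
    then have "w \<le> w'" unfolding w_def using bdd by (rule cInf_lower)
    then show False unfolding w'_def using wp c by auto
  qed
  then show ?thesis using w[OF assms, of x] by simp
qed

theorem decay:
  assumes "t > 0" shows "norm ((D ^^ n) (S t x)) \<le> fact n / t ^ n * norm x"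
proof -
  have "S t ((D ^^ n) y) = (D ^^ n) (S t y)" for y by (induction n) (auto simp: S_D)
  then show ?thesis using decay_aux[of 0 t n x] contraction assms by simp
qed

corollary decay1: "t > 0 \<Longrightarrow> norm (D (S t x)) \<le> norm x / t"
  using decay[of t 1 x] by simp

end

section \<open>Jordan identities\<close>

lemma eq_of_double:
  fixes a b c :: "'v::real_vector"
  assumes "a = b + b - c" "b = a + a - c" shows "a = b"
proof -
  have "a + a + a = a + (b + c)" using assms(2) by (simp add: algebra_simps)
  also have "\<dots> = b + (a + c)" by (simp add: algebra_simps)
  also have "a + c = b + b" using assms(1) by (simp add: algebra_simps)
  finally have "3 *\<^sub>R a = 3 *\<^sub>R b"
    using scaleR_left.add[of 1 "2::real" a] scaleR_left.add[of 1 "2::real" b] by (simp add: scaleR_2 add.assoc)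
  then show ?thesis by simp
qed

locale jb_triple = complex_banach J for J :: "'a::banach \<Rightarrow> 'a" +
  fixes tp :: "'a \<Rightarrow> 'a \<Rightarrow> 'a \<Rightarrow> 'a"
  assumes triple: "complex_JBstar_triple J tp"
begin

lemma lin1: "linear (\<lambda>x. tp x y z)"
  by (rule triple[unfolded complex_JBstar_triple_def, THEN conjunct2, THEN conjunct1, rule_format])

lemma lin2: "linear (\<lambda>y. tp x y z)"
  by (rule triple[unfolded complex_JBstar_triple_def, THEN conjunct2, THEN conjunct2, THEN conjunct1, rule_format])

lemma lin3: "linear (\<lambda>z. tp x y z)"
  by (rule triple[unfolded complex_JBstar_triple_def, THEN conjunct2, THEN conjunct2, THEN conjunct2, THEN conjunct1, rule_format])

lemma tp_J1: "tp (J x) y z = J (tp x y z)"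
  using triple unfolding complex_JBstar_triple_def by blast

lemma tp_J2: "tp x (J y) z = - J (tp x y z)"
  using triple unfolding complex_JBstar_triple_def by blast

lemma tp_sym: "tp x y z = tp z y x"
  using triple unfolding complex_JBstar_triple_def by blast

lemma cube_norm: "norm (tp x x x) = norm x ^ 3"
  using triple unfolding complex_JBstar_triple_def by blast

lemma JI: "tp a b (tp x y z) = tp (tp a b x) y z - tp x (tp b a y) z + tp x y (tp a b z)"
  using triple unfolding complex_JBstar_triple_def by blast

lemma JI_mid: "tp x (tp b a y) z = tp (tp a b x) y z + tp x y (tp a b z) - tp a b (tp x y z)"
  using JI[of a b x y z] by (simp add: algebra_simps)

lemma tp_J3: "tp x y (J z) = J (tp x y z)"
  by (metis tp_sym tp_J1)

definition K :: real where
  "K = max 1 (SOME K. \<forall>x y z. norm (tp x y z) \<le> K * norm x * norm y * norm z)"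

lemma K1: "1 \<le> K" and K0: "0 \<le> K" by (simp_all add: K_def)

lemma tp_bound: "norm (tp x y z) \<le> K * norm x * norm y * norm z"
proof -
  have "\<exists>K. \<forall>x y z. norm (tp x y z) \<le> K * norm x * norm y * norm z"
    using triple unfolding complex_JBstar_triple_def by blast
  then have "\<forall>x y z. norm (tp x y z) \<le> (SOME K. \<forall>x y z. norm (tp x y z) \<le> K * norm x * norm y * norm z) * norm x * norm y * norm z"
    by (rule someI_ex)
  then have "norm (tp x y z) \<le> (SOME K. \<forall>x y z. norm (tp x y z) \<le> K * norm x * norm y * norm z) * (norm x * norm y * norm z)"
    by (simp only: mult.assoc)
  also have "\<dots> \<le> K * (norm x * norm y * norm z)" unfolding K_def by (intro mult_right_mono) auto
  finally show ?thesis by (simp add: mult.assoc)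
qed

lemma tp_bound':
  assumes "norm x \<le> A" "norm y \<le> B" "norm z \<le> C"
  shows "norm (tp x y z) \<le> K * A * B * C"
proof -
  have "0 \<le> A" "0 \<le> B" "0 \<le> C" using assms norm_ge_zero order_trans by metis+
  then have "K * norm x * norm y * norm z \<le> K * A * B * C" using assms K0 by (intro mult_mono) auto
  then show ?thesis using tp_bound order_trans by blast
qed

lemmas tp_add1 = linear_add[OF lin1] and tp_add2 = linear_add[OF lin2] and tp_add3 = linear_add[OF lin3]
lemmas tp_diff1 = linear_diff[OF lin1] and tp_diff2 = linear_diff[OF lin2] and tp_diff3 = linear_diff[OF lin3]
lemmas tp_neg1 = linear_neg[OF lin1] and tp_neg2 = linear_neg[OF lin2] and tp_neg3 = linear_neg[OF lin3]
lemmas tp_scale1 = linear_scale[OF lin1] and tp_scale2 = linear_scale[OF lin2] and tp_scale3 = linear_scale[OF lin3]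
lemmas tp_0 [simp] = linear_0[OF lin1] linear_0[OF lin2] linear_0[OF lin3]
lemmas tp_lin = tp_add1 tp_add2 tp_add3 tp_diff1 tp_diff2 tp_diff3 tp_neg1 tp_neg2 tp_neg3 tp_scale1 tp_scale2 tp_scale3

lemma bl1: "bounded_linear (\<lambda>x. tp x y z)"
  using tp_bound[of _ y z] by (intro bounded_linear_intro[where K = "K * norm y * norm z"]) (simp_all add: tp_lin mult_ac)

lemma bl2: "bounded_linear (\<lambda>y. tp x y z)"
  using tp_bound[of x _ z] by (intro bounded_linear_intro[where K = "K * norm x * norm z"]) (simp_all add: tp_lin mult_ac)

lemma bl3: "bounded_linear (\<lambda>z. tp x y z)"
  using tp_bound[of x y] by (intro bounded_linear_intro[where K = "K * norm x * norm y"]) (simp_all add: tp_lin mult_ac)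

text \<open>In the names below D, Q, L and P stand for the operators tp a a, \<open>\<lambda>y. tp a y a\<close>,
  tp a b and tp (tp a a a) a.\<close>

lemma swap: "tp a y (tp a z a) = tp a z (tp a y a)" and mid: "tp a y (tp a z a) = tp a (tp y a z) a"
proof -
  \<comment> \<open>The Jordan identities for (y, z) and for (z, y) end in the same term, because
    \<open>tp y a z\<close> is symmetric in y and z. Two equations of this shape force their
    left-hand sides to agree.\<close>
  have 1: "tp a y (tp a z a) = tp a z (tp a y a) + tp a z (tp a y a) - tp a (tp y a z) a"
    using JI[of a y a z a] tp_sym[of "tp a y a" z a] by simp
  have 2: "tp a z (tp a y a) = tp a y (tp a z a) + tp a y (tp a z a) - tp a (tp y a z) a"
    using JI[of a z a y a] tp_sym[of "tp a z a" y a] tp_sym[of z a y] by simp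
  show e: "tp a y (tp a z a) = tp a z (tp a y a)" using 1 2 by (rule eq_of_double)
  show "tp a y (tp a z a) = tp a (tp y a z) a" using 1 e by (simp add: algebra_simps)
qed

lemma DQ: "tp a a (tp a y a) = tp a (tp a a y) a"
  by (rule mid)

lemma LQ: "tp a z (tp a w a) = tp (tp a z a) w a"
  by (metis swap tp_sym)

text \<open>The Jordan identity for L(w, a) applied to {a, a, a}, read as a formula for Q Q
  w.\<close>

lemma QQ: "tp a (tp a w a) a = 2 *\<^sub>R tp a a (tp a a w) - tp (tp a a a) a w"
  using JI[of w a a a a] tp_sym[of w a a] tp_sym[of "tp a a w" a a] tp_sym[of w a "tp a a a"]
  by (simp add: scaleR_2 algebra_simps)

lemma L_comm: "tp a b (tp x y w) - tp x y (tp a b w) = tp (tp a b x) y w - tp x (tp b a y) w"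
  using JI[of a b x y w] by (simp add: algebra_simps)

lemma P_alt: "tp a (tp a a a) w = tp (tp a a a) a w"
  using L_comm[of a a a a w] by simp

text \<open>The case Q(a^3) = Q(a)^3 of the fundamental formula Q(Q(x) y) = Q(x) Q(y) Q(x). It makes
  Q multiplicative along iterated cubes.\<close>

lemma Q_cube: "tp (tp a a a) y (tp a a a) = tp a (tp a (tp a y a) a) a"
proof -
  define b where "b = tp a a a"
  define c where "c = tp a a b"
  have 1: "tp b y a = tp a a (tp a y a)" for y
  proof -
    have "tp a a (tp a y a) = 2 *\<^sub>R tp b y a - tp a a (tp a y a)"
      using JI[of a a a y a] tp_sym[of a y b] by (simp add: b_def[symmetric] DQ scaleR_2 algebra_simps)
    then have "2 *\<^sub>R tp b y a = 2 *\<^sub>R tp a a (tp a y a)" by (simp add: scaleR_2 algebra_simps)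
    then show ?thesis by simp
  qed
  have 2: "tp b y b = 2 *\<^sub>R tp a a (tp a a (tp a y a)) - tp c y a" for y
  proof -
    have "tp a a (tp b y a) = tp c y a - tp b (tp a a y) a + tp b y b"
      using JI[of a a b y a] by (simp add: b_def c_def)
    then show ?thesis by (simp add: 1 DQ[symmetric] scaleR_2 algebra_simps)
  qed
  have c': "tp b a a = c" unfolding c_def by (metis tp_sym)
  have 3: "tp b a (tp a y a) = 2 *\<^sub>R tp c y a - tp a (tp b a y) a"
    using JI[of b a a y a] tp_sym[of a y c] by (simp add: c' P_alt[of a, folded b_def] scaleR_2)
  have P: "tp b a w = 2 *\<^sub>R tp a a (tp a a w) - tp a (tp a w a) a" for w
    using QQ[of a w] by (simp add: b_def algebra_simps)
  have "tp a (tp b a y) a = tp b a (tp a y a)"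
    unfolding P by (simp add: tp_lin DQ)
  moreover from this 3 have "2 *\<^sub>R tp c y a = 2 *\<^sub>R tp a (tp b a y) a" by (simp add: scaleR_2 algebra_simps)
  ultimately have "tp c y a = tp b a (tp a y a)" by simp
  then have "tp b y b = tp a (tp a (tp a y a) a) a" unfolding 2 P by simp
  then show ?thesis unfolding b_def .
qed

section \<open>Iterated cubes as odd powers of one element\<close>

definition cb :: "'a \<Rightarrow> 'a" where "cb x = tp x x x"

lemma norm_cb_iter: "norm ((cb ^^ j) x) = norm x ^ (3 ^ j)"
  by (induction j) (simp_all add: cb_def cube_norm power_mult[symmetric] mult.commute)

lemma Q_cb_iter: "tp ((cb ^^ j) x) y ((cb ^^ j) x) = ((\<lambda>y. tp x y x) ^^ (3 ^ j)) y"
proof (induction j arbitrary: y)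
  case (Suc j)
  have "tp ((cb ^^ Suc j) x) y ((cb ^^ Suc j) x)
      = tp ((cb ^^ j) x) (tp ((cb ^^ j) x) (tp ((cb ^^ j) x) y ((cb ^^ j) x)) ((cb ^^ j) x)) ((cb ^^ j) x)"
    unfolding funpow.simps o_apply cb_def[of "(cb ^^ j) x"] by (rule Q_cube)
  also have "\<dots> = ((\<lambda>y. tp x y x) ^^ (3 ^ j)) (((\<lambda>y. tp x y x) ^^ (3 ^ j)) (((\<lambda>y. tp x y x) ^^ (3 ^ j)) y))"
    unfolding Suc.IH ..
  also have "\<dots> = ((\<lambda>y. tp x y x) ^^ (3 ^ j + (3 ^ j + 3 ^ j))) y" by (simp only: funpow_add o_apply)
  also have "3 ^ j + (3 ^ j + 3 ^ j) = (3::nat) ^ Suc j" by simp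
  finally show ?case .
qed simp

lemma Q_iter_self: "((\<lambda>y. tp x y x) ^^ n) x = (tp x x ^^ n) x"
proof (induction n)
  case (Suc n)
  have "tp x ((tp x x ^^ n) y) x = (tp x x ^^ n) (tp x y x)" for y by (induction n) (auto simp: DQ[symmetric])
  then show ?case by (simp add: Suc.IH funpow_swap1)
qed simp

text \<open>The odd powers of x are x^(2 n + 1) = D^n x with D = \<open>tp x x\<close>, and iterated
  cubing produces the odd exponents 3^j. Norms of D^n x are thus tied to powers of norms.\<close>

lemma cb_iter: "\<exists>n. 3 ^ j = 2 * n + 1 \<and> (cb ^^ j) x = (tp x x ^^ n) x"
proof -
  have "\<exists>n. 3 ^ j = 2 * n + 1 \<and> (cb ^^ j) x = ((\<lambda>y. tp x y x) ^^ n) x"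
  proof (induction j)
    case 0 show ?case by (rule exI[of _ 0]) simp
  next
    case (Suc j)
    then obtain n where n: "3 ^ j = 2 * n + 1" "(cb ^^ j) x = ((\<lambda>y. tp x y x) ^^ n) x" by blast
    have "(cb ^^ Suc j) x = ((\<lambda>y. tp x y x) ^^ (3 ^ j)) ((cb ^^ j) x)"
      using Q_cb_iter[of j x "(cb ^^ j) x"] by (simp add: cb_def)
    also have "\<dots> = ((\<lambda>y. tp x y x) ^^ (3 ^ j + n)) x" by (simp add: n(2) funpow_add)
    finally show ?case using n(1) by (intro exI[of _ "3 ^ j + n"]) simp
  qed
  then show ?thesis by (simp add: Q_iter_self)
qed

section \<open>The semigroup generated by a box operator\<close>

lemma hermitian_op: "hermitian_op J (tp a a)"
proof (intro hermitian_op.intro hermitian_op_axioms.intro)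
  show "complex_banach J" by (rule complex_banach_axioms)
  show "bounded_linear (tp a a)" by (rule bl3)
  show "tp a a (J x) = J (tp a a x)" for x by (rule tp_J3)
  have "hermitian J (L_op tp a a) \<and> nonneg_spectrum J (L_op tp a a)"
    using triple unfolding complex_JBstar_triple_def by blast
  then show "hermitian J (tp a a)" "nonneg_spectrum J (tp a a)" by (simp_all add: L_op_def)
qed

definition Lo :: "'a \<Rightarrow> 'a \<Rightarrow> 'a uop" where "Lo a b = emb (tp a b)"

definition expL :: "'a \<Rightarrow> real \<Rightarrow> 'a uop" where "expL a s = exp (s *\<^sub>R Lo a a)"

definition R :: "'a \<Rightarrow> real \<Rightarrow> 'a \<Rightarrow> 'a" where "R a t x = app (expL a (- t)) x"

lemma app_Lo [simp]: "app (Lo a b) x = tp a b x"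
  by (simp add: Lo_def app_emb bl3)

lemma norm_Lo: "norm (Lo a b) \<le> K * norm a * norm b"
  unfolding Lo_def using tp_bound K0 by (intro norm_emb_le[OF bl3]) auto

lemma bounded_bilinear_Lo: "bounded_bilinear Lo"
proof
  show "Lo (a + a') b = Lo a b + Lo a' b" for a a' b
    unfolding Lo_def emb_add[OF bl3 bl3] by (rule arg_cong[of _ _ emb]) (simp add: fun_eq_iff tp_lin)
  show "Lo a (b + b') = Lo a b + Lo a b'" for a b b'
    unfolding Lo_def emb_add[OF bl3 bl3] by (rule arg_cong[of _ _ emb]) (simp add: fun_eq_iff tp_lin)
  show "Lo (r *\<^sub>R a) b = r *\<^sub>R Lo a b" for r a b
    unfolding Lo_def emb_scaleR[OF bl3] by (rule arg_cong[of _ _ emb]) (simp add: fun_eq_iff tp_lin)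
  show "Lo a (r *\<^sub>R b) = r *\<^sub>R Lo a b" for r a b
    unfolding Lo_def emb_scaleR[OF bl3] by (rule arg_cong[of _ _ emb]) (simp add: fun_eq_iff tp_lin)
  show "\<exists>K. \<forall>a b. norm (Lo a b) \<le> norm a * norm b * K"
    using norm_Lo by (intro exI[of _ K]) (simp add: mult_ac)
qed

sublocale Lo: bounded_bilinear Lo by (rule bounded_bilinear_Lo)

lemma Lo_comm: "Lo a b * Lo x y - Lo x y * Lo a b = Lo (tp a b x) y - Lo x (tp b a y)"
  unfolding Lo_def
  by (simp add: emb_mult emb_diff bl3 bounded_linear_compose[OF bl3 bl3] L_comm)

lemma R_eq_S: "R a t x = hermitian_op.S (tp a a) t x"
  using hermitian_op.S_def[OF hermitian_op, of a t x] by (simp add: R_def expL_def Lo_def)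

lemma R_contr: "0 \<le> t \<Longrightarrow> norm (R a t x) \<le> norm x"
  unfolding R_eq_S by (rule hermitian_op.contraction[OF hermitian_op])

lemma R_decay: "0 < t \<Longrightarrow> norm ((tp a a ^^ n) (R a t x)) \<le> fact n / t ^ n * norm x"
  unfolding R_eq_S by (rule hermitian_op.decay[OF hermitian_op])

lemma R_decay1: "0 < t \<Longrightarrow> norm (tp a a (R a t x)) \<le> norm x / t"
  unfolding R_eq_S by (rule hermitian_op.decay1[OF hermitian_op])

lemma bounded_linear_R: "bounded_linear (R a t)"
  unfolding R_def by (rule app.bounded_linear_right)

lemmas R_lin = linear_add[OF bounded_linear.linear[OF bounded_linear_R]] linear_diff[OF bounded_linear.linear[OF bounded_linear_R]]
  linear_scale[OF bounded_linear.linear[OF bounded_linear_R]]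

lemma expL_0 [simp]: "expL a 0 = 1" by (simp add: expL_def)

lemma expL_add: "expL a (s + t) = expL a s * expL a t"
  unfolding expL_def scaleR_add_left by (rule exp_add_commuting) simp

lemma expL_inverse: "expL a (- s) * expL a s = 1" "expL a s * expL a (- s) = 1"
  using expL_add[of a "- s" s] expL_add[of a s "- s"] by simp_all

lemma R_0 [simp]: "R a 0 x = x" by (simp add: R_def)

lemma R_add: "R a (s + t) x = R a s (R a t x)"
  using expL_add[of a "- s" "- t"] by (simp add: R_def)

lemma expL_D: "expL a s * Lo a a = Lo a a * expL a s"
  unfolding expL_def by (rule exp_commutes) simp

lemma expL_D_app: "app (expL a s) (tp a a x) = tp a a (app (expL a s) x)"
  using arg_cong[OF expL_D, of "\<lambda>X. app X x" a s] by simp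

lemma R_D: "R a t (tp a a x) = tp a a (R a t x)"
  unfolding R_def by (rule expL_D_app)

lemma expL_deriv: "((\<lambda>s. expL a s) has_vector_derivative Lo a a * expL a s) (at s)"
  unfolding expL_def by (rule exp_scaleR_has_vector_derivative_left)

lemma expL_neg_deriv: "((\<lambda>s. expL a (- s)) has_vector_derivative - (Lo a a * expL a (- s))) (at s)"
proof -
  have "((\<lambda>s. exp (s *\<^sub>R (- Lo a a))) has_vector_derivative (- Lo a a) * exp (s *\<^sub>R (- Lo a a))) (at s)"
    by (rule exp_scaleR_has_vector_derivative_left)
  then show ?thesis by (simp add: expL_def)
qed

text \<open>The conjugated operator is constant in s, since its derivative vanishes by the Jordan identity.\<close>

lemma expL_auto: "expL a s * Lo x y * expL a (- s) = Lo (app (expL a s) x) (app (expL a (- s)) y)"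
proof -
  define f where "f s = expL a (- s) * Lo (app (expL a s) x) (app (expL a (- s)) y) * expL a s" for s
  have "(f has_vector_derivative 0) (at s)" for s
  proof -
    define D where "D = Lo a a"
    define X where "X = app (expL a s) x"
    define Y where "Y = app (expL a (- s)) y"
    have dX: "((\<lambda>s. app (expL a s) x) has_vector_derivative tp a a X) (at s)"
      using bounded_linear.has_vector_derivative[OF app.bounded_linear_left[of x] expL_deriv[of a s]]
      unfolding app_mult app_Lo X_def .
    have dY: "((\<lambda>s. app (expL a (- s)) y) has_vector_derivative - tp a a Y) (at s)"
      using bounded_linear.has_vector_derivative[OF app.bounded_linear_left[of y] expL_neg_deriv[of a s]]
      unfolding app.minus_left app_mult app_Lo Y_def .
    have dL: "((\<lambda>s. Lo (app (expL a s) x) (app (expL a (- s)) y)) has_vector_derivative Lo X (- tp a a Y) + Lo (tp a a X) Y) (at s)"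
      using Lo.has_vector_derivative[OF dX dY] unfolding X_def Y_def .
    have "(f has_vector_derivative (expL a (- s) * Lo X Y) * (D * expL a s)
        + (expL a (- s) * (Lo X (- tp a a Y) + Lo (tp a a X) Y) + - (D * expL a (- s)) * Lo X Y) * expL a s) (at s)"
      unfolding f_def D_def using has_vector_derivative_mult[OF has_vector_derivative_mult[OF expL_neg_deriv dL] expL_deriv]
      unfolding X_def Y_def .
    moreover have "(expL a (- s) * Lo X Y) * (D * expL a s)
        + (expL a (- s) * (Lo X (- tp a a Y) + Lo (tp a a X) Y) + - (D * expL a (- s)) * Lo X Y) * expL a s = 0"
    proof -
      define Z where "Z = Lo X (- tp a a Y) + Lo (tp a a X) Y"
      have Z: "Z = D * Lo X Y - Lo X Y * D"
        unfolding Z_def D_def Lo_comm by (simp add: Lo.minus_right)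
      have De: "D * expL a (- s) = expL a (- s) * D" unfolding D_def by (simp add: expL_D)
      have "(expL a (- s) * Lo X Y) * (D * expL a s) + (expL a (- s) * Z + - (D * expL a (- s)) * Lo X Y) * expL a s = 0"
        unfolding De Z by (simp add: algebra_simps)
      then show ?thesis unfolding Z_def .
    qed
    ultimately show ?thesis by simp
  qed
  then obtain c where "\<And>s. f s = c"
    using has_vector_derivative_zero_constant[of UNIV f] by auto
  then have "f s = f 0" by simp
  then have "expL a s * f s * expL a (- s) = expL a s * Lo x y * expL a (- s)" by (simp add: f_def)
  moreover have "expL a s * f s * expL a (- s) = (expL a s * expL a (- s)) * Lo (app (expL a s) x) (app (expL a (- s)) y) * (expL a s * expL a (- s))"
    unfolding f_def by (simp only: mult.assoc)
  ultimately show ?thesis by (simp add: expL_inverse)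
qed

text \<open>D enters the Jordan identity with the opposite sign in the middle variable, so exp (s D)
  acts there through its inverse.\<close>

lemma expL_tp: "app (expL a s) (tp x y z) = tp (app (expL a s) x) (app (expL a (- s)) y) (app (expL a s) z)"
proof -
  have "app (expL a s * Lo x y * expL a (- s)) (app (expL a s) z) = tp (app (expL a s) x) (app (expL a (- s)) y) (app (expL a s) z)"
    unfolding expL_auto by simp
  moreover have "app (expL a (- s)) (app (expL a s) z) = z"
    using arg_cong[OF expL_inverse(1), of "\<lambda>X. app X z" a s] by simp
  ultimately show ?thesis by simp
qed

lemma expL_expL: "app (expL a s) (app (expL a t) x) = app (expL a (s + t)) x"
  by (simp add: expL_add)

text \<open>When D commutes with Q(v), so does exp (s D). Pulling exp (s D) out of the outer
  variables puts another exp (s D) on the middle one, and commuting it outwards doubles the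
  time.\<close>

lemma expL_Q:
  assumes "\<And>y. tp a a (tp v y v) = tp v (tp a a y) v"
  shows "app (expL a s) (tp v y v) = tp v (app (expL a s) y) v"
    and "tp (app (expL a s) v) y (app (expL a s) v) = app (expL a (2 * s)) (tp v y v)"
proof -
  have "emb (\<lambda>y. tp v y v) * Lo a a = Lo a a * emb (\<lambda>y. tp v y v)"
    unfolding Lo_def by (simp add: emb_mult bl2 bl3 assms)
  then have "(s *\<^sub>R Lo a a) * emb (\<lambda>y. tp v y v) = emb (\<lambda>y. tp v y v) * (s *\<^sub>R Lo a a)" for s by simp
  then have "expL a s * emb (\<lambda>y. tp v y v) = emb (\<lambda>y. tp v y v) * expL a s" for s
    unfolding expL_def by (rule exp_commutes)
  then have *: "app (expL a s) (tp v y v) = tp v (app (expL a s) y) v" for s y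
    by (metis app_emb app_mult bl2)
  show "app (expL a s) (tp v y v) = tp v (app (expL a s) y) v" by (rule *)
  have "tp (app (expL a s) v) y (app (expL a s) v) = app (expL a s) (tp v (app (expL a s) y) v)"
    unfolding expL_tp by (simp add: expL_expL)
  also have "\<dots> = app (expL a (2 * s)) (tp v y v)"
    unfolding *[symmetric] by (simp add: expL_expL)
  finally show "tp (app (expL a s) v) y (app (expL a s) v) = app (expL a (2 * s)) (tp v y v)" .
qed

lemma D_Q_cb_iter: "tp a a (tp ((cb ^^ j) a) y ((cb ^^ j) a)) = tp ((cb ^^ j) a) (tp a a y) ((cb ^^ j) a)"
proof -
  have "tp a a (((\<lambda>y. tp a y a) ^^ n) y) = ((\<lambda>y. tp a y a) ^^ n) (tp a a y)" for n
    by (induction n) (auto simp: DQ)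
  then show ?thesis by (simp add: Q_cb_iter)
qed

text \<open>Each cubing triples the time: the two outer factors contribute twice the time by
  \<open>expL_Q\<close>, the middle factor once.\<close>

lemma cb_E_iter: "(cb ^^ j) (app (expL a s) a) = app (expL a (3 ^ j * s)) ((cb ^^ j) a)"
proof (induction j)
  case (Suc j)
  define v where "v = (cb ^^ j) a"
  define s' where "s' = 3 ^ j * s"
  have v: "tp a a (tp v y v) = tp v (tp a a y) v" for y unfolding v_def by (rule D_Q_cb_iter)
  have "(cb ^^ Suc j) (app (expL a s) a) = cb (app (expL a s') v)" by (simp add: Suc.IH v_def s'_def)
  also have "\<dots> = app (expL a (2 * s')) (tp v (app (expL a s') v) v)" unfolding cb_def by (rule expL_Q(2)[OF v])
  also have "\<dots> = app (expL a (3 * s')) (cb v)" unfolding cb_def expL_Q(1)[OF v, symmetric] by (simp add: expL_expL)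
  finally show ?case by (simp add: v_def s'_def algebra_simps)
qed simp

lemma Q_R: "tp (R a t a) y (R a t a) = tp a (R a (2 * t) y) a"
  using expL_Q[OF DQ, of a "- t" y] expL_Q(1)[OF DQ, of a "- (2 * t)" y] by (simp add: R_def)

text \<open>Since {a, a, a} = D a, the cube of \<open>R a t a\<close> is D R a (3 t) a. Hence the
  decay of D R gives a decay of \<open>R a t a\<close> itself, at the price of a cube root.\<close>

lemma R_self_decay:
  assumes "0 < t" shows "norm (R a t a) ^ 3 \<le> norm a / (3 * t)"
proof -
  have "cb (R a t a) = R a (3 * t) (tp a a a)"
    using cb_E_iter[of 1 a "- t"] by (simp add: R_def cb_def)
  then have "norm (R a t a) ^ 3 = norm (tp a a (R a (3 * t) a))"
    by (metis cb_def cube_norm R_D)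
  then show ?thesis using R_decay1[of "3 * t" a a] assms by simp
qed

end

section \<open>Asymptotic orthogonality\<close>

lemma vector_mvt_bound:
  fixes f :: "real \<Rightarrow> 'v::real_normed_vector"
  assumes "a \<le> b" and "\<And>r. a \<le> r \<Longrightarrow> r \<le> b \<Longrightarrow> (f has_vector_derivative f' r) (at r)"
    and "\<And>r. a \<le> r \<Longrightarrow> r \<le> b \<Longrightarrow> norm (f' r) \<le> B"
  shows "norm (f b - f a) \<le> B * (b - a)"
proof -
  have "norm (f b - f a) \<le> B * norm (b - a)"
  proof (rule differentiable_bound[where S = "{a..b}" and f' = "\<lambda>r h. h *\<^sub>R f' r"])
    show "(f has_derivative (\<lambda>h. h *\<^sub>R f' r)) (at r within {a..b})" if "r \<in> {a..b}" for r
      using assms(2)[of r] that by (simp add: has_vector_derivative_def has_derivative_at_withinI)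
    show "onorm (\<lambda>h. h *\<^sub>R f' r) \<le> B" if "r \<in> {a..b}" for r
    proof (rule onorm_bound)
      show "0 \<le> B" using order_trans[OF norm_ge_zero assms(3)[of r]] that by simp
      show "norm (h *\<^sub>R f' r) \<le> B * norm h" for h
        using mult_right_mono[OF assms(3)[of r], of "\<bar>h\<bar>"] that by (simp add: mult.commute)
    qed
  qed (use assms(1) in auto)
  then show ?thesis using assms(1) by simp
qed

lemma second_difference_bound:
  fixes f :: "real \<Rightarrow> 'v::real_normed_vector"
  assumes "0 \<le> S" and f: "\<And>r. 0 \<le> r \<Longrightarrow> r \<le> 2 * S \<Longrightarrow> (f has_vector_derivative f' r) (at r)"
    and f': "\<And>r. 0 \<le> r \<Longrightarrow> r \<le> 2 * S \<Longrightarrow> (f' has_vector_derivative f'' r) (at r)"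
    and B: "\<And>r. 0 \<le> r \<Longrightarrow> r \<le> 2 * S \<Longrightarrow> norm (f'' r) \<le> B"
  shows "norm (f (2 * S) - 2 *\<^sub>R f S + f 0) \<le> B * S\<^sup>2"
proof -
  define g where "g r = f (r + S) - f r" for r
  have "norm (g S - g 0) \<le> (B * S) * (S - 0)"
  proof (rule vector_mvt_bound)
    fix r assume r: "0 \<le> r" "r \<le> S"
    have "((\<lambda>r. f (r + S)) has_vector_derivative f' (r + S)) (at r)"
      using vector_diff_chain_at[of "\<lambda>r. r + S" 1 r f "f' (r + S)"] f[of "r + S"] r assms(1)
      by (simp add: o_def has_vector_derivative_add_const has_vector_derivative_id)
    then show "(g has_vector_derivative f' (r + S) - f' r) (at r)"
      unfolding g_def using f[of r] r assms(1) by (intro has_vector_derivative_diff) auto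
    have "norm (f' (r + S) - f' r) \<le> B * ((r + S) - r)"
      using r assms(1) by (intro vector_mvt_bound[OF _ f' B]) auto
    then show "norm (f' (r + S) - f' r) \<le> B * S" by simp
  qed (use assms(1) in auto)
  moreover have "g S - g 0 = f (2 * S) - 2 *\<^sub>R f S + f 0" by (simp add: g_def scaleR_2 algebra_simps)
  ultimately show ?thesis by (simp add: power2_eq_square mult.assoc)
qed

lemma norm_sum7:
  fixes a b c d e f g :: "'v::real_normed_vector"
  shows "norm (a - b - c + d + e + f - g) \<le> norm a + norm b + norm c + norm d + norm e + norm f + norm g"
    and "norm (a + b - c - d - e + f + g) \<le> norm a + norm b + norm c + norm d + norm e + norm f + norm g"
proof -
  show "norm (a - b - c + d + e + f - g) \<le> norm a + norm b + norm c + norm d + norm e + norm f + norm g"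
    using norm_triangle_ineq4[of "a - b - c + d + e + f" g] norm_triangle_ineq[of "a - b - c + d + e" f]
      norm_triangle_ineq[of "a - b - c + d" e] norm_triangle_ineq[of "a - b - c" d] norm_triangle_ineq4[of "a - b" c]
      norm_triangle_ineq4[of a b] by linarith
  show "norm (a + b - c - d - e + f + g) \<le> norm a + norm b + norm c + norm d + norm e + norm f + norm g"
    using norm_triangle_ineq[of "a + b - c - d - e + f" g] norm_triangle_ineq[of "a + b - c - d - e" f]
      norm_triangle_ineq4[of "a + b - c - d" e] norm_triangle_ineq4[of "a + b - c" d] norm_triangle_ineq4[of "a + b" c]
      norm_triangle_ineq[of a b] by linarith
qed

text \<open>Because of the adjoined unit the action on the space is not faithful: the unit and the
  embedded identity act alike. Among elements without unit part the action determines the element,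
  which is \<open>uop_eqI\<close>.\<close>

lift_definition unit_free :: "'a::banach uop \<Rightarrow> bool" is "\<lambda>(c, T). c = 0" .

lemma unit_free_simps [simp]:
  "unit_free (emb f)" "unit_free X \<Longrightarrow> unit_free Y \<Longrightarrow> unit_free (X + Y)"
  "unit_free X \<Longrightarrow> unit_free Y \<Longrightarrow> unit_free (X - Y)" "unit_free X \<Longrightarrow> unit_free (r *\<^sub>R X)"
  "unit_free X \<Longrightarrow> unit_free (X * Y)" "unit_free Y \<Longrightarrow> unit_free (X * Y)"
  by (transfer; auto)+

lemma uop_eqI: "unit_free X \<Longrightarrow> unit_free Y \<Longrightarrow> (\<And>x. app X x = app Y x) \<Longrightarrow> X = Y"
  by transfer (auto intro!: blinfun_eqI)

context jb_triple begin

lemma unit_free_Lo [simp]: "unit_free (Lo a b)" by (simp add: Lo_def)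

lemma norm_R_le: "0 \<le> t \<Longrightarrow> norm x \<le> B \<Longrightarrow> norm (R a t x) \<le> B"
  using R_contr order_trans by blast

lemma norm_emb_tp_mid: "norm (emb (\<lambda>w. tp x w y)) \<le> K * norm x * norm y"
  using tp_bound[of x _ y] K0 by (intro norm_emb_le[OF bl2]) (simp_all add: mult_ac)

text \<open>An operator satisfying an approximate Sylvester equation
  with coefficients p D and q D nearly kills the range of D.\<close>

lemma sylvester_decay:
  assumes "0 < s" "0 < p" "0 < q" and M: "\<And>x. norm (app (p *\<^sub>R (Lo n n * X) + q *\<^sub>R (X * Lo n n)) x) \<le> e * norm x"
    and X: "norm X \<le> B" and n: "norm n \<le> 1" and e: "0 \<le> e"
  shows "norm (app (X * Lo n n) x) \<le> (B / (q * s) + s * e * K) * norm x"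
proof -
  define y where "y = tp n n x"
  have y: "norm y \<le> K * norm x"
    unfolding y_def using tp_bound'[of n 1 n 1 x "norm x"] n by simp
  \<comment> \<open>Under the exact Sylvester equation g would be constant. The error e lets it
    drift by at most s e K norm x, while at time s the right factor meets y = D x and the decay of D
    R makes g small.\<close>
  define g where "g s = app (expL n (- (p * s)) * X * expL n (- (q * s))) y" for s
  have dE: "((\<lambda>s. expL n (- (c * s))) has_vector_derivative - (c *\<^sub>R (Lo n n * expL n (- (c * s))))) (at s)" for c s
    using vector_diff_chain_at[of "\<lambda>s. c * s" c s "\<lambda>s. expL n (- s)" "- (Lo n n * expL n (- (c * s)))"] expL_neg_deriv[of n "c * s"]
    by (simp add: o_def has_vector_derivative_mult_right[OF has_vector_derivative_id, simplified])
  define d where "d r = - app (expL n (- (p * r)) * (p *\<^sub>R (Lo n n * X) + q *\<^sub>R (X * Lo n n)) * expL n (- (q * r))) y" for r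
  have dg: "(g has_vector_derivative d r) (at r)" for r
  proof -
    have "((\<lambda>s. expL n (- (p * s)) * X) has_vector_derivative (- (p *\<^sub>R (Lo n n * expL n (- (p * r))))) * X) (at r)"
      using bounded_linear.has_vector_derivative[OF bounded_linear_mult_left[of X] dE[of p r]] .
    then have "((\<lambda>s. expL n (- (p * s)) * X * expL n (- (q * s))) has_vector_derivative
      (expL n (- (p * r)) * X) * (- (q *\<^sub>R (Lo n n * expL n (- (q * r)))))
      + ((- (p *\<^sub>R (Lo n n * expL n (- (p * r))))) * X) * expL n (- (q * r))) (at r)"
      by (rule has_vector_derivative_mult) (rule dE)
    moreover have "(expL n (- (p * r)) * X) * (- (q *\<^sub>R (Lo n n * expL n (- (q * r)))))
      + ((- (p *\<^sub>R (Lo n n * expL n (- (p * r))))) * X) * expL n (- (q * r))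
      = - (expL n (- (p * r)) * (p *\<^sub>R (Lo n n * X) + q *\<^sub>R (X * Lo n n)) * expL n (- (q * r)))"
      unfolding expL_D[symmetric, of n "- (p * r)"] by (simp add: algebra_simps)
    ultimately have "((\<lambda>s. expL n (- (p * s)) * X * expL n (- (q * s))) has_vector_derivative
      - (expL n (- (p * r)) * (p *\<^sub>R (Lo n n * X) + q *\<^sub>R (X * Lo n n)) * expL n (- (q * r)))) (at r)" by simp
    from bounded_linear.has_vector_derivative[OF app.bounded_linear_left[of y] this]
    show ?thesis unfolding g_def d_def app.minus_left .
  qed
  have nd: "norm (d r) \<le> e * norm y" if "0 \<le> r" for r
  proof -
    have "norm (d r) = norm (R n (p * r) (app (p *\<^sub>R (Lo n n * X) + q *\<^sub>R (X * Lo n n)) (R n (q * r) y)))"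
      by (simp add: d_def R_def)
    also have "\<dots> \<le> norm (app (p *\<^sub>R (Lo n n * X) + q *\<^sub>R (X * Lo n n)) (R n (q * r) y))"
      using that assms by (intro R_contr) auto
    also have "\<dots> \<le> e * norm (R n (q * r) y)" by (rule M)
    also have "\<dots> \<le> e * norm y" using that assms e by (intro mult_left_mono R_contr) auto
    finally show ?thesis .
  qed
  have "norm (g s - g 0) \<le> (e * norm y) * (s - 0)"
    using assms nd by (intro vector_mvt_bound[OF _ dg]) auto
  also have "\<dots> \<le> (e * (K * norm x)) * s" using y e assms by (simp add: mult_left_mono mult_right_mono)
  finally have 1: "norm (g s - g 0) \<le> s * e * K * norm x" by (simp add: mult_ac)
  have "norm (g s) = norm (R n (p * s) (app X (R n (q * s) y)))" by (simp add: g_def R_def)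
  also have "\<dots> \<le> norm (app X (R n (q * s) y))" using assms by (intro R_contr) auto
  also have "\<dots> \<le> norm X * norm (R n (q * s) y)" by (rule norm_app_le)
  also have "\<dots> \<le> B * norm (R n (q * s) y)" using X by (intro mult_right_mono) auto
  also have "\<dots> \<le> B * (norm x / (q * s))"
    unfolding y_def R_D using X assms by (intro mult_left_mono R_decay1) (auto intro: order_trans[OF norm_ge_zero X])
  finally have 2: "norm (g s) \<le> B / (q * s) * norm x" by simp
  have "g 0 = app (X * Lo n n) x" by (simp add: g_def y_def)
  then have "norm (app (X * Lo n n) x) \<le> norm (g s) + norm (g s - g 0)"
    by (metis norm_triangle_sub add.commute norm_minus_commute)
  then show ?thesis using 1 2 by (simp add: algebra_simps)
qed

text \<open>Put L k = L(D^k n, z). Commuting with D raises k, and L 0 Q is small, so Q^2 = 2 D^2 - P makes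
  L 2 + 4 L 1 D small. Hence D L 1 + 3 L 1 D is small, and the Sylvester estimate applies to L 1.
  The operators L(z, D^k n) are treated in the same way.\<close>

lemma orth_core:
  assumes n: "norm n \<le> 1" and z: "norm z \<le> 1" and s: "0 < s"
    and e: "norm (tp n n z) \<le> e" "norm (tp n z n) \<le> e"
  defines "n1 \<equiv> tp n n n" and "n2 \<equiv> tp n n (tp n n n)"
  shows "norm (tp n2 z x) \<le> (2 * K / s + (100 * K ^ 3 * s + 20 * K\<^sup>2) * e) * norm x"
    and "norm (tp z n2 x) \<le> (2 * K / s + (100 * K ^ 3 * s + 20 * K\<^sup>2) * e) * norm x"
proof -
  define d where "d = tp n n z"
  define D where "D = Lo n n"
  define P where "P = Lo n1 n"
  define Q where "Q = emb (\<lambda>w. tp n w n)"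
  define L0 L1 L2 where "L0 = Lo n z" and "L1 = Lo n1 z" and "L2 = Lo n2 z"
  define Z0 Z1 Z2 where "Z0 = Lo z n" and "Z1 = Lo z n1" and "Z2 = Lo z n2"
  define E1 where "E1 = emb (\<lambda>w. tp (tp n z n) w n)"
  define E2 where "E2 = 2 *\<^sub>R emb (\<lambda>w. tp d w n)"
  define pz where "pz = tp n1 n z"
  have e0: "0 \<le> e" using e(1) norm_ge_zero order_trans by blast
  have sym: "tp n1 n n = n2" "tp n n1 n = n2" "tp z n n = d" "tp n n1 z = pz"
    unfolding n1_def n2_def d_def pz_def using tp_sym mid[of n n n] P_alt by auto
  have pz: "pz = 2 *\<^sub>R tp n n d - tp n (tp n z n) n"
    unfolding pz_def d_def using QQ[of n z] by (simp add: n1_def algebra_simps)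
  have c1: "D * L0 = L0 * D + L1 - Lo n d"
    using Lo_comm[of n n n z] unfolding D_def L0_def L1_def n1_def d_def by (simp add: algebra_simps)
  have c2: "D * L1 = L1 * D + L2 - Lo n1 d"
    using Lo_comm[of n n n1 z] unfolding D_def L1_def L2_def n1_def n2_def d_def by (simp add: algebra_simps)
  have c3: "P * L0 = L0 * P + L2 - Lo n pz"
    using Lo_comm[of n1 n n z] unfolding P_def L0_def L2_def sym by (simp add: algebra_simps)
  have k1: "D * Z0 = Z0 * D + Lo d n - Z1"
    using Lo_comm[of n n z n] unfolding D_def Z0_def Z1_def n1_def d_def by (simp add: algebra_simps)
  have k2: "D * Z1 = Z1 * D + Lo d n1 - Z2"
    using Lo_comm[of n n z n1] unfolding D_def Z1_def Z2_def n1_def n2_def d_def by (simp add: algebra_simps)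
  have k3: "P * Z0 = Z0 * P + Lo pz n - Z2"
    using Lo_comm[of n1 n z n] unfolding P_def Z0_def Z2_def sym pz_def by (simp add: algebra_simps)
  have aQ: "app Q w = tp n w n" for w by (simp add: Q_def app_emb bl2)
  have aE1: "app E1 w = tp (tp n z n) w n" for w by (simp add: E1_def app_emb bl2)
  have aE2: "app E2 w = 2 *\<^sub>R tp d w n" for w by (simp add: E2_def app_emb bl2 app.scaleR_left)
  have uf [simp]: "unit_free Q" "unit_free E1" "unit_free E2" by (simp_all add: Q_def E1_def E2_def)
  have QQ': "Q * Q = 2 *\<^sub>R (D * D) - P"
  proof (rule uop_eqI)
    show "app (Q * Q) x = app (2 *\<^sub>R (D * D) - P) x" for x
      using QQ[of n x] unfolding app_mult aQ app.diff_left app.scaleR_left D_def P_def app_Lo n1_def .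
  qed (simp_all add: D_def P_def)
  have LQ': "L0 * Q = E1"
  proof (rule uop_eqI)
    show "app (L0 * Q) x = app E1 x" for x
      using LQ[of n z x] unfolding app_mult aQ aE1 L0_def app_Lo .
  qed (simp_all add: L0_def)
  have QZ: "Q * Z0 = E1"
  proof (rule uop_eqI)
    show "app (Q * Z0) x = app E1 x" for x
      using trans[OF mid[symmetric] LQ[of n z x]] unfolding app_mult aQ aE1 Z0_def app_Lo .
  qed (simp_all add: Z0_def)
  have ZQ: "Z0 * Q = E2 - Q * L0"
  proof -
    have "tp z n (tp n w n) = 2 *\<^sub>R tp d w n - tp n (tp n z w) n" for w
      using JI[of z n n w n] unfolding sym(3) tp_sym[of n w d] scaleR_2 by (simp only: algebra_simps)
    then have "app (Z0 * Q) w = app (E2 - Q * L0) w" for w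
      unfolding app_mult aQ aE2 app.diff_left Z0_def L0_def app_Lo .
    then show ?thesis by (intro uop_eqI) (simp_all add: Z0_def L0_def)
  qed
  have nn1: "norm n1 \<le> 1" unfolding n1_def using n by (simp add: cube_norm power_le_one)
  have nLo: "norm (Lo a b) \<le> K * r" "norm (Lo b a) \<le> K * r" if "norm a \<le> 1" "norm b \<le> r" for a b r
  proof -
    have r: "0 \<le> r" using that norm_ge_zero order_trans by blast
    have "K * norm a * norm b \<le> K * 1 * r" using that K0 r by (intro mult_mono) auto
    then show "norm (Lo a b) \<le> K * r" "norm (Lo b a) \<le> K * r" using norm_Lo[of a b] norm_Lo[of b a] by (auto simp: mult_ac)
  qed
  have nD: "norm D \<le> K" unfolding D_def using nLo(1)[OF n n] by simp
  have nP: "norm P \<le> K" unfolding P_def using nLo(1)[OF nn1 n] by simp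
  have nQ: "norm Q \<le> K"
  proof -
    have "K * norm n * norm n \<le> K * 1 * 1" using n K0 by (intro mult_mono) auto
    then show ?thesis unfolding Q_def using norm_emb_tp_mid[of n n] by simp
  qed
  have nd: "norm d \<le> e" unfolding d_def by (rule e)
  have nE1: "norm E1 \<le> K * e"
  proof -
    have "K * norm (tp n z n) * norm n \<le> K * e * 1" using e n K0 e0 by (intro mult_mono) auto
    then show ?thesis unfolding E1_def using norm_emb_tp_mid[of "tp n z n" n] by simp
  qed
  have nE2: "norm E2 \<le> 2 * (K * e)"
  proof -
    have "K * norm d * norm n \<le> K * e * 1" using nd n K0 e0 by (intro mult_mono) auto
    then show ?thesis unfolding E2_def using norm_emb_tp_mid[of d n] by simp
  qed
  have npz: "norm pz \<le> 3 * K * e"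
  proof -
    have "norm pz \<le> 2 * norm (tp n n d) + norm (tp n (tp n z n) n)"
      unfolding pz using norm_triangle_ineq4[of "2 *\<^sub>R tp n n d" "tp n (tp n z n) n"] by simp
    moreover have "norm (tp n n d) \<le> K * 1 * 1 * e" "norm (tp n (tp n z n) n) \<le> K * 1 * e * 1"
      using tp_bound'[OF n n nd] tp_bound'[OF n e(2) n] by simp_all
    ultimately show ?thesis by simp
  qed
  have prod: "norm (A * B) \<le> a * b" if "norm A \<le> a" "norm B \<le> b" for A B :: "'a uop" and a b
    by (meson mult_mono norm_ge_zero norm_mult_ineq order_trans that)
  have K2: "K \<le> K\<^sup>2" using K1 by (simp add: power2_eq_square mult_left_mono[of 1 K K, simplified])
  have Ke: "K * e \<le> K\<^sup>2 * e" using K2 e0 by (rule mult_right_mono)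
  have Ke0: "0 \<le> K\<^sup>2 * e" using e0 by simp
  \<comment> \<open>Both sides come from the commutator Q Q L0 - L0 Q Q. The rules for Q next to
    \<open>L0\<close> and \<open>Z0\<close> show that it is small; Q Q = 2 D D - P together with
    \<open>c1\<close>, \<open>c2\<close>, \<open>c3\<close> expresses it by \<open>L2\<close> and
    \<open>L1 * D\<close>.\<close>
  have Leq: "L2 + 4 *\<^sub>R (L1 * D) = Q * E2 - E1 * Q - E1 * Q + 2 *\<^sub>R (Lo n d * D) + 2 *\<^sub>R Lo n1 d + 2 *\<^sub>R (D * Lo n d) - Lo n pz"
  proof -
    have A: "Q * Q * L0 = Q * E2 - E1 * Q"
    proof -
      have "Q * Q * L0 = Q * (E2 - Z0 * Q)" unfolding ZQ by (simp add: mult.assoc)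
      also have "\<dots> = Q * E2 - (Q * Z0) * Q" by (simp add: algebra_simps)
      finally show ?thesis unfolding QZ .
    qed
    have B: "L0 * Q * Q = E1 * Q" unfolding LQ' ..
    have C: "Q * Q * L0 = 2 *\<^sub>R (D * (D * L0)) - P * L0" "L0 * Q * Q = 2 *\<^sub>R (L0 * D * D) - L0 * P"
      unfolding mult.assoc[of L0 Q Q] QQ' by (simp_all add: algebra_simps)
    have F: "D * (D * L0) = L0 * D * D + (L1 * D + L1 * D) + L2 - Lo n d * D - Lo n1 d - D * Lo n d"
    proof -
      have "D * (D * L0) = D * (L0 * D + L1 - Lo n d)" by (simp only: c1)
      also have "\<dots> = (D * L0) * D + D * L1 - D * Lo n d" by (simp add: algebra_simps)
      also have "\<dots> = L0 * D * D + (L1 * D + L1 * D) + L2 - Lo n d * D - Lo n1 d - D * Lo n d"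
        unfolding c1 c2 by (simp add: algebra_simps)
      finally show ?thesis .
    qed
    have "Q * E2 - E1 * Q - E1 * Q = Q * Q * L0 - L0 * Q * Q" unfolding A B by simp
    also have "\<dots> = 2 *\<^sub>R (D * (D * L0)) - P * L0 - (2 *\<^sub>R (L0 * D * D) - L0 * P)" unfolding C ..
    also have "\<dots> = 4 *\<^sub>R (L1 * D) + L2 - 2 *\<^sub>R (Lo n d * D) - 2 *\<^sub>R Lo n1 d - 2 *\<^sub>R (D * Lo n d) + Lo n pz"
      unfolding F c3 by (simp add: scaleR_2 algebra_simps scaleR_left.add[of 2 "2::real", simplified])
    finally show ?thesis by (simp add: algebra_simps)
  qed
  have Zeq: "3 *\<^sub>R Z2 - 4 *\<^sub>R (Z1 * D) = Q * E1 + Q * E1 - E2 * Q - 2 *\<^sub>R (Lo d n * D) - 2 *\<^sub>R (D * Lo d n) + 2 *\<^sub>R Lo d n1 + Lo pz n"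
  proof -
    have A: "Z0 * Q * Q = E2 * Q - Q * E1" unfolding ZQ by (simp add: algebra_simps LQ'[symmetric])
    have B: "Q * Q * Z0 = Q * E1" by (simp add: mult.assoc QZ)
    have C: "Q * Q * Z0 = 2 *\<^sub>R (D * (D * Z0)) - P * Z0" "Z0 * Q * Q = 2 *\<^sub>R (Z0 * D * D) - Z0 * P"
      unfolding mult.assoc[of Z0 Q Q] QQ' by (simp_all add: algebra_simps)
    have F: "D * (D * Z0) = Z0 * D * D - (Z1 * D + Z1 * D) + Z2 + Lo d n * D + D * Lo d n - Lo d n1"
    proof -
      have "D * (D * Z0) = D * (Z0 * D + Lo d n - Z1)" by (simp only: k1)
      also have "\<dots> = (D * Z0) * D + D * Lo d n - D * Z1" by (simp add: algebra_simps)
      also have "\<dots> = Z0 * D * D - (Z1 * D + Z1 * D) + Z2 + Lo d n * D + D * Lo d n - Lo d n1"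
        unfolding k1 k2 by (simp add: algebra_simps)
      finally show ?thesis .
    qed
    have "Q * E1 + Q * E1 - E2 * Q = Q * Q * Z0 - Z0 * Q * Q" unfolding A B by simp
    also have "\<dots> = 2 *\<^sub>R (D * (D * Z0)) - P * Z0 - (2 *\<^sub>R (Z0 * D * D) - Z0 * P)" unfolding C ..
    also have "\<dots> = 3 *\<^sub>R Z2 - 4 *\<^sub>R (Z1 * D) + 2 *\<^sub>R (Lo d n * D) + 2 *\<^sub>R (D * Lo d n) - 2 *\<^sub>R Lo d n1 - Lo pz n"
      unfolding F k3 by (simp add: scaleR_2 algebra_simps scaleR_left.add[of 2 "2::real", simplified] scaleR_left.add[of 1 "2::real", simplified])
    finally show ?thesis by (simp add: algebra_simps)
  qed
  have small: "norm (Q * E2) \<le> 2 * (K\<^sup>2 * e)" "norm (E2 * Q) \<le> 2 * (K\<^sup>2 * e)"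
    "norm (E1 * Q) \<le> K\<^sup>2 * e" "norm (Q * E1) \<le> K\<^sup>2 * e"
    "norm (Lo n d * D) \<le> K\<^sup>2 * e" "norm (D * Lo n d) \<le> K\<^sup>2 * e" "norm (Lo d n * D) \<le> K\<^sup>2 * e" "norm (D * Lo d n) \<le> K\<^sup>2 * e"
    "norm (Lo n1 d) \<le> K\<^sup>2 * e" "norm (Lo d n1) \<le> K\<^sup>2 * e"
    "norm (Lo n pz) \<le> 3 * (K\<^sup>2 * e)" "norm (Lo pz n) \<le> 3 * (K\<^sup>2 * e)"
    using prod[OF nQ nE2] prod[OF nE2 nQ] prod[OF nE1 nQ] prod[OF nQ nE1] prod[OF nLo(1)[OF n nd] nD] prod[OF nD nLo(1)[OF n nd]]
      prod[OF nLo(2)[OF n nd] nD] prod[OF nD nLo(2)[OF n nd]] nLo[OF nn1 nd] nLo[OF n npz] Ke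
    by (simp_all add: power2_eq_square mult_ac)
  have bL: "norm (L2 + 4 *\<^sub>R (L1 * D)) \<le> 14 * (K\<^sup>2 * e)"
  proof -
    have "norm (L2 + 4 *\<^sub>R (L1 * D)) \<le> norm (Q * E2) + norm (E1 * Q) + norm (E1 * Q) + norm (2 *\<^sub>R (Lo n d * D))
       + norm (2 *\<^sub>R Lo n1 d) + norm (2 *\<^sub>R (D * Lo n d)) + norm (Lo n pz)"
      unfolding Leq by (rule norm_sum7)
    then show ?thesis using small Ke0 by simp
  qed
  have bZ: "norm (3 *\<^sub>R Z2 - 4 *\<^sub>R (Z1 * D)) \<le> 14 * (K\<^sup>2 * e)"
  proof -
    have "norm (3 *\<^sub>R Z2 - 4 *\<^sub>R (Z1 * D)) \<le> norm (Q * E1) + norm (Q * E1) + norm (E2 * Q) + norm (2 *\<^sub>R (Lo d n * D))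
       + norm (2 *\<^sub>R (D * Lo d n)) + norm (2 *\<^sub>R Lo d n1) + norm (Lo pz n)"
      unfolding Zeq by (rule norm_sum7)
    then show ?thesis using small Ke0 by simp
  qed
  \<comment> \<open>Eliminating \<open>L2\<close> by \<open>c2\<close> leaves a Sylvester equation
    for \<open>L1\<close> with coefficients 1 and 3. For \<open>Z1\<close> the opposite sign in the
    middle variable leads to the coefficients 3 and 1.\<close>
  have SL: "1 *\<^sub>R (D * L1) + 3 *\<^sub>R (L1 * D) = (L2 + 4 *\<^sub>R (L1 * D)) - Lo n1 d"
    unfolding c2 by (simp add: scaleR_left.add[of 1 "3::real", simplified])
  have SZ: "3 *\<^sub>R (D * Z1) + 1 *\<^sub>R (Z1 * D) = 3 *\<^sub>R Lo d n1 - (3 *\<^sub>R Z2 - 4 *\<^sub>R (Z1 * D))"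
    unfolding k2 by (simp add: scaleR_left.add[of 3 "1::real", simplified] algebra_simps)
  have bML: "norm (app (1 *\<^sub>R (Lo n n * L1) + 3 *\<^sub>R (L1 * Lo n n)) x) \<le> (15 * (K\<^sup>2 * e)) * norm x" for x
  proof -
    have "norm (1 *\<^sub>R (D * L1) + 3 *\<^sub>R (L1 * D)) \<le> 15 * (K\<^sup>2 * e)"
      unfolding SL using bL small norm_triangle_ineq4[of "L2 + 4 *\<^sub>R (L1 * D)" "Lo n1 d"] by linarith
    then show ?thesis unfolding D_def by (meson mult_right_mono norm_app_le norm_ge_zero order_trans)
  qed
  have bMZ: "norm (app (3 *\<^sub>R (Lo n n * Z1) + 1 *\<^sub>R (Z1 * Lo n n)) x) \<le> (17 * (K\<^sup>2 * e)) * norm x" for x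
  proof -
    have "norm (3 *\<^sub>R (D * Z1) + 1 *\<^sub>R (Z1 * D)) \<le> 17 * (K\<^sup>2 * e)"
      unfolding SZ using bZ small norm_triangle_ineq4[of "3 *\<^sub>R Lo d n1" "3 *\<^sub>R Z2 - 4 *\<^sub>R (Z1 * D)"] by simp
    then show ?thesis unfolding D_def by (meson mult_right_mono norm_app_le norm_ge_zero order_trans)
  qed
  have nL1: "norm L1 \<le> K" and nZ1: "norm Z1 \<le> K" unfolding L1_def Z1_def using nLo[OF nn1 z] by auto
  have L1D: "norm (app (L1 * D) x) \<le> (K / (3 * s) + s * (15 * (K\<^sup>2 * e)) * K) * norm x"
    unfolding D_def using bML nL1 n s Ke0 by (intro sylvester_decay[where p = 1 and q = 3]) auto
  have Z1D: "norm (app (Z1 * D) x) \<le> (K / (1 * s) + s * (17 * (K\<^sup>2 * e)) * K) * norm x"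
    unfolding D_def using bMZ nZ1 n s Ke0 by (intro sylvester_decay[where p = 3 and q = 1]) auto
  have K3: "K * (K\<^sup>2 * e) = K ^ 3 * e" by (simp add: power3_eq_cube power2_eq_square)
  have K3e: "0 \<le> s * (K ^ 3 * e)" using s K0 e0 by simp
  have Ks: "0 \<le> K / s" using K0 s by simp
  \<comment> \<open>Rounds the constants obtained for \<open>L2\<close> and for 3 times
    \<open>Z2\<close> up to the common ones of the statement.\<close>
  have lin: "14 * a + 4 / 3 * b + 60 * c \<le> 20 * a + 2 * b + 100 * c"
    "14 * a + 4 * b + 68 * c \<le> 3 * (20 * a + 2 * b + 100 * c)" if "0 \<le> a" "0 \<le> b" "0 \<le> c" for a b c :: real
    using that by simp_all
  show "norm (tp n2 z x) \<le> (2 * K / s + (100 * K ^ 3 * s + 20 * K\<^sup>2) * e) * norm x"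
  proof -
    have "tp n2 z x = app (L2 + 4 *\<^sub>R (L1 * D)) x - 4 *\<^sub>R app (L1 * D) x"
      by (simp add: app.add_left app.scaleR_left L2_def)
    then have "norm (tp n2 z x) \<le> norm (app (L2 + 4 *\<^sub>R (L1 * D)) x) + 4 * norm (app (L1 * D) x)"
      using norm_triangle_ineq4[of "app (L2 + 4 *\<^sub>R (L1 * D)) x" "4 *\<^sub>R app (L1 * D) x"] by simp
    also have "\<dots> \<le> (14 * (K\<^sup>2 * e)) * norm x + 4 * ((K / (3 * s) + s * (15 * (K\<^sup>2 * e)) * K) * norm x)"
      using order_trans[OF norm_app_le mult_right_mono[OF bL norm_ge_zero]] L1D by (intro add_mono mult_left_mono) auto
    also have "\<dots> = (14 * (K\<^sup>2 * e) + 4 / 3 * (K / s) + 60 * (s * (K ^ 3 * e))) * norm x"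
      unfolding K3[symmetric] by (simp add: algebra_simps)
    also have "\<dots> \<le> (20 * (K\<^sup>2 * e) + 2 * (K / s) + 100 * (s * (K ^ 3 * e))) * norm x"
      by (intro mult_right_mono lin Ke0 K3e Ks) simp
    finally show ?thesis by (simp add: algebra_simps)
  qed
  show "norm (tp z n2 x) \<le> (2 * K / s + (100 * K ^ 3 * s + 20 * K\<^sup>2) * e) * norm x"
  proof -
    have "3 *\<^sub>R tp z n2 x = app (3 *\<^sub>R Z2 - 4 *\<^sub>R (Z1 * D)) x + 4 *\<^sub>R app (Z1 * D) x"
      by (simp add: app.diff_left app.scaleR_left Z2_def)
    then have "norm (3 *\<^sub>R tp z n2 x) \<le> norm (app (3 *\<^sub>R Z2 - 4 *\<^sub>R (Z1 * D)) x) + 4 * norm (app (Z1 * D) x)"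
      using norm_triangle_ineq[of "app (3 *\<^sub>R Z2 - 4 *\<^sub>R (Z1 * D)) x" "4 *\<^sub>R app (Z1 * D) x"] by simp
    also have "\<dots> \<le> (14 * (K\<^sup>2 * e)) * norm x + 4 * ((K / (1 * s) + s * (17 * (K\<^sup>2 * e)) * K) * norm x)"
      using order_trans[OF norm_app_le mult_right_mono[OF bZ norm_ge_zero]] Z1D by (intro add_mono mult_left_mono) auto
    also have "\<dots> = (14 * (K\<^sup>2 * e) + 4 * (K / s) + 68 * (s * (K ^ 3 * e))) * norm x"
      unfolding K3[symmetric] by (simp add: algebra_simps)
    also have "\<dots> \<le> (3 * (20 * (K\<^sup>2 * e) + 2 * (K / s) + 100 * (s * (K ^ 3 * e)))) * norm x"
      by (intro mult_right_mono lin Ke0 K3e Ks) simp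
    also have "\<dots> = 3 * ((20 * (K\<^sup>2 * e) + 2 * (K / s) + 100 * (s * (K ^ 3 * e))) * norm x)" by (simp only: mult.assoc)
    finally have "norm (tp z n2 x) \<le> (20 * (K\<^sup>2 * e) + 2 * (K / s) + 100 * (s * (K ^ 3 * e))) * norm x" by simp
    then show ?thesis by (simp add: algebra_simps)
  qed
qed

lemma exp_growth: "0 \<le> r \<Longrightarrow> norm n \<le> 1 \<Longrightarrow> norm (app (expL n r) x) \<le> exp (r * K) * norm x"
proof -
  assume r: "0 \<le> r" and n: "norm n \<le> 1"
  have "K * norm n * norm n \<le> K * 1 * 1" using n K0 by (intro mult_mono) auto
  then have "norm (r *\<^sub>R Lo n n) \<le> r * K" using norm_Lo[of n n] r by (simp add: mult_left_mono)
  then have "norm (expL n r) \<le> exp (r * K)"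
    unfolding expL_def using norm_exp[of "r *\<^sub>R Lo n n"] by (meson exp_le_cancel_iff order_trans)
  then show ?thesis using norm_app_le[of "expL n r" x] by (meson mult_right_mono norm_ge_zero order_trans)
qed

lemma R_self_small:
  assumes "0 < c" shows "\<exists>S>0. \<forall>t\<ge>S. \<forall>n. norm n \<le> 1 \<longrightarrow> norm (R n t n) \<le> c"
proof -
  define S where "S = 1 / (3 * c ^ 3)"
  have S: "S > 0" unfolding S_def using assms by simp
  have "norm (R n t n) \<le> c" if t: "t \<ge> S" and n: "norm n \<le> 1" for t n
  proof -
    have t0: "t > 0" using t S by simp
    have "norm (R n t n) ^ 3 \<le> norm n / (3 * t)" by (rule R_self_decay[OF t0])
    also have "\<dots> \<le> 1 / (3 * t)" using n t0 by (simp add: divide_right_mono)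
    also have "\<dots> \<le> 1 / (3 * S)" using t S by (simp add: frac_le)
    also have "\<dots> = c ^ 3" unfolding S_def using assms by simp
    finally show ?thesis using assms by (metis power_mono_iff norm_ge_zero less_imp_le zero_less_numeral)
  qed
  then show ?thesis using S by blast
qed

text \<open>The first vector is small by the decay of D R. In the second one \<open>Q_R\<close>
  moves half of the time onto each outer factor, and \<open>R n (t / 2) n\<close> is small by
  itself.\<close>

lemma null_small:
  assumes "0 < c"
  shows "\<exists>T>0. \<forall>t\<ge>T. \<forall>n y. norm n \<le> 1 \<longrightarrow> norm y \<le> 1 \<longrightarrow> norm (tp n n (R n t y)) \<le> c \<and> norm (tp n (R n t y) n) \<le> c"
proof -
  define b where "b = min 1 (c / K)"
  have b: "b > 0" "b \<le> 1" unfolding b_def using assms K1 by auto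
  have "K * (c / K) = c" using K1 by simp
  moreover have "K * b \<le> K * (c / K)" unfolding b_def using K0 by (intro mult_left_mono) auto
  ultimately have bc: "K * b \<le> c" by simp
  obtain S where S: "S > 0" "\<And>t n. t \<ge> S \<Longrightarrow> norm n \<le> 1 \<Longrightarrow> norm (R n t n) \<le> b"
    using R_self_small[OF b(1)] by blast
  define T where "T = max (2 * S) (1 / c)"
  have T: "T > 0" unfolding T_def using S by simp
  have "norm (tp n n (R n t y)) \<le> c \<and> norm (tp n (R n t y) n) \<le> c" if t: "t \<ge> T" and n: "norm n \<le> 1" and y: "norm y \<le> 1" for t n y
  proof
    have t0: "t > 0" using t T by simp
    have "norm (tp n n (R n t y)) \<le> norm y / t" by (rule R_decay1[OF t0])
    also have "\<dots> \<le> 1 / t" using y t0 by (simp add: divide_right_mono)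
    also have "\<dots> \<le> c" using t assms t0 unfolding T_def by (simp add: field_simps)
    finally show "norm (tp n n (R n t y)) \<le> c" .
    have v: "norm (R n (t / 2) n) \<le> b" using S(2)[of "t / 2" n] t n unfolding T_def by simp
    have "tp n (R n t y) n = tp (R n (t / 2) n) y (R n (t / 2) n)" using Q_R[of n "t / 2" y] by simp
    then have "norm (tp n (R n t y) n) \<le> K * b * 1 * b" using tp_bound'[OF v y v] by simp
    also have "\<dots> \<le> K * b * 1" using b K0 by (simp add: mult_left_le)
    finally show "norm (tp n (R n t y) n) \<le> c" using bc by simp
  qed
  then show ?thesis using T by blast
qed

lemma orth_core_small:
  assumes "0 < \<eta>"
  shows "\<exists>T>0. \<forall>t\<ge>T. \<forall>n y x. norm n \<le> 1 \<longrightarrow> norm y \<le> 1 \<longrightarrow>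
    norm (tp (tp n n (tp n n n)) (R n t y) x) \<le> \<eta> * norm x \<and> norm (tp (R n t y) (tp n n (tp n n n)) x) \<le> \<eta> * norm x"
proof -
  \<comment> \<open>For this s the term 2 K / s equals \<eta> / 2; the other half is left for the
    term that is linear in e.\<close>
  define s where "s = 4 * K / \<eta>"
  have s: "s > 0" unfolding s_def using assms K1 by simp
  define C where "C = 100 * K ^ 3 * s + 20 * K\<^sup>2"
  have C: "C > 0" unfolding C_def using s K1 by (simp add: add_pos_pos)
  obtain T where T: "T > 0" "\<And>t n y. t \<ge> T \<Longrightarrow> norm n \<le> 1 \<Longrightarrow> norm y \<le> 1 \<Longrightarrow>
    norm (tp n n (R n t y)) \<le> \<eta> / (2 * C) \<and> norm (tp n (R n t y) n) \<le> \<eta> / (2 * C)"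
    using null_small[of "\<eta> / (2 * C)"] assms C by (metis divide_pos_pos mult_pos_pos zero_less_numeral)
  have eq: "2 * K / s + C * (\<eta> / (2 * C)) = \<eta>" unfolding s_def using C assms K1 by simp
  have "norm (tp (tp n n (tp n n n)) (R n t y) x) \<le> \<eta> * norm x \<and> norm (tp (R n t y) (tp n n (tp n n n)) x) \<le> \<eta> * norm x"
    if t: "t \<ge> T" and n: "norm n \<le> 1" and y: "norm y \<le> 1" for t n y x
  proof -
    have z: "norm (R n t y) \<le> 1" using y t T(1) by (intro norm_R_le) auto
    show ?thesis
      using orth_core[OF n z s, of "\<eta> / (2 * C)" x] T(2)[OF t n y] eq unfolding C_def by simp
  qed
  then show ?thesis using T(1) by blast
qed

lemma R_deriv: "((\<lambda>r. R n r x) has_vector_derivative - tp n n (R n r x)) (at r)"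
  using bounded_linear.has_vector_derivative[OF app.bounded_linear_left[of x] expL_neg_deriv[of n r]]
  unfolding app.minus_left app_mult app_Lo R_def .

lemma tp_R_deriv1: "((\<lambda>r. tp (R n r v) z x) has_vector_derivative - tp (R n r (tp n n v)) z x) (at r)"
  using bounded_linear.has_vector_derivative[OF bl1[of z x] R_deriv[of n v r]]
  unfolding tp_neg1 R_D .

lemma tp_R_deriv2: "((\<lambda>r. tp z (R n r v) x) has_vector_derivative - tp z (R n r (tp n n v)) x) (at r)"
  using bounded_linear.has_vector_derivative[OF bl2[of z x] R_deriv[of n v r]]
  unfolding tp_neg2 R_D .

lemma norm_from_second_difference:
  fixes a b c :: "'v::real_normed_vector"
  assumes "norm (c - 2 *\<^sub>R b + a) \<le> e" shows "norm a \<le> e + 2 * norm b + norm c"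
proof -
  have "a = (c - 2 *\<^sub>R b + a) + 2 *\<^sub>R b - c" by simp
  then have "norm a \<le> norm (c - 2 *\<^sub>R b + a) + norm (2 *\<^sub>R b) + norm c"
    by (metis norm_triangle_ineq norm_triangle_ineq4 add_right_mono order_trans)
  then show ?thesis using assms by simp
qed

text \<open>For large S the vector n is nearly the second difference R n (2 S) n - 2 R n S n + n, which involves
  only D^2 n, up to the action of the semigroup.\<close>

theorem orthogonality:
  assumes "0 < \<eta>"
  shows "\<exists>T>0. \<forall>t\<ge>T. \<forall>n y x. norm n \<le> 1 \<longrightarrow> norm y \<le> 1 \<longrightarrow>
    norm (tp n (R n t y) x) \<le> \<eta> * norm x \<and> norm (tp (R n t y) n x) \<le> \<eta> * norm x"
proof -
  \<comment> \<open>Half of \<eta> is spent on R n S n and R n (2 S) n, which contribute (2 + 1) K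
    c. The number e below is chosen so that the second difference contributes the other half, growth
    factor exp (2 S K) included.\<close>
  define c where "c = \<eta> / (6 * K)"
  have c: "c > 0" unfolding c_def using assms K1 by simp
  obtain S where S: "S > 0" "\<And>t n. t \<ge> S \<Longrightarrow> norm n \<le> 1 \<Longrightarrow> norm (R n t n) \<le> c"
    using R_self_small[OF c] by blast
  define e where "e = \<eta> / (2 * S\<^sup>2 * exp (2 * S * K))"
  have e: "e > 0" unfolding e_def using assms S by simp
  obtain T where T: "T > 0" "\<And>t n y x. t \<ge> T \<Longrightarrow> norm n \<le> 1 \<Longrightarrow> norm y \<le> 1 \<Longrightarrow>
    norm (tp (tp n n (tp n n n)) (R n t y) x) \<le> e * norm x \<and> norm (tp (R n t y) (tp n n (tp n n n)) x) \<le> e * norm x"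
    using orth_core_small[OF e] by blast
  have "norm (tp n (R n t y) x) \<le> \<eta> * norm x \<and> norm (tp (R n t y) n x) \<le> \<eta> * norm x"
    if t: "t \<ge> T" and n: "norm n \<le> 1" and y: "norm y \<le> 1" for t n y x
  proof -
    define n2 where "n2 = tp n n (tp n n n)"
    define z where "z = R n t y"
    have z: "norm z \<le> 1" unfolding z_def using y t T(1) by (intro norm_R_le) auto
    define B where "B = e * exp (2 * S * K) * norm x"
    have zr: "app (expL n (- r)) z = R n (r + t) y" for r
      unfolding z_def by (simp add: R_add) (simp add: R_def)
    \<comment> \<open>Conjugation by the group moves \<open>R n r\<close> from \<open>n2\<close>
      onto z, which turns into the vector of the later time r + t. The bound by e holds for all
      times from T on, and the conjugation costs at most exp (2 S K).\<close>
    have b1: "norm (tp (R n r n2) z x) \<le> B" and b2: "norm (tp z (R n r n2) x) \<le> B" if r: "0 \<le> r" "r \<le> 2 * S" for r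
    proof -
      have g: "exp (r * K) \<le> exp (2 * S * K)" using r K0 by (simp add: mult_right_mono)
      have Ez: "app (expL n r) (R n (r + t) y) = z" unfolding zr[symmetric] expL_expL by simp
      have "Lo (R n r n2) z = expL n (- r) * Lo n2 (R n (r + t) y) * expL n r"
        using expL_auto[of n "- r" n2 "R n (r + t) y"] Ez by (simp add: R_def)
      then have "tp (R n r n2) z x = R n r (tp n2 (R n (r + t) y) (app (expL n r) x))"
        using arg_cong[of _ _ "\<lambda>X. app X x"] by (simp add: R_def flip: app_Lo)
      then have "norm (tp (R n r n2) z x) \<le> norm (tp n2 (R n (r + t) y) (app (expL n r) x))" using R_contr r by simp
      also have "\<dots> \<le> e * norm (app (expL n r) x)" unfolding n2_def using T(2)[of "r + t" n y "app (expL n r) x"] r t n y by simp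
      also have "\<dots> \<le> e * (exp (r * K) * norm x)" using exp_growth[OF r(1) n] e by (intro mult_left_mono) auto
      also have "\<dots> \<le> e * (exp (2 * S * K) * norm x)" using g e by (intro mult_left_mono mult_right_mono) auto
      finally show "norm (tp (R n r n2) z x) \<le> B" unfolding B_def by (simp add: mult.assoc)
      have "Lo z (R n r n2) = expL n r * Lo (R n (r + t) y) n2 * expL n (- r)"
        using expL_auto[of n r "R n (r + t) y" n2] Ez by (simp add: R_def)
      then have "tp z (R n r n2) x = app (expL n r) (tp (R n (r + t) y) n2 (R n r x))"
        using arg_cong[of _ _ "\<lambda>X. app X x"] by (simp add: R_def flip: app_Lo)
      then have "norm (tp z (R n r n2) x) \<le> exp (r * K) * norm (tp (R n (r + t) y) n2 (R n r x))"
        using exp_growth[OF r(1) n] by simp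
      also have "\<dots> \<le> exp (r * K) * (e * norm (R n r x))" unfolding n2_def using T(2)[of "r + t" n y "R n r x"] r t n y by (intro mult_left_mono) auto
      also have "\<dots> \<le> exp (2 * S * K) * (e * norm x)" using g e R_contr[OF r(1)] by (intro mult_mono) auto
      finally show "norm (tp z (R n r n2) x) \<le> B" unfolding B_def by (simp add: mult_ac)
    qed
    have S0: "0 \<le> S" using S(1) by simp
    have BS: "B * S\<^sup>2 = \<eta> / 2 * norm x" unfolding B_def e_def using S(1) by (simp add: field_simps)
    have rS: "norm (R n S n) \<le> c" "norm (R n (2 * S) n) \<le> c" using S n by auto
    have Kc: "K * c = \<eta> / 6" unfolding c_def using K1 by simp
    have "norm (tp (R n (2 * S) n) z x - 2 *\<^sub>R tp (R n S n) z x + tp (R n 0 n) z x) \<le> B * S\<^sup>2"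
      using b1 unfolding n2_def
      by (intro second_difference_bound[OF S0 tp_R_deriv1, where f'' = "\<lambda>r. tp (R n r (tp n n (tp n n n))) z x"])
        (use has_vector_derivative_minus[OF tp_R_deriv1] in auto)
    then have "norm (tp n z x) \<le> B * S\<^sup>2 + 2 * norm (tp (R n S n) z x) + norm (tp (R n (2 * S) n) z x)"
      by (intro norm_from_second_difference) simp
    moreover have "norm (tp (R n S n) z x) \<le> K * c * 1 * norm x" "norm (tp (R n (2 * S) n) z x) \<le> K * c * 1 * norm x"
      using rS z by (auto intro!: tp_bound' simp del: mult_1_right)
    ultimately have 1: "norm (tp n z x) \<le> \<eta> * norm x" unfolding BS Kc by simp
    have "norm (tp z (R n (2 * S) n) x - 2 *\<^sub>R tp z (R n S n) x + tp z (R n 0 n) x) \<le> B * S\<^sup>2"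
      using b2 unfolding n2_def
      by (intro second_difference_bound[OF S0 tp_R_deriv2, where f'' = "\<lambda>r. tp z (R n r (tp n n (tp n n n))) x"])
        (use has_vector_derivative_minus[OF tp_R_deriv2] in auto)
    then have "norm (tp z n x) \<le> B * S\<^sup>2 + 2 * norm (tp z (R n S n) x) + norm (tp z (R n (2 * S) n) x)"
      by (intro norm_from_second_difference) simp
    moreover have "norm (tp z (R n S n) x) \<le> K * 1 * c * norm x" "norm (tp z (R n (2 * S) n) x) \<le> K * 1 * c * norm x"
      using tp_bound'[OF z rS(1) order_refl] tp_bound'[OF z rS(2) order_refl] by auto
    ultimately have 2: "norm (tp z n x) \<le> \<eta> * norm x" using Kc unfolding BS by simp
    show ?thesis using 1 2 unfolding z_def by blast
  qed
  then show ?thesis using T(1) by blast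
qed

end

section \<open>Norm estimates\<close>

text \<open>A crude upper half of Stirling's formula; the induction step is (n / (n + 1))^(n + 1)
  \<le> 1 / e.\<close>

lemma fact_mult_exp_le: "1 \<le> n \<Longrightarrow> fact n * exp (real n) \<le> exp 1 * real n ^ (n + 1)"
proof (induction n rule: dec_induct)
  case (step n)
  have "exp 1 * real n ^ (n + 1) \<le> real (Suc n) ^ (n + 1)"
  proof -
    have "real n / real (Suc n) = 1 + - (1 / real (Suc n))" by (simp add: field_simps)
    also have "\<dots> \<le> exp (- (1 / real (Suc n)))" by (rule exp_ge_add_one_self)
    finally have "(real n / real (Suc n)) ^ (n + 1) \<le> exp (- (1 / real (Suc n))) ^ (n + 1)"
      by (intro power_mono) auto
    also have "\<dots> = exp (real (n + 1) * - (1 / real (Suc n)))" by (rule exp_of_nat_mult[symmetric])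
    also have "real (n + 1) * - (1 / real (Suc n)) = - 1" by simp
    finally show ?thesis by (simp add: power_divide exp_minus field_simps del: power_Suc of_nat_Suc)
  qed
  then have "(real (Suc n) * exp 1) * (exp 1 * real n ^ (n + 1)) \<le> (real (Suc n) * exp 1) * real (Suc n) ^ (n + 1)"
    by (intro mult_left_mono) auto
  moreover have "fact (Suc n) * exp (real (Suc n)) = (real (Suc n) * exp 1) * (fact n * exp (real n))"
    by (simp add: exp_add algebra_simps)
  moreover have "(real (Suc n) * exp 1) * (fact n * exp (real n)) \<le> (real (Suc n) * exp 1) * (exp 1 * real n ^ (n + 1))"
    using step.IH by (intro mult_left_mono) auto
  ultimately show ?case by (simp add: algebra_simps)
qed simp

lemma norm_three:
  fixes a b c :: "'v::real_normed_vector"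
  shows "norm (a - b + c) \<le> norm a + norm b + norm c" "norm (a + b + c) \<le> norm a + norm b + norm c"
  using norm_triangle_ineq[of "a - b" c] norm_triangle_ineq4[of a b] norm_triangle_ineq[of "a + b" c] norm_triangle_ineq[of a b]
  by linarith+

section \<open>Approximate orthogonality and the norm of a sum\<close>

context jb_triple begin

definition orth :: "real \<Rightarrow> 'a \<Rightarrow> 'a \<Rightarrow> bool" where
  "orth \<theta> m z \<longleftrightarrow> (\<forall>x. norm (tp m z x) \<le> \<theta> * norm x \<and> norm (tp z m x) \<le> \<theta> * norm x)"

lemma orth_sym: "orth \<theta> m z \<Longrightarrow> orth \<theta> z m"
  by (auto simp: orth_def)

lemma orth_mono: "orth \<theta> m z \<Longrightarrow> \<theta> \<le> \<theta>' \<Longrightarrow> orth \<theta>' m z"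
  unfolding orth_def by (meson mult_right_mono norm_ge_zero order_trans)

text \<open>Since m^3 = D m for D = \<open>tp m m\<close>, the commutators of D with L(m, z) and
  L(z, m) produce the operators of m^3 and z. Each of the three resulting terms contains a factor of
  size \<theta>.\<close>

lemma orth_cb:
  assumes o: "orth \<theta> m z" and m: "norm m \<le> 1" and z: "norm z \<le> 1" and \<theta>: "0 \<le> \<theta>"
  shows "orth (3 * K * \<theta>) (cb m) z"
  unfolding orth_def
proof (intro allI conjI)
  fix x
  have o1: "norm (tp m z x) \<le> \<theta> * norm x" "norm (tp z m x) \<le> \<theta> * norm x" for x using o by (auto simp: orth_def)
  have d: "norm (tp m m z) \<le> \<theta>"
  proof -
    have "norm (tp m m z) \<le> \<theta> * norm m" using o1(2)[of m] tp_sym[of m m z] by simp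
    also have "\<dots> \<le> \<theta> * 1" using m \<theta> by (intro mult_left_mono) auto
    finally show ?thesis by simp
  qed
  have Dx: "norm (tp m m x) \<le> K * norm x" using tp_bound'[OF m m, of x "norm x"] by simp
  have b: "norm (tp m m (tp m z x)) \<le> K * \<theta> * norm x" "norm (tp m m (tp z m x)) \<le> K * \<theta> * norm x"
    using tp_bound'[OF m m o1(1)[of x]] tp_bound'[OF m m o1(2)[of x]] by (simp_all add: mult.assoc)
  have c: "norm (tp m z (tp m m x)) \<le> K * \<theta> * norm x" "norm (tp z m (tp m m x)) \<le> K * \<theta> * norm x"
    using order_trans[OF o1(1)[of "tp m m x"] mult_left_mono[OF Dx \<theta>]] order_trans[OF o1(2)[of "tp m m x"] mult_left_mono[OF Dx \<theta>]]
    by (simp_all add: mult_ac)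
  have e: "norm (tp m (tp m m z) x) \<le> K * \<theta> * norm x" "norm (tp (tp m m z) m x) \<le> K * \<theta> * norm x"
    using tp_bound'[OF m d, of x "norm x"] tp_bound'[OF d m, of x "norm x"] by simp_all
  have "tp (cb m) z x = tp m m (tp m z x) - tp m z (tp m m x) + tp m (tp m m z) x"
    using L_comm[of m m m z x] by (simp add: cb_def algebra_simps)
  then have "norm (tp (cb m) z x) \<le> norm (tp m m (tp m z x)) + norm (tp m z (tp m m x)) + norm (tp m (tp m m z) x)"
    by (simp only: norm_three)
  then show "norm (tp (cb m) z x) \<le> 3 * K * \<theta> * norm x" using b c e by simp
  have "tp z (cb m) x = tp (tp m m z) m x - tp m m (tp z m x) + tp z m (tp m m x)"
    using L_comm[of m m z m x] by (simp add: cb_def algebra_simps)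
  then have "norm (tp z (cb m) x) \<le> norm (tp (tp m m z) m x) + norm (tp m m (tp z m x)) + norm (tp z m (tp m m x))"
    by (simp only: norm_three)
  then show "norm (tp z (cb m) x) \<le> 3 * K * \<theta> * norm x" using b c e by simp
qed

lemma norm_cb: "norm (cb x) = norm x ^ 3"
  by (simp add: cb_def cube_norm)

text \<open>Each of the six mixed terms can be written with m and z as its first two
  entries.\<close>

lemma cb_add_orth:
  assumes o: "orth \<theta> m z" and m: "norm m \<le> 1" and z: "norm z \<le> 1" and \<theta>: "0 \<le> \<theta>"
  shows "norm (cb (m + z) - (cb m + cb z)) \<le> 6 * \<theta>"
proof -
  have b: "norm (tp m z x) \<le> \<theta>" "norm (tp z m x) \<le> \<theta>" if "norm x \<le> 1" for x
    using o that mult_left_mono[OF that \<theta>] unfolding orth_def by (auto intro: order_trans)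
  have "cb (m + z) - (cb m + cb z) = tp m z m + tp z m m + tp z m m + tp m z z + tp m z z + tp z m z"
    unfolding cb_def using tp_sym[of m m z] tp_sym[of z z m] by (simp add: tp_add1 tp_add2 tp_add3)
  then have "norm (cb (m + z) - (cb m + cb z)) \<le> norm (tp m z m) + norm (tp z m m) + norm (tp z m m) + norm (tp m z z) + norm (tp m z z) + norm (tp z m z)"
    by (simp add: norm_triangle_le add_mono)
  then show ?thesis using b[OF m] b[OF z] by simp
qed

lemma cb_diff: "cb a - cb b = tp (a - b) a a + tp b (a - b) a + tp b b (a - b)"
  by (simp add: cb_def tp_diff1 tp_diff2 tp_diff3)

lemma cb_iter_unif_cont:
  assumes "0 < \<eta>" "0 \<le> r"
  shows "\<exists>\<theta>>0. \<forall>a b. norm a \<le> r \<longrightarrow> norm b \<le> r \<longrightarrow> norm (a - b) \<le> \<theta> \<longrightarrow> norm ((cb ^^ j) a - (cb ^^ j) b) \<le> \<eta>"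
  using assms
proof (induction j arbitrary: r)
  case 0 then show ?case by auto
next
  case (Suc j)
  obtain \<theta>' where \<theta>': "\<theta>' > 0" "\<And>a b. norm a \<le> r ^ 3 \<Longrightarrow> norm b \<le> r ^ 3 \<Longrightarrow> norm (a - b) \<le> \<theta>' \<Longrightarrow> norm ((cb ^^ j) a - (cb ^^ j) b) \<le> \<eta>"
    using Suc.IH[of "r ^ 3"] Suc.prems by auto
  define \<theta> where "\<theta> = \<theta>' / (3 * K * r\<^sup>2 + 1)"
  have pos: "3 * K * r\<^sup>2 + 1 > 0" using K0 by (simp add: add_nonneg_pos)
  have "norm ((cb ^^ Suc j) a - (cb ^^ Suc j) b) \<le> \<eta>" if a: "norm a \<le> r" and b: "norm b \<le> r" and ab: "norm (a - b) \<le> \<theta>" for a b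
  proof -
    have "norm (cb a - cb b) \<le> norm (tp (a - b) a a) + norm (tp b (a - b) a) + norm (tp b b (a - b))"
      unfolding cb_diff by (rule norm_three)
    also have "\<dots> \<le> K * \<theta> * r * r + K * r * \<theta> * r + K * r * r * \<theta>"
      using a b ab by (intro add_mono tp_bound')
    also have "\<dots> \<le> (3 * K * r\<^sup>2 + 1) * \<theta>"
      using \<theta>'(1) pos unfolding \<theta>_def by (simp add: power2_eq_square algebra_simps add_divide_distrib[symmetric] divide_right_mono)
    also have "\<dots> = \<theta>'" unfolding \<theta>_def using pos by simp
    finally have "norm ((cb ^^ j) (cb a) - (cb ^^ j) (cb b)) \<le> \<eta>"
      using a b by (intro \<theta>'(2)) (auto simp: norm_cb intro: power_mono)
    then show ?thesis by (simp add: funpow_swap1)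
  qed
  moreover have "\<theta> > 0" unfolding \<theta>_def using \<theta>'(1) pos by simp
  ultimately show ?case by blast
qed

lemma cb_iter_orth:
  assumes "0 < \<eta>"
  shows "\<exists>\<theta>>0. \<forall>m z. norm m \<le> 1 \<longrightarrow> norm z \<le> 1 \<longrightarrow> orth \<theta> m z \<longrightarrow>
    norm ((cb ^^ j) (m + z) - ((cb ^^ j) m + (cb ^^ j) z)) \<le> \<eta>"
  using assms
proof (induction j arbitrary: \<eta>)
  case 0 then show ?case by (auto intro: exI[of _ 1])
next
  case (Suc j)
  obtain \<theta>1 where \<theta>1: "\<theta>1 > 0" "\<And>m z. norm m \<le> 1 \<Longrightarrow> norm z \<le> 1 \<Longrightarrow> orth \<theta>1 m z \<Longrightarrow>
    norm ((cb ^^ j) (m + z) - ((cb ^^ j) m + (cb ^^ j) z)) \<le> \<eta> / 2"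
    using Suc.IH[of "\<eta> / 2"] Suc.prems by auto
  obtain \<theta>2 where \<theta>2: "\<theta>2 > 0" "\<And>a b. norm a \<le> 8 \<Longrightarrow> norm b \<le> 8 \<Longrightarrow> norm (a - b) \<le> \<theta>2 \<Longrightarrow> norm ((cb ^^ j) a - (cb ^^ j) b) \<le> \<eta> / 2"
    using cb_iter_unif_cont[of "\<eta> / 2" 8 j] Suc.prems by auto
  \<comment> \<open>Two uses of \<open>orth_cb\<close>, one for each argument, multiply the defect
    by (3 K)^2; \<open>cb_add_orth\<close> multiplies it by 6.\<close>
  define \<theta> where "\<theta> = min (\<theta>1 / (9 * K\<^sup>2)) (\<theta>2 / 6)"
  have Kp: "9 * K\<^sup>2 > 0" using K1 by simp
  have \<theta>: "\<theta> > 0" unfolding \<theta>_def using \<theta>1(1) \<theta>2(1) Kp by simp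
  have "\<theta> \<le> \<theta>1 / (9 * K\<^sup>2)" unfolding \<theta>_def by simp
  then have t1: "9 * K\<^sup>2 * \<theta> \<le> \<theta>1" using Kp by (simp add: field_simps)
  have t2: "6 * \<theta> \<le> \<theta>2" unfolding \<theta>_def by simp
  have "norm ((cb ^^ Suc j) (m + z) - ((cb ^^ Suc j) m + (cb ^^ Suc j) z)) \<le> \<eta>"
    if m: "norm m \<le> 1" and z: "norm z \<le> 1" and o: "orth \<theta> m z" for m z
  proof -
    have cm: "norm (cb m) \<le> 1" and cz: "norm (cb z) \<le> 1" using m z by (auto simp: norm_cb power_le_one)
    have p: "0 \<le> \<theta>" "0 \<le> 3 * K * \<theta>" using \<theta> K0 by simp_all
    have "orth (3 * K * \<theta>) z (cb m)" by (rule orth_sym[OF orth_cb[OF o m z p(1)]])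
    then have o2: "orth (3 * K * (3 * K * \<theta>)) (cb z) (cb m)" by (rule orth_cb[OF _ z cm p(2)])
    have "3 * K * (3 * K * \<theta>) \<le> \<theta>1" using t1 by (simp add: power2_eq_square algebra_simps)
    then have "orth \<theta>1 (cb m) (cb z)" by (rule orth_mono[OF orth_sym[OF o2]])
    then have 1: "norm ((cb ^^ j) (cb m + cb z) - ((cb ^^ j) (cb m) + (cb ^^ j) (cb z))) \<le> \<eta> / 2"
      using \<theta>1(2) cm cz by blast
    have "norm (m + z) \<le> 2" using m z norm_triangle_ineq[of m z] by simp
    then have "norm (m + z) ^ 3 \<le> 2 ^ 3" by (intro power_mono) auto
    then have n8: "norm (cb (m + z)) \<le> 8" by (simp add: norm_cb)
    have n8': "norm (cb m + cb z) \<le> 8" using cm cz norm_triangle_ineq[of "cb m" "cb z"] by simp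
    have "norm (cb (m + z) - (cb m + cb z)) \<le> \<theta>2" using cb_add_orth[OF o m z] \<theta> t2 by simp
    then have 2: "norm ((cb ^^ j) (cb (m + z)) - (cb ^^ j) (cb m + cb z)) \<le> \<eta> / 2" by (intro \<theta>2(2) n8 n8')
    from norm_diff_triangle_le[OF 2 1]
    show ?thesis by (simp add: funpow_swap1)
  qed
  then show ?case using \<theta> by blast
qed

text \<open>Iterated cubing raises norms to the power 3^k and stays nearly additive on m and z, so
  \<open>norm (m + z) ^ (3 ^ k)\<close> is at most 3. The roots of 3 of order 3^k tend to 1.\<close>

theorem orth_norm:
  assumes "0 < \<eta>"
  shows "\<exists>\<theta>>0. \<forall>m z. norm m \<le> 1 \<longrightarrow> norm z \<le> 1 \<longrightarrow> orth \<theta> m z \<longrightarrow> norm (m + z) \<le> 1 + \<eta>"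
proof -
  have "\<exists>k. 3 < (1 + \<eta>) ^ k" using real_arch_pow[of "1 + \<eta>" 3] assms by simp
  then obtain k where k: "3 < (1 + \<eta>) ^ k" by blast
  have "k < 2 ^ k" "2 ^ k \<le> (3::nat) ^ k" by (simp_all add: power_mono)
  then have "k \<le> 3 ^ k" by linarith
  then have "(1 + \<eta>) ^ k \<le> (1 + \<eta>) ^ (3 ^ k)" using assms by (intro power_increasing) auto
  then have k3: "3 \<le> (1 + \<eta>) ^ (3 ^ k)" using k by linarith
  obtain \<theta> where \<theta>: "\<theta> > 0" "\<And>m z. norm m \<le> 1 \<Longrightarrow> norm z \<le> 1 \<Longrightarrow> orth \<theta> m z \<Longrightarrow>
    norm ((cb ^^ k) (m + z) - ((cb ^^ k) m + (cb ^^ k) z)) \<le> 1"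
    using cb_iter_orth[of 1 k] by auto
  have "norm (m + z) \<le> 1 + \<eta>" if m: "norm m \<le> 1" and z: "norm z \<le> 1" and o: "orth \<theta> m z" for m z
  proof -
    have "norm ((cb ^^ k) m) \<le> 1" "norm ((cb ^^ k) z) \<le> 1" using m z by (auto simp: norm_cb_iter power_le_one)
    then have "norm ((cb ^^ k) (m + z)) \<le> 3"
      using \<theta>(2)[OF m z o] norm_triangle_ineq[of "(cb ^^ k) m" "(cb ^^ k) z"]
        norm_triangle_ineq2[of "(cb ^^ k) (m + z)" "(cb ^^ k) m + (cb ^^ k) z"] by linarith
    then have "norm (m + z) ^ (3 ^ k) \<le> (1 + \<eta>) ^ (3 ^ k)" using k3 by (simp add: norm_cb_iter)
    then show ?thesis using assms by (simp add: power_mono_iff)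
  qed
  then show ?thesis using \<theta>(1) by blast
qed

corollary R_orth_norm:
  assumes "0 < \<eta>"
  shows "\<exists>T>0. \<forall>t\<ge>T. \<forall>n y. norm n \<le> 1 \<longrightarrow> norm y \<le> 1 \<longrightarrow> norm (n + R n t y) \<le> 1 + \<eta> \<and> norm (n - R n t y) \<le> 1 + \<eta>"
proof -
  obtain \<theta> where \<theta>: "\<theta> > 0" "\<And>m z. norm m \<le> 1 \<Longrightarrow> norm z \<le> 1 \<Longrightarrow> orth \<theta> m z \<Longrightarrow> norm (m + z) \<le> 1 + \<eta>"
    using orth_norm[OF assms] by blast
  obtain T where T: "T > 0" "\<And>t n y. t \<ge> T \<Longrightarrow> norm n \<le> 1 \<Longrightarrow> norm y \<le> 1 \<Longrightarrow> orth \<theta> n (R n t y)"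
    using orthogonality[OF \<theta>(1)] unfolding orth_def by blast
  have "norm (n + R n t y) \<le> 1 + \<eta> \<and> norm (n - R n t y) \<le> 1 + \<eta>" if t: "t \<ge> T" and n: "norm n \<le> 1" and y: "norm y \<le> 1" for t n y
  proof -
    have 1: "norm (n + R n t y) \<le> 1 + \<eta>" if "norm y \<le> 1" for y
      using that t T n by (intro \<theta>(2)) (auto intro!: norm_R_le)
    have "R n t (- y) = - R n t y" by (rule linear_neg[OF bounded_linear.linear[OF bounded_linear_R]])
    then show ?thesis using 1[of y] 1[of "- y"] y by simp
  qed
  then show ?thesis using T(1) by blast
qed

section \<open>First-order norm estimates for derivations and for cubing\<close>

lemma norm_exp_J_le: "norm (app (exp (t *\<^sub>R emb (\<lambda>x. J (tp c c x)))) u) \<le> norm u"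
  using hermitian_op.norm_exp_JT[OF hermitian_op] .

text \<open>The map is the first-order part of the contraction exp (i s L(c, c)). The constant
  reflects that i s L(c, c) has norm at most 4 K |s| when norm c \<le> 2.\<close>

lemma box_J_first_order:
  assumes "norm c \<le> 2" "\<bar>s\<bar> \<le> 1"
  shows "norm (u + s *\<^sub>R J (tp c c u)) \<le> (1 + 16 * K\<^sup>2 * exp (4 * K) * s\<^sup>2) * norm u"
proof -
  define X where "X = emb (\<lambda>x. J (tp c c x))"
  have bl: "bounded_linear (\<lambda>x. J (tp c c x))" by (rule bounded_linear_compose[OF bounded_linear_J bl3])
  have "norm X \<le> 4 * K"
    unfolding X_def
  proof (rule norm_emb_le[OF bl])
    show "norm (J (tp c c x)) \<le> 4 * K * norm x" for x
      using tp_bound'[OF assms(1) assms(1), of x "norm x"] by (simp add: norm_J)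
  qed (use K0 in simp)
  then have nX: "norm (s *\<^sub>R X) \<le> \<bar>s\<bar> * (4 * K)" by (simp add: mult_left_mono)
  then have nX2: "(norm (s *\<^sub>R X))\<^sup>2 \<le> 16 * K\<^sup>2 * s\<^sup>2"
    using power_mono[OF nX norm_ge_zero, of 2] by (simp add: power_mult_distrib mult_ac)
  have "norm (s *\<^sub>R X) \<le> 4 * K" using nX assms(2) K0 by (meson mult_left_le_one_le order_trans abs_ge_zero mult_nonneg_nonneg zero_le_numeral)
  then have e: "exp (norm (s *\<^sub>R X)) \<le> exp (4 * K)" by simp
  have "norm (exp (s *\<^sub>R X) - 1 - s *\<^sub>R X) \<le> (16 * K\<^sup>2 * s\<^sup>2) * exp (4 * K)"
    using norm_exp_remainder[of "s *\<^sub>R X"] mult_mono[OF nX2 e] by (auto intro: order_trans)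
  then have "norm (app (exp (s *\<^sub>R X) - 1 - s *\<^sub>R X) u) \<le> (16 * K\<^sup>2 * exp (4 * K) * s\<^sup>2) * norm u"
    using norm_app_le[of "exp (s *\<^sub>R X) - 1 - s *\<^sub>R X" u] mult_right_mono[of _ _ "norm u"] by (fastforce simp: mult_ac)
  moreover have "u + s *\<^sub>R J (tp c c u) = app (exp (s *\<^sub>R X)) u - app (exp (s *\<^sub>R X) - 1 - s *\<^sub>R X) u"
    by (simp add: app.diff_left app.scaleR_left X_def app_emb bl)
  moreover have "norm (app (exp (s *\<^sub>R X)) u) \<le> norm u" unfolding X_def by (rule norm_exp_J_le)
  ultimately have "norm (u + s *\<^sub>R J (tp c c u)) \<le> norm u + (16 * K\<^sup>2 * exp (4 * K) * s\<^sup>2) * norm u"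
    using norm_triangle_ineq4[of "app (exp (s *\<^sub>R X)) u" "app (exp (s *\<^sub>R X) - 1 - s *\<^sub>R X) u"] by (simp only:)
  then show ?thesis by (simp add: algebra_simps)
qed

text \<open>Polarization writes the derivation as a real combination of three operators i L(c, c),
  each of which generates contractions. The element a + J b lies in the complex triple, usually
  outside the real one.\<close>

lemma derivation_as_hermitian:
  "tp a b u - tp b a u = J (tp (a + J b) (a + J b) u) - J (tp a a u) - J (tp b b u)"
proof -
  have "tp (a + J b) (a + J b) u = tp a a u - J (tp a b u) + (J (tp b a u) + tp b b u)"
    by (simp add: tp_lin tp_J1 tp_J2 JJ linear_neg[OF linear_J] linear_add[OF linear_J])
  then show ?thesis by (simp add: linear_add[OF linear_J] linear_diff[OF linear_J] JJ)
qed

text \<open>144 = 16 x 9: \<open>derivation_first_order\<close> averages three maps of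
  \<open>box_J_first_order\<close>, each run for time 3 s.\<close>

definition dC :: real where "dC = 144 * K\<^sup>2 * exp (4 * K)"

lemma dC0: "0 \<le> dC" by (simp add: dC_def)

lemma derivation_first_order:
  assumes a: "norm a \<le> 1" and b: "norm b \<le> 1" and s: "\<bar>s\<bar> \<le> 1 / 3"
  shows "norm (u + s *\<^sub>R (tp a b u - tp b a u)) \<le> (1 + dC * s\<^sup>2) * norm u"
proof -
  define c where "c = a + J b"
  have c: "norm c \<le> 2" unfolding c_def using a b norm_triangle_ineq[of a "J b"] by (simp add: norm_J)
  have s3: "\<bar>3 * s\<bar> \<le> 1" "\<bar>- (3 * s)\<bar> \<le> 1" using s by auto
  have e: "(1 + 16 * K\<^sup>2 * exp (4 * K) * (3 * s)\<^sup>2) = 1 + dC * s\<^sup>2" "(1 + 16 * K\<^sup>2 * exp (4 * K) * (- (3 * s))\<^sup>2) = 1 + dC * s\<^sup>2"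
    by (simp_all add: dC_def power_mult_distrib)
  have "3 *\<^sub>R (u + s *\<^sub>R (tp a b u - tp b a u))
      = (u + (3 * s) *\<^sub>R J (tp c c u)) + (u + (- (3 * s)) *\<^sub>R J (tp a a u)) + (u + (- (3 * s)) *\<^sub>R J (tp b b u))"
    unfolding derivation_as_hermitian c_def[symmetric] using scaleR_left.add[of 1 "2::real" u]
    by (simp add: algebra_simps scaleR_2)
  then have "norm (3 *\<^sub>R (u + s *\<^sub>R (tp a b u - tp b a u)))
      \<le> norm (u + (3 * s) *\<^sub>R J (tp c c u)) + norm (u + (- (3 * s)) *\<^sub>R J (tp a a u)) + norm (u + (- (3 * s)) *\<^sub>R J (tp b b u))"
    by (simp only: norm_three)
  then show ?thesis
    using box_J_first_order[OF c s3(1), of u] box_J_first_order[of a "- (3 * s)" u] box_J_first_order[of b "- (3 * s)" u] a b s3(2)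
    unfolding e by simp
qed

lemma R_first_order:
  assumes n: "norm n \<le> 1" and s: "0 \<le> s" "s \<le> 1"
  shows "norm (R n s x - (x - s *\<^sub>R tp n n x)) \<le> K\<^sup>2 * exp K * s\<^sup>2 * norm x"
proof -
  define X where "X = (- s) *\<^sub>R Lo n n"
  have "K * norm n * norm n \<le> K * 1 * 1" using n K0 by (intro mult_mono) auto
  then have nX: "norm X \<le> s * K" unfolding X_def using norm_Lo[of n n] s by (simp add: mult_left_mono)
  then have nX2: "(norm X)\<^sup>2 \<le> K\<^sup>2 * s\<^sup>2"
    using power_mono[OF nX norm_ge_zero, of 2] by (simp add: power_mult_distrib mult_ac)
  have "norm X \<le> K" using nX s K0 by (meson mult_left_le_one_le order_trans)
  then have e: "exp (norm X) \<le> exp K" by simp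
  have "norm (exp X - 1 - X) \<le> (K\<^sup>2 * s\<^sup>2) * exp K"
    using norm_exp_remainder[of X] mult_mono[OF nX2 e] by (auto intro: order_trans)
  then have "norm (app (exp X - 1 - X) x) \<le> (K\<^sup>2 * s\<^sup>2 * exp K) * norm x"
    using norm_app_le[of "exp X - 1 - X" x] mult_right_mono[of _ _ "norm x"] by (meson norm_ge_zero order_trans)
  moreover have "app (exp X - 1 - X) x = R n s x - (x - s *\<^sub>R tp n n x)"
    by (simp add: app.diff_left app.add_left X_def app.scaleR_left app.minus_left R_def expL_def)
  ultimately show ?thesis by (simp add: mult_ac)
qed

text \<open>Iterated cubing multiplies the time by 3^j, and the decay n!/n^n of D^n R n beats any power of
  a number larger than 1/e.\<close>

lemma R_half_self:
  assumes u: "norm u \<le> 1" shows "norm (R u (1 / 2) u) \<le> exp (- 1 / 2)"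
proof (rule ccontr)
  define a where "a = norm (R u (1 / 2) u)"
  assume "\<not> ?thesis"
  then have a: "exp (- 1 / 2) < a" unfolding a_def by simp
  then have a0: "0 < a" by (meson exp_gt_zero less_trans)
  \<comment> \<open>A norm above exp (- 1 / 2) makes q larger than 1, while \<open>main\<close>
    bounds a q^n by a multiple of n for arbitrarily large n.\<close>
  define q where "q = a\<^sup>2 * exp 1"
  have "exp (- 1 / 2) ^ 2 < a ^ 2" using a by (intro power_strict_mono) auto
  moreover have "exp (- 1 / 2 :: real) ^ 2 = exp (- 1)" by (simp add: exp_double[symmetric])
  ultimately have q: "q > 1" unfolding q_def by (simp add: exp_minus field_simps)
  have main: "a * q ^ n \<le> exp 1 * n" if j: "3 ^ j = 2 * n + 1" "(cb ^^ j) u = (tp u u ^^ n) u" and n: "1 \<le> n" for j n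
  proof -
    have RD: "R u t ((tp u u ^^ n) x) = (tp u u ^^ n) (R u t x)" for t x n by (induction n) (auto simp: R_D)
    \<comment> \<open>The exponent 3^j = 2 n + 1 splits the total time 3^j / 2 into 1 / 2 + n; the
      part n is spent on the decay of D^n.\<close>
    have "3 ^ j * (- (1 / 2)) = - (1 / 2 + real n)" using arg_cong[OF j(1), of real] by (simp add: field_simps)
    then have "(cb ^^ j) (R u (1 / 2) u) = R u (1 / 2 + real n) ((tp u u ^^ n) u)"
      using cb_E_iter[of j u "- (1 / 2)"] j(2) by (simp add: R_def)
    also have "\<dots> = R u (1 / 2) ((tp u u ^^ n) (R u (real n) u))" by (simp only: R_add RD)
    finally have "a ^ (2 * n + 1) \<le> norm ((tp u u ^^ n) (R u (real n) u))"
      unfolding a_def j(1)[symmetric] norm_cb_iter[symmetric] using R_contr by simp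
    also have "\<dots> \<le> fact n / real n ^ n * norm u" using n by (intro R_decay) auto
    also have "\<dots> \<le> fact n / real n ^ n * 1" using u by (intro mult_left_mono) auto
    also have "\<dots> = fact n / real n ^ n" by simp
    finally have "a ^ (2 * n + 1) * (real n ^ n * exp (real n)) \<le> fact n / real n ^ n * (real n ^ n * exp (real n))"
      by (intro mult_right_mono) auto
    also have "\<dots> = fact n * exp (real n)" using n by simp
    also have "\<dots> \<le> exp 1 * real n ^ (n + 1)" by (rule fact_mult_exp_le[OF n])
    finally have "(a * q ^ n) * real n ^ n \<le> (exp 1 * real n) * real n ^ n"
      unfolding q_def by (simp add: power_mult_distrib power_mult[symmetric] exp_of_nat_mult[symmetric] mult_ac)
    then show ?thesis using n by simp
  qed
  have "(\<lambda>n. real n * (1 / q) ^ n) \<longlonglongrightarrow> 0"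
    using q by (intro powser_times_n_limit_0) simp
  then have "\<forall>\<^sub>F n in sequentially. real n * (1 / q) ^ n < a / exp 1"
    using a0 by (intro order_tendstoD(2)[where y = 0]) auto
  then obtain N where N: "\<And>n. n \<ge> N \<Longrightarrow> real n * (1 / q) ^ n < a / exp 1" by (auto simp: eventually_sequentially)
  obtain n where n: "3 ^ (2 * N + 3) = 2 * n + 1" "(cb ^^ (2 * N + 3)) u = (tp u u ^^ n) u" using cb_iter[of "2 * N + 3" u] by blast
  have "2 * N + 3 < (3::nat) ^ (2 * N + 3)"
    by (rule less_exp[THEN less_le_trans]) (simp add: power_mono)
  then have nN: "n \<ge> N" "1 \<le> n" using n(1) by auto
  have "real n / q ^ n < a / exp 1" using N[OF nN(1)] by (simp add: power_one_over divide_inverse power_inverse)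
  then have "exp 1 * n < a * q ^ n" using q by (simp add: field_simps)
  then show False using main[OF n nN(2)] by simp
qed

text \<open>Interpolation from \<open>R_half_self\<close> gives norm (R u s u) \<le> exp (- s). So
  exp (s (1 - D)) u has norm at most 1, and its first-order part is u + s (u - {u, u, u}). In the
  function model r exp (- s r^2) increases on [0, 1] precisely for s \<le> 1 / 2, which explains the
  time 1 / 2.\<close>

lemma cube_first_order:
  assumes u: "norm u \<le> 1" and s: "0 \<le> s" "s \<le> 1 / 2"
  shows "norm (u + s *\<^sub>R (u - cb u)) \<le> 1 + (1 + K)\<^sup>2 * exp (1 + K) * s\<^sup>2"
proof -
  have "norm (R u s u) \<le> 1 * exp (ln (exp (- 1 / 2)) * (s / (1 / 2)))"
    unfolding R_eq_S using R_half_self[OF u] u s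
    by (intro hermitian_op.S_interpolation[OF hermitian_op]) (auto simp: R_eq_S)
  also have "ln (exp (- 1 / 2)) * (s / (1 / 2)) = - s" by (simp only: ln_exp) simp
  finally have "exp s * norm (R u s u) \<le> exp s * exp (- s)" by (intro mult_left_mono) auto
  then have 1: "norm (exp s *\<^sub>R R u s u) \<le> 1" by (simp add: exp_minus)
  define X where "X = s *\<^sub>R (1 - Lo u u)"
  have "exp X = exp (s *\<^sub>R 1) * exp ((- s) *\<^sub>R Lo u u)"
    unfolding X_def scaleR_diff_right using exp_add_commuting[of "s *\<^sub>R 1" "(- s) *\<^sub>R Lo u u"] by simp
  moreover have "exp (s *\<^sub>R (1 :: 'a uop)) = exp s *\<^sub>R 1" 
  proof -
    have "exp (of_real s :: 'a uop) = of_real (exp s)" by (rule exp_of_real)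
    then show ?thesis by (simp add: of_real_def)
  qed
  ultimately have eX: "app (exp X) u = exp s *\<^sub>R R u s u" by (simp add: R_def expL_def app.scaleR_left)
  have "norm (1 - Lo u u) \<le> 1 + K"
  proof -
    have "K * norm u * norm u \<le> K * 1 * 1" using u K0 by (intro mult_mono) auto
    then show ?thesis using norm_triangle_ineq4[of 1 "Lo u u"] norm_Lo[of u u] by simp
  qed
  then have nX: "norm X \<le> s * (1 + K)" unfolding X_def using s by (simp add: mult_left_mono)
  then have nX2: "(norm X)\<^sup>2 \<le> (1 + K)\<^sup>2 * s\<^sup>2"
    using power_mono[OF nX norm_ge_zero, of 2] by (simp add: power_mult_distrib mult_ac)
  have "s * (1 + K) \<le> 1 * (1 + K)" using s K0 by (intro mult_right_mono) auto
  then have e: "exp (norm X) \<le> exp (1 + K)" using nX by simp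
  have "norm (exp X - 1 - X) \<le> ((1 + K)\<^sup>2 * s\<^sup>2) * exp (1 + K)"
    using norm_exp_remainder[of X] mult_mono[OF nX2 e] by (auto intro: order_trans)
  then have "norm (app (exp X - 1 - X) u) \<le> ((1 + K)\<^sup>2 * s\<^sup>2) * exp (1 + K) * 1"
    using u by (intro order_trans[OF norm_app_le] mult_mono) auto
  moreover have "u + s *\<^sub>R (u - cb u) = app (exp X) u - app (exp X - 1 - X) u"
    by (simp add: app.diff_left app.scaleR_left X_def cb_def)
  ultimately show ?thesis
    using 1 norm_triangle_ineq4[of "app (exp X) u" "app (exp X - 1 - X) u"] unfolding eX by (simp add: mult_ac)
qed

end

section \<open>Functionals on a subspace\<close>

lemma dual_add: "f \<in> dual_space E \<Longrightarrow> x \<in> E \<Longrightarrow> y \<in> E \<Longrightarrow> f (x + y) = f x + f y"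
  and dual_scale: "f \<in> dual_space E \<Longrightarrow> x \<in> E \<Longrightarrow> f (c *\<^sub>R x) = c * f x"
  and dual_outside: "f \<in> dual_space E \<Longrightarrow> x \<notin> E \<Longrightarrow> f x = 0"
  and dual_bdd: "f \<in> dual_space E \<Longrightarrow> \<exists>K. \<forall>x\<in>E. \<bar>f x\<bar> \<le> K * norm x"
  by (auto simp: dual_space_def)

lemma dual_minus: "f \<in> dual_space E \<Longrightarrow> x \<in> E \<Longrightarrow> f (- x) = - f x"
  using dual_scale[of f E x "- 1"] by simp

lemma dual_diff: "f \<in> dual_space E \<Longrightarrow> subspace E \<Longrightarrow> x \<in> E \<Longrightarrow> y \<in> E \<Longrightarrow> f (x - y) = f x - f y"
  using dual_add[of f E x "- y"] dual_minus[of f E y] by (simp add: subspace_neg)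

lemma dual_space_add: "f \<in> dual_space E \<Longrightarrow> g \<in> dual_space E \<Longrightarrow> (\<lambda>x. f x + g x) \<in> dual_space E"
proof -
  assume f: "f \<in> dual_space E" and g: "g \<in> dual_space E"
  obtain A B where A: "\<And>x. x \<in> E \<Longrightarrow> \<bar>f x\<bar> \<le> A * norm x" and B: "\<And>x. x \<in> E \<Longrightarrow> \<bar>g x\<bar> \<le> B * norm x"
    using dual_bdd[OF f] dual_bdd[OF g] by blast
  have "\<bar>f x + g x\<bar> \<le> (A + B) * norm x" if "x \<in> E" for x
    using A[OF that] B[OF that] by (simp add: distrib_right)
  then have "\<exists>K. \<forall>x\<in>E. \<bar>f x + g x\<bar> \<le> K * norm x" by blast
  then show ?thesis using f g unfolding dual_space_def by (auto simp: algebra_simps)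
qed

lemma dual_space_cmult: "f \<in> dual_space E \<Longrightarrow> (\<lambda>x. c * f x) \<in> dual_space E"
proof -
  assume f: "f \<in> dual_space E"
  obtain A where A: "\<And>x. x \<in> E \<Longrightarrow> \<bar>f x\<bar> \<le> A * norm x" using dual_bdd[OF f] by blast
  have "\<bar>c * f x\<bar> \<le> (\<bar>c\<bar> * A) * norm x" if "x \<in> E" for x
    using mult_left_mono[OF A[OF that], of "\<bar>c\<bar>"] by (simp add: abs_mult mult.assoc)
  then have "\<exists>K. \<forall>x\<in>E. \<bar>c * f x\<bar> \<le> K * norm x" by blast
  then show ?thesis using f unfolding dual_space_def by (auto simp: algebra_simps)
qed

lemma dual_space_diff: "f \<in> dual_space E \<Longrightarrow> g \<in> dual_space E \<Longrightarrow> (\<lambda>x. f x - g x) \<in> dual_space E"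
  using dual_space_add[of f E "\<lambda>x. - 1 * g x"] dual_space_cmult[of g E "- 1"] by simp

lemma dual_space_zero: "(\<lambda>x. 0) \<in> dual_space E"
  by (auto simp: dual_space_def intro: exI[of _ 0])

lemma dual_norm_bdd: "f \<in> dual_space E \<Longrightarrow> bdd_above ((\<lambda>x. \<bar>f x\<bar>) ` {x \<in> E. norm x \<le> 1})"
proof -
  assume "f \<in> dual_space E"
  then obtain A where A: "\<And>x. x \<in> E \<Longrightarrow> \<bar>f x\<bar> \<le> A * norm x" using dual_bdd by blast
  have "\<bar>f x\<bar> \<le> \<bar>A\<bar>" if "x \<in> E" "norm x \<le> 1" for x
  proof -
    have "A * norm x \<le> \<bar>A\<bar> * 1" using that by (intro mult_mono) auto
    then show ?thesis using A[OF that(1)] by simp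
  qed
  then show ?thesis by (intro bdd_aboveI[of _ "\<bar>A\<bar>"]) auto
qed

lemma dual_norm_ge:
  assumes "f \<in> dual_space E" "subspace E" "x \<in> E" "norm x \<le> 1" shows "\<bar>f x\<bar> \<le> dual_norm E f"
  unfolding dual_norm_def using assms by (intro cSUP_upper dual_norm_bdd) auto

lemma dual_norm_nonneg: "f \<in> dual_space E \<Longrightarrow> subspace E \<Longrightarrow> 0 \<le> dual_norm E f"
  using dual_norm_ge[of f E 0] by (simp add: subspace_0 order_trans[OF abs_ge_zero])

lemma dual_norm_bound:
  assumes f: "f \<in> dual_space E" and E: "subspace E" and x: "x \<in> E" shows "\<bar>f x\<bar> \<le> dual_norm E f * norm x"
proof (cases "x = 0")
  case True then show ?thesis using dual_scale[OF f, of 0 0] E by (simp add: subspace_0)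
next
  case False
  have "\<bar>f ((1 / norm x) *\<^sub>R x)\<bar> \<le> dual_norm E f"
    using False x E by (intro dual_norm_ge[OF f E]) (auto simp: subspace_scale)
  then show ?thesis using dual_scale[OF f x, of "1 / norm x"] False by (simp add: abs_mult field_simps)
qed

lemma dual_norm_leI:
  assumes "subspace E" "\<And>x. x \<in> E \<Longrightarrow> norm x \<le> 1 \<Longrightarrow> f x \<le> B" and f: "f \<in> dual_space E"
  shows "dual_norm E f \<le> B"
  unfolding dual_norm_def
proof (rule cSUP_least)
  show "{x \<in> E. norm x \<le> 1} \<noteq> {}" using assms(1) subspace_0 by fastforce
  fix x assume x: "x \<in> {x \<in> E. norm x \<le> 1}"
  have "f (- x) = - f x" using dual_minus[OF f] x by simp
  then show "\<bar>f x\<bar> \<le> B" using assms(2)[of x] assms(2)[of "- x"] x assms(1) by (simp add: subspace_neg abs_le_iff)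
qed

lemma dual_norm_approx:
  assumes f: "f \<in> dual_space E" and E: "subspace E" and "0 < e"
  obtains x where "x \<in> E" "norm x \<le> 1" "dual_norm E f - e \<le> f x"
proof -
  have "\<exists>x\<in>E. norm x \<le> 1 \<and> dual_norm E f - e \<le> f x"
  proof (rule ccontr)
    assume "\<not> ?thesis"
    then have "f x \<le> dual_norm E f - e" if "x \<in> E" "norm x \<le> 1" for x using that by force
    then have "dual_norm E f \<le> dual_norm E f - e" using dual_norm_leI[OF E _ f] by blast
    then show False using \<open>0 < e\<close> by simp
  qed
  then show thesis using that by blast
qed

lemma dual_norm_triangle:
  assumes "f \<in> dual_space E" "g \<in> dual_space E" "subspace E"
  shows "dual_norm E (\<lambda>x. f x + g x) \<le> dual_norm E f + dual_norm E g"
proof (rule dual_norm_leI[OF assms(3) _ dual_space_add[OF assms(1,2)]])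
  fix x assume "x \<in> E" "norm x \<le> 1"
  then show "f x + g x \<le> dual_norm E f + dual_norm E g"
    using dual_norm_ge[OF assms(1,3), of x] dual_norm_ge[OF assms(2,3), of x] by linarith
qed

lemma dual_norm_cmult:
  assumes f: "f \<in> dual_space E" and E: "subspace E"
  shows "dual_norm E (\<lambda>x. c * f x) = \<bar>c\<bar> * dual_norm E f"
proof -
  have le: "dual_norm E (\<lambda>x. c * f x) \<le> \<bar>c\<bar> * dual_norm E f" if f: "f \<in> dual_space E" for c f
  proof (rule dual_norm_leI[OF E _ dual_space_cmult[OF f]])
    fix x assume "x \<in> E" "norm x \<le> 1"
    then have "\<bar>c\<bar> * \<bar>f x\<bar> \<le> \<bar>c\<bar> * dual_norm E f" using dual_norm_ge[OF f E] by (intro mult_left_mono) auto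
    then show "c * f x \<le> \<bar>c\<bar> * dual_norm E f" using abs_ge_self[of "c * f x"] by (simp add: abs_mult)
  qed
  show ?thesis
  proof (cases "c = 0")
    case True
    then show ?thesis using le[OF f, of 0] dual_norm_nonneg[OF dual_space_zero E] by simp
  next
    case False
    have "dual_norm E (\<lambda>x. (1 / c) * (c * f x)) \<le> \<bar>1 / c\<bar> * dual_norm E (\<lambda>x. c * f x)" by (rule le[OF dual_space_cmult[OF f]])
    then have "\<bar>c\<bar> * dual_norm E f \<le> dual_norm E (\<lambda>x. c * f x)" using False by (simp add: field_simps)
    then show ?thesis using le[OF f, of c] by simp
  qed
qed

lemma dual_eq_zeroI: "f \<in> dual_space E \<Longrightarrow> subspace E \<Longrightarrow> dual_norm E f \<le> 0 \<Longrightarrow> f x = 0"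
  using dual_norm_bound[of f E x] dual_outside[of f E x]
  by (smt (verit) mult_nonpos_nonneg norm_ge_zero)

lemma dual_restrictI:
  assumes "linear F" "\<And>x. \<bar>F x\<bar> \<le> B * norm x" and E: "subspace E"
  shows "(\<lambda>x. if x \<in> E then F x else 0) \<in> dual_space E"
  using assms unfolding dual_space_def
  by (auto simp: linear_add linear_scale subspace_add subspace_scale)

lemma dual_extend_global:
  assumes f: "f \<in> dual_space E" and E: "subspace E"
  obtains F where "linear F" "\<And>x. x \<in> E \<Longrightarrow> F x = f x" "\<And>x. \<bar>F x\<bar> \<le> dual_norm E f * norm x"
  using Hahn_Banach_norm[of E f "dual_norm E f"] dual_add[OF f] dual_scale[OF f] dual_norm_bound[OF f E] dual_norm_nonneg[OF f E] E
  by metis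

lemma polar_separation:
  assumes M: "subspace M" "closed M" and x: "x \<in> E" "x \<notin> M" and E: "subspace E" and ME: "M \<subseteq> E"
  obtains g where "g \<in> polar E M" "g x \<noteq> 0"
proof -
  obtain F B where F: "linear F" "F x \<noteq> 0" "\<And>y. y \<in> M \<Longrightarrow> F y = 0" "\<And>y. \<bar>F y\<bar> \<le> B * norm y"
    using separating_functional[OF M x(2)] by metis
  have "(\<lambda>x. if x \<in> E then F x else 0) \<in> polar E M"
    unfolding polar_def using dual_restrictI[OF F(1,4) E] F(3) ME by auto
  then show thesis using that F(2) x(1) by fastforce
qed

lemma in_closed_subspaceI:
  assumes "subspace M" "closed M" "subspace E" "M \<subseteq> E" "x \<in> E" and "\<And>g. g \<in> polar E M \<Longrightarrow> g x = 0"
  shows "x \<in> M"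
  using polar_separation[OF assms(1,2,5) _ assms(3,4)] assms(6) by metis

section \<open>Triple ideals are M-ideals\<close>

context jb_triple begin

text \<open>Subtracting x removes the constant term of the exponential series, and all other terms
  start from D x. Therefore x itself may lie outside V, as in the application to x in E and V =
  M.\<close>

lemma R_minus_mem:
  assumes V: "subspace V" "closed V" and x: "tp n n x \<in> V" and inv: "\<And>v. v \<in> V \<Longrightarrow> tp n n v \<in> V"
  shows "R n t x - x \<in> V"
proof -
  define X where "X = (- t) *\<^sub>R Lo n n"
  have V1: "app (X ^ Suc k) x \<in> V" for k
  proof (induction k)
    case 0
    show ?case using subspace_scale[OF V(1) x, of "- t"] by (simp add: X_def app.scaleR_left app.minus_left)
  next
    case (Suc k)
    have "app (X ^ Suc (Suc k)) x = (- t) *\<^sub>R tp n n (app (X ^ Suc k) x)"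
      by (simp add: X_def app.scaleR_left app.minus_left tp_lin)
    then show ?case using subspace_scale[OF V(1) inv[OF Suc.IH], of "- t"] by simp
  qed
  have "(\<lambda>k. app (X ^ k /\<^sub>R fact k) x) sums app (exp X) x"
    unfolding exp_def by (rule bounded_linear.sums[OF app.bounded_linear_left summable_sums[OF summable_exp_generic]])
  then have "(\<lambda>k. app (X ^ Suc k /\<^sub>R fact (Suc k)) x) sums (app (exp X) x - app (X ^ 0 /\<^sub>R fact 0) x)"
    by (subst sums_Suc_iff) simp
  then have "(\<lambda>k. app (X ^ Suc k /\<^sub>R fact (Suc k)) x) sums (R n t x - x)"
    by (simp add: R_def expL_def X_def)
  then have lim: "(\<lambda>N. \<Sum>k<N. app (X ^ Suc k /\<^sub>R fact (Suc k)) x) \<longlonglongrightarrow> R n t x - x" by (simp add: sums_def)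
  have "(\<Sum>k<N. app (X ^ Suc k /\<^sub>R fact (Suc k)) x) \<in> V" for N
    using V1 by (intro subspace_sum[OF V(1)]) (simp only: app.scaleR_left subspace_scale[OF V(1)])
  then show ?thesis using lim by (rule closed_sequentially[OF V(2)])
qed

lemma R_mem:
  assumes V: "subspace V" "closed V" and x: "x \<in> V" and inv: "\<And>v. v \<in> V \<Longrightarrow> tp n n v \<in> V"
  shows "R n t x \<in> V"
  using subspace_add[OF V(1) R_minus_mem[OF V inv[OF x] inv, of t] x] by simp

text \<open>F nearly attains its norm at m, and the derivation L(a, m) - L(m, a) moves m with norm
  growth of second order only. So F is small on the value of this derivation at m, which compares F
  L(m, m) a with F Q(m) a.\<close>

lemma derivation_value:
  assumes F: "linear F" "\<And>x. \<bar>F x\<bar> \<le> \<kappa> * norm x" and \<kappa>: "0 \<le> \<kappa>"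
    and m: "norm m \<le> 1" "\<kappa> - \<epsilon> \<le> F m" and a: "norm a \<le> 1" and s: "0 < s" "s \<le> 1 / 3"
  shows "\<bar>F (tp m m a) - F (tp m a m)\<bar> \<le> \<epsilon> / s + \<kappa> * dC * s"
proof -
  define d where "d = tp a m m - tp m a m"
  have *: "r * F d \<le> \<epsilon> + \<kappa> * dC * s\<^sup>2" if r: "\<bar>r\<bar> = s" for r
  proof -
    have "F m + r * F d = F (m + r *\<^sub>R d)" using F(1) by (simp add: linear_add linear_scale)
    also have "\<dots> \<le> \<kappa> * norm (m + r *\<^sub>R d)" using F(2) abs_ge_self order_trans by blast
    also have "\<dots> \<le> \<kappa> * ((1 + dC * r\<^sup>2) * norm m)"
      unfolding d_def using derivation_first_order[OF a m(1), of r m] r s \<kappa> by (intro mult_left_mono) auto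
    also have "\<dots> \<le> \<kappa> * ((1 + dC * r\<^sup>2) * 1)" using m(1) \<kappa> dC0 by (intro mult_left_mono) auto
    also have "r\<^sup>2 = s\<^sup>2" using r by (metis power2_abs)
    finally show ?thesis using m(2) by (simp add: algebra_simps)
  qed
  have "s * \<bar>F d\<bar> \<le> \<epsilon> + \<kappa> * dC * s\<^sup>2" using *[of s] *[of "- s"] s by (auto simp: abs_if)
  then have "\<bar>F d\<bar> \<le> (\<epsilon> + \<kappa> * dC * s\<^sup>2) / s" using s by (simp add: field_simps)
  also have "\<dots> = \<epsilon> / s + \<kappa> * dC * s" using s by (simp add: add_divide_distrib power2_eq_square)
  finally have "\<bar>F d\<bar> \<le> \<epsilon> / s + \<kappa> * dC * s" .
  moreover have "F d = F (tp m m a) - F (tp m a m)"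
    unfolding d_def using F(1) tp_sym[of a m m] by (simp add: linear_diff)
  ultimately show ?thesis by simp
qed

text \<open>Two Jordan identities rewrite the vector as five products, each of which contains a
  factor where m and y are adjacent.\<close>

lemma Q_of_orth_product:
  assumes o: "orth \<theta> m y" and m: "norm m \<le> 1" and b: "norm b \<le> 1" and x: "norm x \<le> 1" and \<theta>: "0 \<le> \<theta>"
  shows "norm (tp m (tp y b x) m) \<le> 5 * K * \<theta>"
proof -
  have o1: "norm (tp m y v) \<le> \<theta>" "norm (tp y m v) \<le> \<theta>" if "norm v \<le> 1" for v
    using o mult_left_mono[OF that \<theta>] unfolding orth_def by (auto intro: order_trans)
  have oK: "norm (tp m y v) \<le> \<theta> * K" if "norm v \<le> K" for v
    using o mult_left_mono[OF that \<theta>] unfolding orth_def by (auto intro: order_trans)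
  have 1: "tp m (tp y b x) m = tp (tp b y m) x m + tp m x (tp b y m) - tp b y (tp m x m)"
    by (rule JI_mid)
  have 2: "tp b y (tp m x m) = tp m x (tp m y b) - tp m y (tp m x b) + tp m (tp x m y) b"
    using L_comm[of m x m y b] tp_sym[of b y "tp m x m"] by (simp add: algebra_simps)
  have p: "norm (tp b y m) \<le> \<theta>" "norm (tp m y b) \<le> \<theta>" "norm (tp x m y) \<le> \<theta>"
    using o1(1)[OF b] o1(2)[OF x] tp_sym[of b y m] tp_sym[of x m y] by auto
  have "norm (tp (tp b y m) x m) \<le> K * \<theta> * 1 * 1" "norm (tp m x (tp b y m)) \<le> K * 1 * 1 * \<theta>"
    "norm (tp m x (tp m y b)) \<le> K * 1 * 1 * \<theta>" "norm (tp m (tp x m y) b) \<le> K * 1 * \<theta> * 1"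
    using tp_bound'[OF p(1) x m] tp_bound'[OF m x p(1)] tp_bound'[OF m x p(2)] tp_bound'[OF m p(3) b] by simp_all
  moreover have "norm (tp m y (tp m x b)) \<le> \<theta> * K"
    using tp_bound'[OF m x b] by (intro oK) simp
  moreover have "norm (tp m (tp y b x) m) \<le> norm (tp (tp b y m) x m) + norm (tp m x (tp b y m)) + norm (tp b y (tp m x m))"
    unfolding 1 using norm_triangle_ineq4[of "tp (tp b y m) x m + tp m x (tp b y m)" "tp b y (tp m x m)"]
      norm_triangle_ineq[of "tp (tp b y m) x m" "tp m x (tp b y m)"] by linarith
  moreover have "norm (tp b y (tp m x m)) \<le> norm (tp m x (tp m y b)) + norm (tp m y (tp m x b)) + norm (tp m (tp x m y) b)"
    unfolding 2 by (rule norm_three)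
  ultimately show ?thesis by (simp add: mult.commute)
qed

text \<open>A functional that nearly attains its norm at m is nearly supported by the Peirce-2 part of m,
  and this part does not meet a product one of whose outer factors is nearly orthogonal to m.\<close>

lemma outer_orth_small:
  assumes F: "linear F" "\<And>x. \<bar>F x\<bar> \<le> \<kappa> * norm x" and \<kappa>: "0 \<le> \<kappa>" and \<eta>: "0 < \<eta>"
  shows "\<exists>\<epsilon>>0. \<forall>m. norm m \<le> 1 \<longrightarrow> \<kappa> - \<epsilon> \<le> F m \<longrightarrow>
    (\<exists>T>0. \<forall>t\<ge>T. \<forall>y b x. norm y \<le> 1 \<longrightarrow> norm b \<le> 1 \<longrightarrow> norm x \<le> 1 \<longrightarrow> \<bar>F (tp (R m t y) b x)\<bar> \<le> \<eta>)"
proof -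
  define \<kappa>1 where "\<kappa>1 = \<kappa> + 1"
  have k1: "\<kappa>1 > 0" "\<kappa> \<le> \<kappa>1" unfolding \<kappa>1_def using \<kappa> by auto
  have Kp: "K > 0" using K1 by simp
  \<comment> \<open>The target \<eta> is split into five equal parts. The time \<open>t2\<close>
    depends on \<eta>', s on \<open>t2\<close>, and \<epsilon> on both, because the error \<epsilon>
    / s of \<open>derivation_value\<close> is accumulated over the time \<open>t2\<close>.\<close>
  define \<eta>' where "\<eta>' = \<eta> / (5 * K * \<kappa>1)"
  have \<eta>': "\<eta>' > 0" unfolding \<eta>'_def using \<eta> k1 Kp by simp
  obtain t2 where t2: "t2 > 0" "\<And>n y. norm n \<le> 1 \<Longrightarrow> norm y \<le> 1 \<Longrightarrow> norm (n + R n t2 y) \<le> 1 + \<eta>' \<and> norm (n - R n t2 y) \<le> 1 + \<eta>'"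
    using R_orth_norm[OF \<eta>'] by (metis order_refl)
  define s where "s = min (1 / 3) (\<eta> / (5 * t2 * K * \<kappa>1 * (dC + 1)))"
  have pos: "5 * t2 * K * \<kappa>1 * (dC + 1) > 0" using t2(1) Kp k1 dC0 by simp
  have s: "0 < s" "s \<le> 1 / 3" unfolding s_def using \<eta> pos by auto
  have "s \<le> \<eta> / (5 * t2 * K * \<kappa>1 * (dC + 1))" unfolding s_def by simp
  then have s1: "s * (5 * t2 * K * \<kappa>1 * (dC + 1)) \<le> \<eta>" using pos by (simp add: pos_le_divide_eq)
  define \<epsilon> where "\<epsilon> = min (\<eta> / (5 * K)) (\<eta> * s / (5 * t2 * K))"
  have \<epsilon>: "\<epsilon> > 0" unfolding \<epsilon>_def using \<eta> Kp s t2(1) by simp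
  have e1: "5 * K * \<epsilon> \<le> \<eta>"
  proof -
    have "\<epsilon> \<le> \<eta> / (5 * K)" unfolding \<epsilon>_def by simp
    then show ?thesis using Kp by (simp add: field_simps)
  qed
  have e2: "5 * (t2 * (K * (\<epsilon> / s))) \<le> \<eta>"
  proof -
    have "\<epsilon> \<le> \<eta> * s / (5 * t2 * K)" unfolding \<epsilon>_def by simp
    then have "\<epsilon> * (5 * t2 * K) \<le> \<eta> * s" using Kp t2(1) by (simp add: pos_le_divide_eq)
    then show ?thesis using s by (simp add: field_simps)
  qed
  define \<theta> where "\<theta> = \<eta> / (25 * t2 * K * \<kappa>1)"
  have \<theta>: "\<theta> > 0" unfolding \<theta>_def using \<eta> t2(1) Kp k1 by simp
  obtain T where T: "T > 0" "\<And>t n y. t \<ge> T \<Longrightarrow> norm n \<le> 1 \<Longrightarrow> norm y \<le> 1 \<Longrightarrow> orth \<theta> n (R n t y)"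
    using orthogonality[OF \<theta>] unfolding orth_def by blast
  have main: "\<bar>F (tp (R m t y) b x)\<bar> \<le> \<eta>"
    if m: "norm m \<le> 1" and Fm: "\<kappa> - \<epsilon> \<le> F m" and t: "t \<ge> T" and y: "norm y \<le> 1" and b: "norm b \<le> 1" and x: "norm x \<le> 1"
    for m t y b x
  proof -
    define y1 where "y1 = R m t y"
    define w where "w = tp y1 b x"
    have y1: "norm y1 \<le> 1" unfolding y1_def using y t T(1) by (intro norm_R_le) auto
    have nw: "norm w \<le> K" unfolding w_def using tp_bound'[OF y1 b x] by simp
    have Qw: "norm (tp m w m) \<le> 5 * K * \<theta>"
      unfolding w_def y1_def using T(2)[OF t m y] m b x \<theta> by (intro Q_of_orth_product) auto
    \<comment> \<open>Both m + R m t2 v and m - R m t2 v have norm nearly 1 while F is nearly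
      maximal at m, so there is no room for F on R m t2 v.\<close>
    have late: "\<bar>F (R m t2 w)\<bar> \<le> K * (\<kappa> * \<eta>' + \<epsilon>)"
    proof -
      define v where "v = (1 / K) *\<^sub>R w"
      have v: "norm v \<le> 1" unfolding v_def using nw Kp by (simp add: field_simps)
      have "F m + F (R m t2 v) = F (m + R m t2 v)" "F m - F (R m t2 v) = F (m - R m t2 v)"
        using F(1) by (simp_all add: linear_add linear_diff)
      moreover have "F (m + R m t2 v) \<le> \<kappa> * (1 + \<eta>')" "F (m - R m t2 v) \<le> \<kappa> * (1 + \<eta>')"
        using t2(2)[OF m v] F(2)[of "m + R m t2 v"] F(2)[of "m - R m t2 v"] \<kappa> by (meson abs_ge_self mult_left_mono order_trans)+
      ultimately have "\<bar>F (R m t2 v)\<bar> \<le> \<kappa> * \<eta>' + \<epsilon>" using Fm by (simp add: algebra_simps abs_le_iff)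
      then have "K * \<bar>F (R m t2 v)\<bar> \<le> K * (\<kappa> * \<eta>' + \<epsilon>)" using Kp by simp
      moreover have "R m t2 w = K *\<^sub>R R m t2 v" unfolding v_def using Kp by (simp add: R_lin)
      ultimately show ?thesis using F(1) Kp by (simp add: linear_scale abs_mult)
    qed
    define \<nu> where "\<nu> = K * (\<epsilon> / s + \<kappa> * dC * s) + \<kappa> * (5 * K * \<theta>)"
    \<comment> \<open>F composed with D is close to F composed with Q, and Q is small along the
      orbit of w. Hence F hardly changes between time 0 and \<open>t2\<close>.\<close>
    have der: "\<bar>F (tp m m (R m r w))\<bar> \<le> \<nu>" if r: "0 \<le> r" for r
    proof -
      define v where "v = (1 / K) *\<^sub>R R m r w"
      have "norm (R m r w) \<le> K" using nw r by (intro norm_R_le)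
      then have v: "norm v \<le> 1" unfolding v_def using Kp by (simp add: field_simps)
      have vw: "R m r w = K *\<^sub>R v" unfolding v_def using Kp by simp
      have "\<bar>F (tp m m v) - F (tp m v m)\<bar> \<le> \<epsilon> / s + \<kappa> * dC * s" by (rule derivation_value[OF F \<kappa> m Fm v s])
      then have "K * \<bar>F (tp m m v) - F (tp m v m)\<bar> \<le> K * (\<epsilon> / s + \<kappa> * dC * s)" using Kp by simp
      moreover have "F (tp m m (R m r w)) = K * F (tp m m v)" "F (tp m (R m r w) m) = K * F (tp m v m)"
        unfolding vw using F(1) by (simp_all add: tp_scale3 tp_scale2 linear_scale)
      ultimately have A: "\<bar>F (tp m m (R m r w)) - F (tp m (R m r w) m)\<bar> \<le> K * (\<epsilon> / s + \<kappa> * dC * s)"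
        using Kp by (simp add: abs_mult flip: right_diff_distrib)
      have "tp m (R m r w) m = R m r (tp m w m)"
        using expL_Q(1)[OF DQ, of m "- r" w] by (simp add: R_def)
      then have "norm (tp m (R m r w) m) \<le> 5 * K * \<theta>" using Qw r by (simp add: norm_R_le)
      then have "\<bar>F (tp m (R m r w) m)\<bar> \<le> \<kappa> * (5 * K * \<theta>)" using F(2) \<kappa> by (meson mult_left_mono order_trans)
      then show ?thesis using A unfolding \<nu>_def by linarith
    qed
    have blF: "bounded_linear F"
      using F by (intro bounded_linear_intro[where K = \<kappa>]) (auto simp: linear_add linear_scale mult.commute)
    have "norm (F (R m t2 w) - F (R m 0 w)) \<le> \<nu> * (t2 - 0)"
    proof (rule vector_mvt_bound[where f = "\<lambda>r. F (R m r w)" and f' = "\<lambda>r. F (- tp m m (R m r w))"])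
      show "((\<lambda>r. F (R m r w)) has_vector_derivative F (- tp m m (R m r w))) (at r)" for r
        by (rule bounded_linear.has_vector_derivative[OF blF R_deriv])
      show "norm (F (- tp m m (R m r w))) \<le> \<nu>" if "0 \<le> r" for r
        using der[OF that] F(1) by (simp add: linear_neg)
    qed (use t2(1) in simp)
    then have "\<bar>F w\<bar> \<le> K * (\<kappa> * \<eta>' + \<epsilon>) + \<nu> * t2" using late by simp
    also have "\<dots> \<le> \<eta>"
    proof -
      have "K * (\<kappa> * \<eta>') \<le> K * (\<kappa>1 * \<eta>')" using k1 \<eta>' Kp by simp
      also have "\<dots> = \<eta> / 5" unfolding \<eta>'_def using k1 Kp by simp
      finally have 1: "5 * (K * (\<kappa> * \<eta>')) \<le> \<eta>" by simp
      have "t2 * (K * (\<kappa> * dC * s)) \<le> t2 * (K * (\<kappa>1 * (dC + 1) * s))"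
        using k1 dC0 s t2(1) Kp \<kappa> by (intro mult_left_mono mult_right_mono mult_mono) auto
      moreover have "5 * (t2 * (K * (\<kappa>1 * (dC + 1) * s))) = s * (5 * t2 * K * \<kappa>1 * (dC + 1))" by (simp only: mult_ac)
      ultimately have 2: "5 * (t2 * (K * (\<kappa> * dC * s))) \<le> \<eta>" using s1 by linarith
      have "t2 * (\<kappa> * (5 * K * \<theta>)) \<le> t2 * (\<kappa>1 * (5 * K * \<theta>))"
        using k1 t2(1) Kp \<theta> by (intro mult_left_mono mult_right_mono) auto
      also have "\<dots> = \<eta> / 5" unfolding \<theta>_def using k1 t2(1) Kp by simp
      finally have 3: "5 * (t2 * (\<kappa> * (5 * K * \<theta>))) \<le> \<eta>" by simp
      have "K * (\<kappa> * \<eta>' + \<epsilon>) + \<nu> * t2 = K * (\<kappa> * \<eta>') + K * \<epsilon> + t2 * (K * (\<epsilon> / s)) + t2 * (K * (\<kappa> * dC * s)) + t2 * (\<kappa> * (5 * K * \<theta>))"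
        unfolding \<nu>_def by (simp add: algebra_simps)
      then show ?thesis using 1 2 3 e1 e2 by linarith
    qed
    finally show ?thesis unfolding w_def y1_def .
  qed
  show ?thesis using \<epsilon> T(1) main by blast
qed

end

locale real_jb = jb_triple J tp for J :: "'a::banach \<Rightarrow> 'a" and tp :: "'a \<Rightarrow> 'a \<Rightarrow> 'a \<Rightarrow> 'a" +
  fixes E :: "'a set"
  assumes E: "subspace E" "closed E" and E_tp_mem: "x \<in> E \<Longrightarrow> y \<in> E \<Longrightarrow> z \<in> E \<Longrightarrow> tp x y z \<in> E"
begin

lemma R_E: "n \<in> E \<Longrightarrow> x \<in> E \<Longrightarrow> R n t x \<in> E"
  using E E_tp_mem by (intro R_mem) auto

text \<open>If f kills all products, then f (R y s y) is constant in s and tends to 0.\<close>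

lemma functional_zero_on_products:
  assumes f: "f \<in> dual_space E" and z: "\<And>a b c. a \<in> E \<Longrightarrow> b \<in> E \<Longrightarrow> c \<in> E \<Longrightarrow> f (tp a b c) = 0"
  shows "f x = 0"
proof -
  obtain F where F: "linear F" "\<And>x. x \<in> E \<Longrightarrow> F x = f x" "\<And>x. \<bar>F x\<bar> \<le> dual_norm E f * norm x"
    using dual_extend_global[OF f E(1)] by blast
  have nn: "0 \<le> dual_norm E f" by (rule dual_norm_nonneg[OF f E(1)])
  have blF: "bounded_linear F"
    using F by (intro bounded_linear_intro[where K = "dual_norm E f"]) (auto simp: linear_add linear_scale mult.commute)
  have unit: "f y = 0" if y: "y \<in> E" "norm y \<le> 1" for y
  proof -
    have const: "F (R y t y) = F y" if t: "0 \<le> t" for t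
    proof -
      have "norm (F (R y t y) - F (R y 0 y)) \<le> 0 * (t - 0)"
      proof (rule vector_mvt_bound[where f = "\<lambda>r. F (R y r y)" and f' = "\<lambda>r. F (- tp y y (R y r y))"])
        show "((\<lambda>r. F (R y r y)) has_vector_derivative F (- tp y y (R y r y))) (at r)" for r
          by (rule bounded_linear.has_vector_derivative[OF blF R_deriv])
        show "norm (F (- tp y y (R y r y))) \<le> 0" for r
          using F(1,2) z[OF y(1) y(1) R_E[OF y(1) y(1)]] E_tp_mem[OF y(1) y(1) R_E[OF y(1) y(1)]] by (simp add: linear_neg)
      qed (rule t)
      then show ?thesis by simp
    qed
    have bnd: "\<bar>F y\<bar> \<le> dual_norm E f * c" if c: "0 < c" for c
    proof -
      obtain S where "S > 0" "\<And>t n. t \<ge> S \<Longrightarrow> norm n \<le> 1 \<Longrightarrow> norm (R n t n) \<le> c" using R_self_small[OF c] by blast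
      then have "norm (R y S y) \<le> c" "F (R y S y) = F y" using y const by auto
      then show ?thesis using F(3)[of "R y S y"] mult_left_mono[OF _ nn, of "norm (R y S y)" c] by linarith
    qed
    have "\<bar>F y\<bar> \<le> 0 + e" if "0 < e" for e
    proof -
      have p: "dual_norm E f + 1 > 0" using nn by simp
      have "\<bar>F y\<bar> \<le> dual_norm E f * (e / (dual_norm E f + 1))"
        by (rule bnd) (use that p in simp)
      also have "\<dots> \<le> (dual_norm E f + 1) * (e / (dual_norm E f + 1))" using that p by (intro mult_right_mono) auto
      also have "\<dots> = e" using p by simp
      finally show ?thesis by simp
    qed
    then have "\<bar>F y\<bar> \<le> 0" by (rule field_le_epsilon)
    then show ?thesis using F(2)[OF y(1)] by simp
  qed
  show ?thesis
  proof (cases "x \<in> E \<and> x \<noteq> 0")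
    case True
    then have "f ((1 / norm x) *\<^sub>R x) = 0" using E(1) by (intro unit) (auto simp: subspace_scale)
    then show ?thesis using dual_scale[OF f, of x "1 / norm x"] True by simp
  qed (use dual_outside[OF f, of x] unit[of 0] E(1) in \<open>auto simp: subspace_0\<close>)
qed

end

section \<open>Norm preserving extensions from a triple ideal\<close>

locale triple_ideal_in = real_jb J tp E for J :: "'a::banach \<Rightarrow> 'a" and tp E +
  fixes M :: "'a set"
  assumes ideal: "triple_ideal tp E M"
begin

lemma M: "subspace M" "closed M" "M \<subseteq> E"
  using ideal by (auto simp: triple_ideal_def)

lemma M_tp: "a \<in> E \<Longrightarrow> b \<in> E \<Longrightarrow> x \<in> M \<Longrightarrow> tp a b x \<in> M" "a \<in> E \<Longrightarrow> b \<in> E \<Longrightarrow> x \<in> M \<Longrightarrow> tp a x b \<in> M"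
  "a \<in> E \<Longrightarrow> b \<in> E \<Longrightarrow> x \<in> M \<Longrightarrow> tp x a b \<in> M"
  using ideal tp_sym by (fastforce simp: triple_ideal_def)+

lemma R_diff_M: "n \<in> M \<Longrightarrow> x \<in> E \<Longrightarrow> R n t x - x \<in> M"
  using M M_tp by (intro R_minus_mem) auto

lemma tp_cong_M:
  assumes "a \<in> E" "b \<in> E" "c \<in> E" "a' \<in> E" "b' \<in> E" "c' \<in> E" "a' - a \<in> M" "b' - b \<in> M" "c' - c \<in> M"
  shows "tp a' b' c' - tp a b c \<in> M"
proof -
  have "tp a' b' c' - tp a b c = tp (a' - a) b' c' + tp a (b' - b) c' + tp a b (c' - c)" by (simp add: tp_lin)
  moreover have "tp (a' - a) b' c' \<in> M" "tp a (b' - b) c' \<in> M" "tp a b (c' - c) \<in> M" using assms M_tp by auto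
  ultimately show ?thesis using M(1) by (simp add: subspace_add)
qed

lemma polar_cong: "h \<in> polar E M \<Longrightarrow> x \<in> E \<Longrightarrow> y \<in> E \<Longrightarrow> x - y \<in> M \<Longrightarrow> h x = h y"
  using dual_diff[of h E x y] E(1) by (simp add: polar_def)

text \<open>The functionals that attain their norm on M (approximately); they turn out to be the
  complementary L-summand of the polar.\<close>

definition G :: "('a \<Rightarrow> real) set" where
  "G = {g \<in> dual_space E. \<forall>e>0. \<exists>m\<in>M. norm m \<le> 1 \<and> dual_norm E g - e \<le> g m}"

lemma G_dual: "g \<in> G \<Longrightarrow> g \<in> dual_space E" by (simp add: G_def)

lemma G_approx:
  assumes "g \<in> G" "0 < e" obtains m where "m \<in> M" "norm m \<le> 1" "dual_norm E g - e \<le> g m"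
  using assms unfolding G_def by blast

lemma G_cmult:
  assumes g: "g \<in> G" shows "(\<lambda>x. c * g x) \<in> G"
proof (cases "c = 0")
  case True
  have "dual_norm E (\<lambda>x. 0 * g x) = 0" using dual_norm_cmult[OF G_dual[OF g] E(1), of 0] by simp
  then show ?thesis unfolding G_def True using dual_space_cmult[OF G_dual[OF g], of 0] M(1)
    by (auto intro!: bexI[of _ 0] simp: subspace_0)
next
  case False
  have "\<exists>m\<in>M. norm m \<le> 1 \<and> dual_norm E (\<lambda>x. c * g x) - e \<le> c * g m" if e: "0 < e" for e
  proof -
    obtain m where m: "m \<in> M" "norm m \<le> 1" "dual_norm E g - e / \<bar>c\<bar> \<le> g m" using G_approx[OF g, of "e / \<bar>c\<bar>"] e False by auto
    have mm: "sgn c *\<^sub>R m \<in> M" "norm (sgn c *\<^sub>R m) \<le> 1" using m M(1) False by (auto simp: subspace_scale abs_sgn_eq)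
    have "\<bar>c\<bar> * (dual_norm E g - e / \<bar>c\<bar>) \<le> \<bar>c\<bar> * g m" using m by (intro mult_left_mono) auto
    moreover have "\<bar>c\<bar> * g m = c * g (sgn c *\<^sub>R m)"
      using dual_scale[OF G_dual[OF g], of m "sgn c"] m M(3) by (auto simp: abs_sgn mult_ac)
    ultimately show ?thesis using mm dual_norm_cmult[OF G_dual[OF g] E(1), of c] False
      by (intro bexI[of _ "sgn c *\<^sub>R m"]) (auto simp: right_diff_distrib)
  qed
  then show ?thesis unfolding G_def using dual_space_cmult[OF G_dual[OF g]] by blast
qed

text \<open>Hahn-Banach with \<alpha>, the norm of f on M, as bound: the extension has norm at most
  \<alpha>, and vectors of M come arbitrarily close to it.\<close>

lemma G_extension:
  assumes f: "f \<in> dual_space E"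
  obtains g where "g \<in> G" "\<And>m. m \<in> M \<Longrightarrow> g m = f m"
proof -
  define \<alpha> where "\<alpha> = (SUP m\<in>{m \<in> M. norm m \<le> 1}. f m)"
  have bdd: "bdd_above (f ` {m \<in> M. norm m \<le> 1})"
  proof (rule bdd_aboveI2[where M = "dual_norm E f"])
    show "f m \<le> dual_norm E f" if "m \<in> {m \<in> M. norm m \<le> 1}" for m
      using dual_norm_ge[OF f E(1), of m] that M(3) by auto
  qed
  have up: "f m \<le> \<alpha>" if "m \<in> M" "norm m \<le> 1" for m unfolding \<alpha>_def using that bdd by (intro cSUP_upper) auto
  have f0: "f 0 = 0" using dual_scale[OF f, of 0 0] E(1) by (simp add: subspace_0)
  have \<alpha>0: "0 \<le> \<alpha>" using up[of 0] M(1) f0 by (simp add: subspace_0)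
  have bound: "\<bar>f m\<bar> \<le> \<alpha> * norm m" if m: "m \<in> M" for m
  proof (cases "m = 0")
    case False
    have mE: "m \<in> E" using m M(3) by blast
    have "(1 / norm m) *\<^sub>R m \<in> M" "(- (1 / norm m)) *\<^sub>R m \<in> M" using m M(1) by (auto simp only: subspace_scale)
    then have "f ((1 / norm m) *\<^sub>R m) \<le> \<alpha>" "f ((- (1 / norm m)) *\<^sub>R m) \<le> \<alpha>" using False by (auto intro!: up)
    then show ?thesis unfolding dual_scale[OF f mE] using False by (simp add: abs_le_iff field_simps)
  qed (simp add: f0)
  obtain F where F: "linear F" "\<And>x. x \<in> M \<Longrightarrow> F x = f x" "\<And>x. \<bar>F x\<bar> \<le> \<alpha> * norm x"
    using Hahn_Banach_norm[of M f \<alpha>] dual_add[OF f] dual_scale[OF f] M bound \<alpha>0 by (metis subsetD)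
  define g where "g x = (if x \<in> E then F x else 0)" for x
  have gd: "g \<in> dual_space E" unfolding g_def using dual_restrictI[OF F(1,3) E(1)] .
  have gM: "g m = f m" if "m \<in> M" for m unfolding g_def using that F(2) M(3) by auto
  have "dual_norm E g \<le> \<alpha>"
  proof (rule dual_norm_leI[OF E(1) _ gd])
    fix x assume "x \<in> E" "norm x \<le> 1"
    then have "\<alpha> * norm x \<le> \<alpha>" using \<alpha>0 by (simp add: mult_left_le)
    then show "g x \<le> \<alpha>" using F(3)[of x] \<open>x \<in> E\<close> by (simp add: g_def abs_le_iff)
  qed
  moreover have "\<exists>m\<in>M. norm m \<le> 1 \<and> \<alpha> - e \<le> f m" if "0 < e" for e
  proof (rule ccontr)
    assume "\<not> ?thesis"
    then have le: "f m \<le> \<alpha> - e" if "m \<in> {m \<in> M. norm m \<le> 1}" for m using that by force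
    have "(SUP m\<in>{m \<in> M. norm m \<le> 1}. f m) \<le> \<alpha> - e"
      by (rule cSUP_least[OF _ le]) (use subspace_0[OF M(1)] in \<open>auto intro!: exI[of _ 0]\<close>)
    then show False using that unfolding \<alpha>_def by simp
  qed
  ultimately have "g \<in> G" unfolding G_def using gd gM by (smt (verit) mem_Collect_eq)
  then show thesis using that gM by blast
qed

text \<open>Let m in M nearly norm g and y nearly norm h. Replacing y by z = \<open>R m T y\<close>
  does not change h, since z - y lies in M, and makes m + z and m - z almost unit vectors. The value
  of g at z is harmless: near maximality of g at m, tested on m - z, bounds it from below.\<close>

lemma norm_split:
  assumes g: "g \<in> G" and h: "h \<in> polar E M"
  shows "dual_norm E (\<lambda>x. g x + h x) = dual_norm E g + dual_norm E h"
proof (rule antisym)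
  have gd: "g \<in> dual_space E" and hd: "h \<in> dual_space E" and hM: "\<And>m. m \<in> M \<Longrightarrow> h m = 0"
    using g h by (auto simp: G_def polar_def)
  have fd: "(\<lambda>x. g x + h x) \<in> dual_space E" by (rule dual_space_add[OF gd hd])
  show "dual_norm E (\<lambda>x. g x + h x) \<le> dual_norm E g + dual_norm E h" by (rule dual_norm_triangle[OF gd hd E(1)])
  define N where "N = dual_norm E (\<lambda>x. g x + h x)"
  define \<alpha> where "\<alpha> = dual_norm E g"
  have N0: "0 \<le> N" and \<alpha>0: "0 \<le> \<alpha>" unfolding N_def \<alpha>_def using dual_norm_nonneg[OF _ E(1)] fd gd by auto
  have "\<alpha> + dual_norm E h \<le> N + e * (N + \<alpha> + 3)" if e: "0 < e" for e
  proof -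
    obtain T where T: "T > 0" "\<And>t n y. t \<ge> T \<Longrightarrow> norm n \<le> 1 \<Longrightarrow> norm y \<le> 1 \<Longrightarrow> norm (n + R n t y) \<le> 1 + e \<and> norm (n - R n t y) \<le> 1 + e"
      using R_orth_norm[OF e] by blast
    obtain m where m: "m \<in> M" "norm m \<le> 1" "\<alpha> - e \<le> g m" using G_approx[OF g e] unfolding \<alpha>_def by blast
    obtain y where y: "y \<in> E" "norm y \<le> 1" "dual_norm E h - e \<le> h y" using dual_norm_approx[OF hd E(1) e] by blast
    have mE: "m \<in> E" using m M(3) by blast
    define z where "z = R m T y"
    have zE: "z \<in> E" unfolding z_def using mE y(1) by (rule R_E)
    have hz: "h z = h y" unfolding z_def using polar_cong[OF h zE[unfolded z_def] y(1)] R_diff_M[OF m(1) y(1)] by blast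
    have nz: "norm (m + z) \<le> 1 + e" "norm (m - z) \<le> 1 + e" unfolding z_def using T(2)[of T m y] m y by auto
    have "g (m - z) \<le> \<alpha> * norm (m - z)"
      using dual_norm_bound[OF gd E(1), of "m - z"] mE zE E(1) unfolding \<alpha>_def by (auto simp: subspace_diff abs_le_iff)
    also have "\<dots> \<le> \<alpha> * (1 + e)" using nz \<alpha>0 by (intro mult_left_mono)
    finally have 1: "g m - g z \<le> \<alpha> * (1 + e)" using dual_diff[OF gd E(1) mE zE] by simp
    have "g (m + z) + h (m + z) \<le> N * norm (m + z)"
      using dual_norm_bound[OF fd E(1), of "m + z"] mE zE E(1) unfolding N_def by (auto simp: subspace_add abs_le_iff)
    also have "\<dots> \<le> N * (1 + e)" using nz N0 by (intro mult_left_mono)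
    finally have 2: "g m + g z + h z \<le> N * (1 + e)"
      using dual_add[OF gd mE zE] dual_add[OF hd mE zE] hM[OF m(1)] by simp
    show ?thesis using 1 2 m(3) y(3) hz by (simp add: algebra_simps)
  qed
  then have "\<alpha> + dual_norm E h \<le> N + e" if "0 < e" for e
  proof -
    have p: "N + \<alpha> + 3 > 0" using N0 \<alpha>0 by simp
    show ?thesis
      using \<open>\<And>e. 0 < e \<Longrightarrow> \<alpha> + dual_norm E h \<le> N + e * (N + \<alpha> + 3)\<close>[of "e / (N + \<alpha> + 3)"] that p by simp
  qed
  then show "dual_norm E g + dual_norm E h \<le> dual_norm E (\<lambda>x. g x + h x)"
    unfolding N_def \<alpha>_def by (rule field_le_epsilon)
qed

lemma polar_diff_of_agree: "f \<in> dual_space E \<Longrightarrow> g \<in> dual_space E \<Longrightarrow> (\<And>m. m \<in> M \<Longrightarrow> f m = g m) \<Longrightarrow> (\<lambda>x. f x - g x) \<in> polar E M"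
  by (simp add: polar_def dual_space_diff)

text \<open>The difference lies in the polar. Splitting norms in both directions shows that each of
  the two norms exceeds the other by the norm of the difference.\<close>

lemma G_unique:
  assumes g: "g1 \<in> G" "g2 \<in> G" and eq: "\<And>m. m \<in> M \<Longrightarrow> g1 m = g2 m"
  shows "g1 = g2"
proof
  fix x
  have h: "(\<lambda>x. g1 x - g2 x) \<in> polar E M" "(\<lambda>x. g2 x - g1 x) \<in> polar E M"
    using polar_diff_of_agree G_dual g eq by auto
  have hd: "(\<lambda>x. g1 x - g2 x) \<in> dual_space E" using h by (simp add: polar_def)
  have "dual_norm E g1 = dual_norm E g2 + dual_norm E (\<lambda>x. g1 x - g2 x)"
    using norm_split[OF g(2) h(1)] by simp
  moreover have "dual_norm E g2 = dual_norm E g1 + dual_norm E (\<lambda>x. g2 x - g1 x)"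
    using norm_split[OF g(1) h(2)] by simp
  moreover have "0 \<le> dual_norm E (\<lambda>x. g2 x - g1 x)" using dual_norm_nonneg[OF _ E(1)] h by (simp add: polar_def)
  ultimately have "dual_norm E (\<lambda>x. g1 x - g2 x) \<le> 0" by simp
  from dual_eq_zeroI[OF hd E(1) this, of x] show "g1 x = g2 x" by simp
qed

text \<open>Three functionals of G can be killed at once on a product of three elements: the outer factors
  are made orthogonal to the first two, and the inner factor is made orthogonal to the part of the
  first factor that is not orthogonal to the third.\<close>

lemma kill_three:
  assumes k: "k1 \<in> G" "k2 \<in> G" "k3 \<in> G" and h: "h \<in> polar E M" and eq: "\<And>x. x \<in> E \<Longrightarrow> h x = k1 x + k2 x - k3 x"
  shows "h x = 0"
proof -
  have hd: "h \<in> dual_space E" using h by (simp add: polar_def)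
  have outer: "\<exists>m\<in>M. norm m \<le> 1 \<and> (\<exists>t\<ge>0. \<forall>y\<in>E. \<forall>b\<in>E. \<forall>x\<in>E. norm y \<le> 1 \<longrightarrow> norm b \<le> 1 \<longrightarrow> norm x \<le> 1 \<longrightarrow> \<bar>k (tp (R m t y) b x)\<bar> \<le> \<eta>)"
    if k: "k \<in> G" and \<eta>: "0 < \<eta>" for k \<eta>
  proof -
    obtain F where F: "linear F" "\<And>x. x \<in> E \<Longrightarrow> F x = k x" "\<And>x. \<bar>F x\<bar> \<le> dual_norm E k * norm x"
      using dual_extend_global[OF G_dual[OF k] E(1)] by blast
    obtain \<epsilon> where \<epsilon>: "\<epsilon> > 0" "\<And>m. norm m \<le> 1 \<Longrightarrow> dual_norm E k - \<epsilon> \<le> F m \<Longrightarrow>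
      \<exists>T>0. \<forall>t\<ge>T. \<forall>y b x. norm y \<le> 1 \<longrightarrow> norm b \<le> 1 \<longrightarrow> norm x \<le> 1 \<longrightarrow> \<bar>F (tp (R m t y) b x)\<bar> \<le> \<eta>"
      using outer_orth_small[OF F(1,3) dual_norm_nonneg[OF G_dual[OF k] E(1)] \<eta>] by blast
    obtain m where m: "m \<in> M" "norm m \<le> 1" "dual_norm E k - \<epsilon> \<le> k m" using G_approx[OF k \<epsilon>(1)] by blast
    have mE: "m \<in> E" using m M(3) by blast
    obtain T where T: "T > 0" "\<And>y b x. norm y \<le> 1 \<Longrightarrow> norm b \<le> 1 \<Longrightarrow> norm x \<le> 1 \<Longrightarrow> \<bar>F (tp (R m T y) b x)\<bar> \<le> \<eta>"
      using \<epsilon>(2)[of m] m F(2)[OF mE] by (metis order_refl)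
    have "\<bar>k (tp (R m T y) b x)\<bar> \<le> \<eta>" if "y \<in> E" "b \<in> E" "x \<in> E" "norm y \<le> 1" "norm b \<le> 1" "norm x \<le> 1" for y b x
      using T(2)[of y b x] F(2)[OF E_tp_mem[OF R_E[OF mE]]] that by simp
    then show ?thesis using m T(1) by (intro bexI[of _ m] conjI exI[of _ T]) auto
  qed
  define \<kappa> where "\<kappa> = dual_norm E k3"
  have \<kappa>: "0 \<le> \<kappa>" unfolding \<kappa>_def by (rule dual_norm_nonneg[OF G_dual[OF k(3)] E(1)])
  have unit: "h (tp y b0 x) = 0" if y: "y \<in> E" "norm y \<le> 1" and b0: "b0 \<in> E" "norm b0 \<le> 1" and x: "x \<in> E" "norm x \<le> 1" for y b0 x
  proof -
    have est: "\<bar>h (tp y b0 x)\<bar> \<le> \<eta> * (3 + 2 * \<kappa>)" if \<eta>: "0 < \<eta>" for \<eta>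
    proof -
      obtain m1 t1 where 1: "m1 \<in> M" "t1 \<ge> 0" "\<And>y b x. y \<in> E \<Longrightarrow> b \<in> E \<Longrightarrow> x \<in> E \<Longrightarrow> norm y \<le> 1 \<Longrightarrow> norm b \<le> 1 \<Longrightarrow> norm x \<le> 1 \<Longrightarrow> \<bar>k1 (tp (R m1 t1 y) b x)\<bar> \<le> \<eta>"
        using outer[OF k(1) \<eta>] by blast
      obtain m2 t2 where 2: "m2 \<in> M" "t2 \<ge> 0" "\<And>y b x. y \<in> E \<Longrightarrow> b \<in> E \<Longrightarrow> x \<in> E \<Longrightarrow> norm y \<le> 1 \<Longrightarrow> norm b \<le> 1 \<Longrightarrow> norm x \<le> 1 \<Longrightarrow> \<bar>k2 (tp (R m2 t2 y) b x)\<bar> \<le> \<eta>"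
        using outer[OF k(2) \<eta>] by blast
      obtain m3 t3 where 3: "m3 \<in> M" "t3 \<ge> 0" "\<And>y b x. y \<in> E \<Longrightarrow> b \<in> E \<Longrightarrow> x \<in> E \<Longrightarrow> norm y \<le> 1 \<Longrightarrow> norm b \<le> 1 \<Longrightarrow> norm x \<le> 1 \<Longrightarrow> \<bar>k3 (tp (R m3 t3 y) b x)\<bar> \<le> \<eta>"
        using outer[OF k(3) \<eta>] by blast
      have mE: "m1 \<in> E" "m2 \<in> E" "m3 \<in> E" using 1 2 3 M(3) by auto
      define y1 where "y1 = R m1 t1 y"
      define x2 where "x2 = R m2 t2 x"
      have y1: "y1 \<in> E" "norm y1 \<le> 1" "y1 - y \<in> M"
        unfolding y1_def using R_E mE y R_diff_M 1 by (auto intro: norm_R_le)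
      have x2: "x2 \<in> E" "norm x2 \<le> 1" "x2 - x \<in> M"
        unfolding x2_def using R_E mE x R_diff_M 2 by (auto intro: norm_R_le)
      define u where "u = R m3 t3 y1"
      have u: "u \<in> E" "norm u \<le> 1" "u - y1 \<in> M"
        unfolding u_def using R_E mE y1 R_diff_M 3 by (auto intro: norm_R_le)
      \<comment> \<open>Now y1 = u + 2 v. As an outer factor u is nearly invisible to k3, and v is
        an element of M, to which the middle factor can be made orthogonal. All replacements stay
        within classes modulo M, so h does not notice them.\<close>
      define v where "v = (1 / 2) *\<^sub>R (y1 - u)"
      have "- (u - y1) \<in> M" using u(3) M(1) by (blast intro: subspace_neg)
      then have vM: "v \<in> M" unfolding v_def using M(1) by (simp add: subspace_scale)
      have nv: "norm v \<le> 1" unfolding v_def using y1(2) u(2) norm_triangle_ineq4[of y1 u] by simp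
      have vE: "v \<in> E" using vM M(3) by blast
      obtain T where T: "T > 0" "\<And>t n y x. t \<ge> T \<Longrightarrow> norm n \<le> 1 \<Longrightarrow> norm y \<le> 1 \<Longrightarrow> norm (tp n (R n t y) x) \<le> \<eta> * norm x"
        using orthogonality[OF \<eta>] by blast
      define b where "b = R v T b0"
      have b: "b \<in> E" "norm b \<le> 1" "b - b0 \<in> M"
        unfolding b_def using R_E vE b0 R_diff_M[OF vM] T(1) by (auto intro: norm_R_le)
      have "h (tp y1 b x2) = h (tp y b0 x)"
        using y1 b x2 y b0 x by (intro polar_cong[OF h] E_tp_mem tp_cong_M) auto
      moreover have "\<bar>k1 (tp y1 b x2)\<bar> \<le> \<eta>" unfolding y1_def using 1(3) y b x2 by simp
      moreover have "\<bar>k2 (tp y1 b x2)\<bar> \<le> \<eta>" unfolding x2_def tp_sym[of y1] using 2(3) x b y1 by simp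
      moreover have "\<bar>k3 (tp y1 b x2)\<bar> \<le> \<eta> + 2 * (\<kappa> * \<eta>)"
      proof -
        have yv: "y1 = u + 2 *\<^sub>R v" unfolding v_def by simp
        have "k3 (tp y1 b x2) = k3 (tp u b x2) + 2 * k3 (tp v b x2)"
          unfolding yv tp_add1 tp_scale1
          using dual_add[OF G_dual[OF k(3)]] dual_scale[OF G_dual[OF k(3)]] E_tp_mem u vE b x2 E(1)
          by (simp add: subspace_scale)
        moreover have "\<bar>k3 (tp u b x2)\<bar> \<le> \<eta>" unfolding u_def using 3(3) y1 b x2 by simp
        moreover have "\<bar>k3 (tp v b x2)\<bar> \<le> \<kappa> * \<eta>"
        proof -
          have "norm (tp v b x2) \<le> \<eta> * norm x2" unfolding b_def using T(2)[of T v b0] nv b0 by simp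
          also have "\<dots> \<le> \<eta>" using x2 \<eta> by (simp add: mult_left_le)
          finally have "\<kappa> * norm (tp v b x2) \<le> \<kappa> * \<eta>" using \<kappa> by (rule mult_left_mono)
          then show ?thesis
            using dual_norm_bound[OF G_dual[OF k(3)] E(1) E_tp_mem[OF vE b(1) x2(1)]] unfolding \<kappa>_def by linarith
        qed
        ultimately show ?thesis by linarith
      qed
      moreover have "h (tp y1 b x2) = k1 (tp y1 b x2) + k2 (tp y1 b x2) - k3 (tp y1 b x2)"
        using eq E_tp_mem y1 b x2 by blast
      ultimately have "\<bar>h (tp y b0 x)\<bar> \<le> 3 * \<eta> + 2 * (\<kappa> * \<eta>)" by linarith
      then show ?thesis by (simp add: algebra_simps)
    qed
    have "\<bar>h (tp y b0 x)\<bar> \<le> 0 + e" if "0 < e" for e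
    proof -
      have p: "3 + 2 * \<kappa> > 0" using \<kappa> by simp
      show ?thesis using est[of "e / (3 + 2 * \<kappa>)"] that p by simp
    qed
    then have "\<bar>h (tp y b0 x)\<bar> \<le> 0" by (rule field_le_epsilon)
    then show ?thesis by simp
  qed
  have "h (tp a b c) = 0" if a: "a \<in> E" "b \<in> E" "c \<in> E" for a b c
  proof -
    define r where "r = 1 + norm a + norm b + norm c"
    have r: "r > 0" unfolding r_def by (simp add: add_pos_nonneg)
    have "norm a \<le> r" "norm b \<le> r" "norm c \<le> r" unfolding r_def by auto
    then have "h (tp ((1 / r) *\<^sub>R a) ((1 / r) *\<^sub>R b) ((1 / r) *\<^sub>R c)) = 0"
      using a E(1) r by (intro unit) (auto simp: subspace_scale)
    then have "h ((1 / r * (1 / r * (1 / r))) *\<^sub>R tp a b c) = 0"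
      by (simp only: tp_scale1 tp_scale2 tp_scale3 scaleR_scaleR mult_ac)
    then show ?thesis using dual_scale[OF hd E_tp_mem[OF a], of "1 / r * (1 / r * (1 / r))"] r by simp
  qed
  then show ?thesis by (rule functional_zero_on_products[OF hd])
qed

lemma G_add:
  assumes g: "g1 \<in> G" "g2 \<in> G" shows "(\<lambda>x. g1 x + g2 x) \<in> G"
proof -
  have d: "(\<lambda>x. g1 x + g2 x) \<in> dual_space E" using dual_space_add G_dual g by blast
  obtain g3 where g3: "g3 \<in> G" "\<And>m. m \<in> M \<Longrightarrow> g3 m = g1 m + g2 m" using G_extension[OF d] by blast
  have "(\<lambda>x. (g1 x + g2 x) - g3 x) \<in> polar E M"
    using polar_diff_of_agree[OF d G_dual[OF g3(1)]] g3(2) by simp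
  from kill_three[OF g g3(1) this] have "(\<lambda>x. g1 x + g2 x) = g3" by fastforce
  then show ?thesis using g3(1) by simp
qed

text \<open>The complementary projection sends f to the norm preserving extension of its restriction
  to M. Uniqueness turns closure of \<open>G\<close> under sums and multiples into linearity, and
  \<open>norm_split\<close> is the L-condition.\<close>

theorem ideal_M_ideal: "M_ideal E M"
proof -
  define ext where "ext f = (SOME g. g \<in> G \<and> (\<forall>m\<in>M. g m = f m))" for f
  have ext: "ext f \<in> G" "\<And>m. m \<in> M \<Longrightarrow> ext f m = f m" if f: "f \<in> dual_space E" for f
  proof -
    have "\<exists>g. g \<in> G \<and> (\<forall>m\<in>M. g m = f m)" by (rule G_extension[OF f]) (intro exI conjI ballI)
    then have "ext f \<in> G \<and> (\<forall>m\<in>M. ext f m = f m)" unfolding ext_def by (rule someI_ex)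
    then show "ext f \<in> G" "\<And>m. m \<in> M \<Longrightarrow> ext f m = f m" by auto
  qed
  have ext_eq: "ext f = g" if "f \<in> dual_space E" "g \<in> G" "\<And>m. m \<in> M \<Longrightarrow> g m = f m" for f g
    using G_unique[OF ext(1)[OF that(1)] that(2)] ext(2)[OF that(1)] that(3) by simp
  define Q where "Q f = (\<lambda>x. f x - ext f x)" for f
  have Qp: "Q f \<in> polar E M" if "f \<in> dual_space E" for f
    unfolding Q_def using polar_diff_of_agree[OF that G_dual[OF ext(1)[OF that]]] ext(2)[OF that] by simp
  have zero: "(\<lambda>x. 0) \<in> G" using G_cmult[OF ext(1)[OF dual_space_zero], of 0] by simp
  have Q_polar: "Q h = h" if h: "h \<in> polar E M" for h
  proof -
    have "ext h = (\<lambda>x. 0)" using h zero by (intro ext_eq) (auto simp: polar_def)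
    then show ?thesis by (simp add: Q_def)
  qed
  have "L_projection E Q"
    unfolding L_projection_def
  proof (intro conjI ballI allI)
    fix f assume f: "f \<in> dual_space E"
    show "Q f \<in> dual_space E" using Qp[OF f] by (simp add: polar_def)
    show "Q (Q f) = Q f" using Q_polar[OF Qp[OF f]] .
    have "(\<lambda>x. ext f x + Q f x) = f" "(\<lambda>x. f x - Q f x) = ext f" by (simp_all add: Q_def)
    then show "dual_norm E f = dual_norm E (Q f) + dual_norm E (\<lambda>x. f x - Q f x)"
      using norm_split[OF ext(1)[OF f] Qp[OF f]] by simp
    show "Q (\<lambda>x. c * f x) = (\<lambda>x. c * Q f x)" for c
    proof -
      have "ext (\<lambda>x. c * f x) = (\<lambda>x. c * ext f x)"
        by (rule ext_eq[OF dual_space_cmult[OF f] G_cmult[OF ext(1)[OF f]]]) (simp add: ext(2)[OF f])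
      then show ?thesis by (simp add: Q_def right_diff_distrib)
    qed
    fix g assume g: "g \<in> dual_space E"
    have "ext (\<lambda>x. f x + g x) = (\<lambda>x. ext f x + ext g x)"
      by (rule ext_eq[OF dual_space_add[OF f g] G_add[OF ext(1)[OF f] ext(1)[OF g]]]) (simp add: ext(2)[OF f] ext(2)[OF g])
    then show "Q (\<lambda>x. f x + g x) = (\<lambda>x. Q f x + Q g x)" by (simp add: Q_def fun_eq_iff)
  qed
  moreover have "Q ` dual_space E = polar E M"
  proof
    show "Q ` dual_space E \<subseteq> polar E M" using Qp by blast
    show "polar E M \<subseteq> Q ` dual_space E" 
    proof
      fix h assume h: "h \<in> polar E M"
      then have "h \<in> dual_space E" by (simp add: polar_def)
      then have "Q h \<in> Q ` dual_space E" by (rule imageI)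
      then show "h \<in> Q ` dual_space E" by (simp only: Q_polar[OF h])
    qed
  qed
  ultimately show ?thesis unfolding M_ideal_def using M by blast
qed

end

section \<open>M-ideals are triple ideals\<close>

text \<open>If the balls did not meet, the Hahn-Banach theorem in the sup-normed square of E would give
  functionals F1, F2 with joint norm at most 1 that contradict the norm formula for Q.\<close>

lemma M_ideal_two_ball:
  fixes E M :: "'a::real_normed_vector set"
  assumes E: "subspace E" and ME: "M \<subseteq> E" and L: "L_projection E Q" and Q: "Q ` dual_space E = polar E M"
    and g: "g \<in> polar E M" "dual_norm E g = 1" and m: "m \<in> M" "norm m \<le> 1" and e: "0 < e"
  shows "\<exists>x\<in>E. g x = 1 \<and> norm (x + m) \<le> 1 + e \<and> norm (x - m) \<le> 1 + e"
proof (rule ccontr)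
  assume neg: "\<not> ?thesis"
  define r where "r = 1 + e"
  have gd: "g \<in> dual_space E" and mE: "m \<in> E" using g m(1) ME by (auto simp: polar_def)
  note gadd = dual_add[OF gd] and gscale = dual_scale[OF gd]
  define p where "p w = max (norm (fst w)) (norm (snd w))" for w :: "'a \<times> 'a"
  \<comment> \<open>A required x would have both coordinates of its pair of norm at most r. If there
    is none, scaling to g x = 1 shows that f, which is r g x on the pair of x, is dominated by p on
    N.\<close>
  define N where "N = (\<lambda>x. (x + g x *\<^sub>R m, x - g x *\<^sub>R m)) ` E"
  define f where "f w = r * g ((1 / 2) *\<^sub>R (fst w + snd w))" for w
  have fN: "f (x + g x *\<^sub>R m, x - g x *\<^sub>R m) = r * g x" for x
  proof -
    have "(1 / 2) *\<^sub>R ((x + g x *\<^sub>R m) + (x - g x *\<^sub>R m)) = x" by (simp flip: scaleR_2)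
    then show ?thesis by (simp add: f_def)
  qed
  have NI: "(u, v) \<in> N" if "x \<in> E" "u = x + g x *\<^sub>R m" "v = x - g x *\<^sub>R m" for u v x
    unfolding N_def using that by blast
  have NE: "\<exists>x\<in>E. w = (x + g x *\<^sub>R m, x - g x *\<^sub>R m)" if "w \<in> N" for w
    using that unfolding N_def by blast
  have E2: "(1 / 2) *\<^sub>R (fst w + snd w) \<in> E" if w: "w \<in> N" for w
  proof -
    obtain x where x: "x \<in> E" "w = (x + g x *\<^sub>R m, x - g x *\<^sub>R m)" using NE[OF w] by blast
    have "(1 / 2) *\<^sub>R (fst w + snd w) = x" unfolding x(2) by (simp flip: scaleR_2)
    then show ?thesis using x(1) by simp
  qed
  obtain F where F: "linear F" "\<And>w. w \<in> N \<Longrightarrow> F w = f w" "\<And>w. F w \<le> p w"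
  proof (rule Hahn_Banach_sublinear[of p N f])
    show "p (x + y) \<le> p x + p y" for x y
      unfolding p_def using norm_triangle_ineq[of "fst x" "fst y"] norm_triangle_ineq[of "snd x" "snd y"]
      by (simp add: max_def)
    show "p (c *\<^sub>R x) = c * p x" if "0 \<le> c" for c x
      unfolding p_def using that by (simp add: max_mult_distrib_left)
    show "subspace N"
      unfolding subspace_def
    proof (intro conjI ballI allI)
      have "(0, 0) \<in> N" using gscale[of 0 0] E by (intro NI[of 0]) (auto simp: subspace_0)
      then show "0 \<in> N" by (simp add: zero_prod_def)
      fix w w' assume "w \<in> N" "w' \<in> N"
      then obtain x y where xy: "x \<in> E" "w = (x + g x *\<^sub>R m, x - g x *\<^sub>R m)" "y \<in> E" "w' = (y + g y *\<^sub>R m, y - g y *\<^sub>R m)"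
        using NE by meson
      show "w + w' \<in> N" unfolding xy add_Pair
        using xy E by (intro NI[of "x + y"]) (auto simp: gadd subspace_add scaleR_add_left)
    next
      fix c w assume "w \<in> N"
      then obtain x where x: "x \<in> E" "w = (x + g x *\<^sub>R m, x - g x *\<^sub>R m)" using NE by blast
      show "c *\<^sub>R w \<in> N" unfolding x scaleR_Pair
        using x E by (intro NI[of "c *\<^sub>R x"]) (auto simp: gscale subspace_scale scaleR_add_right scaleR_diff_right)
    qed
    show "f (x + y) = f x + f y" if "x \<in> N" "y \<in> N" for x y
    proof -
      have "(1 / 2) *\<^sub>R (fst (x + y) + snd (x + y)) = (1 / 2) *\<^sub>R (fst x + snd x) + (1 / 2) *\<^sub>R (fst y + snd y)"
        by (simp add: algebra_simps)
      then show ?thesis unfolding f_def using gadd[OF E2[OF that(1)] E2[OF that(2)]] by (simp only: distrib_left)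
    qed
    show "f (c *\<^sub>R x) = c * f x" if "x \<in> N" for c x
    proof -
      have "(1 / 2) *\<^sub>R (fst (c *\<^sub>R x) + snd (c *\<^sub>R x)) = c *\<^sub>R ((1 / 2) *\<^sub>R (fst x + snd x))"
        by (simp add: algebra_simps)
      then show ?thesis unfolding f_def using gscale[OF E2[OF that]] by (simp only: mult.left_commute)
    qed
    show "f w \<le> p w" if w: "w \<in> N" for w
    proof -
      obtain x where x: "x \<in> E" "w = (x + g x *\<^sub>R m, x - g x *\<^sub>R m)" using NE[OF w] by blast
      have fw: "f w = r * g x" unfolding x(2) by (rule fN)
      show ?thesis
      proof (cases "g x \<le> 0")
        case True
        have "r * g x \<le> 0" using True e unfolding r_def by (intro mult_nonneg_nonpos) auto
        also have "0 \<le> p w" unfolding p_def by (simp add: le_max_iff_disj)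
        finally show ?thesis unfolding fw .
      next
        case False
        define x' where "x' = (1 / g x) *\<^sub>R x"
        have x': "x' \<in> E" "g x' = 1" "x = g x *\<^sub>R x'" unfolding x'_def using x(1) E gscale False by (auto simp: subspace_scale)
        have "\<not> (norm (x' + m) \<le> r \<and> norm (x' - m) \<le> r)" using neg x' unfolding r_def by blast
        then have "r \<le> max (norm (x' + m)) (norm (x' - m))" by linarith
        then have "g x * r \<le> g x * max (norm (x' + m)) (norm (x' - m))" using False by (intro mult_left_mono) auto
        also have "\<dots> = max (norm (g x *\<^sub>R (x' + m))) (norm (g x *\<^sub>R (x' - m)))"
          using False by (simp add: max_mult_distrib_left)
        also have "\<dots> = p w" unfolding p_def x(2) scaleR_add_right scaleR_diff_right x'(3)[symmetric] by simp
        finally show ?thesis unfolding fw by (simp add: mult.commute)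
      qed
    qed
  qed blast
  define F1 where "F1 u = (if u \<in> E then F (u, 0) else 0)" for u
  define F2 where "F2 u = (if u \<in> E then F (0, u) else 0)" for u
  have split: "F (u, v) = F (u, 0) + F (0, v)" for u v
    using linear_add[OF F(1), of "(u, 0)" "(0, v)"] by simp
  have lin1: "linear (\<lambda>u. F (u, 0))"
  proof (rule linearI)
    show "F (a + b, 0) = F (a, 0) + F (b, 0)" for a b using linear_add[OF F(1), of "(a, 0)" "(b, 0)"] by simp
    show "F (c *\<^sub>R b, 0) = c *\<^sub>R F (b, 0)" for c b using linear_scale[OF F(1), of c "(b, 0)"] by simp
  qed
  have lin2: "linear (\<lambda>u. F (0, u))"
  proof (rule linearI)
    show "F (0, a + b) = F (0, a) + F (0, b)" for a b using linear_add[OF F(1), of "(0, a)" "(0, b)"] by simp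
    show "F (0, c *\<^sub>R b) = c *\<^sub>R F (0, b)" for c b using linear_scale[OF F(1), of c "(0, b)"] by simp
  qed
  have b1: "\<bar>F (u, 0)\<bar> \<le> 1 * norm u" for u
    using F(3)[of "(u, 0)"] F(3)[of "(- u, 0)"] linear_neg[OF lin1, of u] by (simp add: p_def abs_le_iff)
  have b2: "\<bar>F (0, u)\<bar> \<le> 1 * norm u" for u
    using F(3)[of "(0, u)"] F(3)[of "(0, - u)"] linear_neg[OF lin2, of u] by (simp add: p_def abs_le_iff)
  have F12: "F1 \<in> dual_space E" "F2 \<in> dual_space E"
    unfolding F1_def F2_def using dual_restrictI[OF lin1 b1 E] dual_restrictI[OF lin2 b2 E] by auto
  \<comment> \<open>The dual of the maximum norm is the sum norm: the two unit vectors can be chosen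
    independently.\<close>
  have le1: "dual_norm E F1 + dual_norm E F2 \<le> 1"
  proof (rule field_le_epsilon)
    fix d :: real assume "0 < d"
    then have d2: "0 < d / 2" by simp
    obtain u where u: "u \<in> E" "norm u \<le> 1" "dual_norm E F1 - d / 2 \<le> F1 u" using dual_norm_approx[OF F12(1) E d2] .
    obtain v where v: "v \<in> E" "norm v \<le> 1" "dual_norm E F2 - d / 2 \<le> F2 v" using dual_norm_approx[OF F12(2) E d2] .
    have "F (u, v) \<le> 1" using F(3)[of "(u, v)"] u v by (simp add: p_def)
    then show "dual_norm E F1 + dual_norm E F2 \<le> 1 + d" using u v split[of u v] by (simp add: F1_def F2_def)
  qed
  \<comment> \<open>Comparing F with f on the pair of x forces F1 + F2 to be this multiple of
    g.\<close>
  define \<kappa> where "\<kappa> = r - (F1 m - F2 m)"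
  have sum: "(\<lambda>x. F1 x + F2 x) = (\<lambda>x. \<kappa> * g x)"
  proof
    fix x
    show "F1 x + F2 x = \<kappa> * g x"
    proof (cases "x \<in> E")
      case True
      have "F (x + g x *\<^sub>R m, x - g x *\<^sub>R m) = r * g x"
        using F(2)[OF NI[OF True refl refl]] fN by simp
      moreover have "F (x + g x *\<^sub>R m, 0) = F1 x + g x * F1 m"
        using True mE linear_add[OF lin1] linear_scale[OF lin1] by (simp add: F1_def)
      moreover have "F (0, x - g x *\<^sub>R m) = F2 x - g x * F2 m"
        using True mE linear_diff[OF lin2] linear_scale[OF lin2] by (simp add: F2_def)
      ultimately have "F1 x + g x * F1 m + (F2 x - g x * F2 m) = r * g x" using split by metis
      then show ?thesis unfolding \<kappa>_def by (simp add: algebra_simps)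
    next
      case False
      then show ?thesis using dual_outside[OF gd] by (simp add: F1_def F2_def)
    qed
  qed
  have Qd: "Q h \<in> dual_space E" "dual_norm E h = dual_norm E (Q h) + dual_norm E (\<lambda>x. h x - Q h x)" if "h \<in> dual_space E" for h
    using L that unfolding L_projection_def by blast+
  have Qm: "Q h m = 0" if "h \<in> dual_space E" for h
    using Q that m(1) unfolding polar_def by blast
  have Qg: "Q g = g"
  proof -
    obtain h where h: "h \<in> dual_space E" "g = Q h" using g(1) Q by blast
    have "Q (Q h) = Q h" using L h(1) unfolding L_projection_def by blast
    then show ?thesis using h(2) by simp
  qed
  have "Q (\<lambda>x. F1 x + F2 x) = (\<lambda>x. Q F1 x + Q F2 x)" using L F12 unfolding L_projection_def by blast
  moreover have "Q (\<lambda>x. \<kappa> * g x) = (\<lambda>x. \<kappa> * Q g x)" using L gd unfolding L_projection_def by blast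
  ultimately have Qs: "(\<lambda>x. Q F1 x + Q F2 x) = (\<lambda>x. \<kappa> * g x)" unfolding sum Qg by simp
  \<comment> \<open>Q fixes g, so the components of F1 and F2 outside the polar are \<psi> and -
    \<psi>. The norm formula gives |\<kappa>| + 2 N \<le> 1 for the norm N of \<psi>, while \<kappa>
    = r - 2 \<psi> m \<ge> r - 2 N. Together r \<le> 1, against r = 1 + e.\<close>
  define \<psi> where "\<psi> x = F1 x - Q F1 x" for x
  have \<psi>d: "\<psi> \<in> dual_space E" unfolding \<psi>_def using F12 Qd(1) by (intro dual_space_diff)
  have \<psi>2: "(\<lambda>x. F2 x - Q F2 x) = (\<lambda>x. - 1 * \<psi> x)"
  proof
    fix x
    show "F2 x - Q F2 x = - 1 * \<psi> x" using fun_cong[OF sum, of x] fun_cong[OF Qs, of x] by (simp add: \<psi>_def)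
  qed
  have n\<psi>: "dual_norm E (\<lambda>x. F2 x - Q F2 x) = dual_norm E \<psi>"
    unfolding \<psi>2 using dual_norm_cmult[OF \<psi>d E, of "- 1"] by simp
  have "\<bar>\<kappa>\<bar> \<le> dual_norm E (Q F1) + dual_norm E (Q F2)"
    using dual_norm_triangle[OF Qd(1)[OF F12(1)] Qd(1)[OF F12(2)] E] dual_norm_cmult[OF gd E, of \<kappa>] g(2) unfolding Qs by simp
  moreover have "dual_norm E F1 + dual_norm E F2 = dual_norm E (Q F1) + dual_norm E (Q F2) + 2 * dual_norm E \<psi>"
    using Qd(2)[OF F12(1)] Qd(2)[OF F12(2)] n\<psi> unfolding \<psi>_def by simp
  ultimately have "\<kappa> + 2 * dual_norm E \<psi> \<le> 1" using le1 by simp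
  moreover have "F1 m - F2 m \<le> 2 * dual_norm E \<psi>"
  proof -
    have "F1 m - F2 m = 2 * \<psi> m" using fun_cong[OF \<psi>2, of m] Qm F12 by (simp add: \<psi>_def)
    moreover have "\<psi> m \<le> dual_norm E \<psi>"
      using dual_norm_ge[OF \<psi>d E mE m(2)] by simp
    ultimately show ?thesis by simp
  qed
  ultimately show False using e unfolding \<kappa>_def r_def by simp
qed

text \<open>The range s \<le> 1 / 3 is the one in which \<open>derivation_first_order\<close> is
  available.\<close>

lemma abs_le_small_zero:
  fixes y :: real
  assumes "\<And>s. 0 < s \<Longrightarrow> s \<le> 1 / 3 \<Longrightarrow> \<bar>y\<bar> \<le> C * s" and C: "0 \<le> C"
  shows "y = 0"
proof -
  have "\<bar>y\<bar> \<le> 0 + e" if e: "0 < e" for e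
  proof -
    define s where "s = min (1 / 3) (e / (C + 1))"
    have s0: "0 < s" unfolding s_def using e C by simp
    have s: "s \<le> 1 / 3" "s \<le> e / (C + 1)" unfolding s_def by (rule min.cobounded1, rule min.cobounded2)
    have "C * s \<le> (C + 1) * s" using s0 by simp
    also have "\<dots> \<le> e" using s(2) C by (simp add: pos_le_divide_eq mult.commute)
    finally show ?thesis using assms(1)[OF s0 s(1)] by simp
  qed
  then have "\<bar>y\<bar> \<le> 0" by (rule field_le_epsilon)
  then show ?thesis by simp
qed

lemma unit_scale:
  fixes x :: "'v::real_normed_vector"
  obtains r y where "0 < r" "norm y \<le> 1" "x = r *\<^sub>R y" "y = (1 / r) *\<^sub>R x"
proof -
  have p: "0 < 1 + norm x" by (simp add: add_pos_nonneg)
  then have "norm ((1 / (1 + norm x)) *\<^sub>R x) \<le> 1" by (simp add: field_simps)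
  then show thesis using that[of "1 + norm x" "(1 / (1 + norm x)) *\<^sub>R x"] p by simp
qed

section \<open>Derivations and cubes of elements of an M-ideal\<close>

locale M_ideal_in = real_jb J tp E for J :: "'a::banach \<Rightarrow> 'a" and tp E +
  fixes M :: "'a set"
  assumes M_ideal: "M_ideal E M"
begin

lemma M: "subspace M" "closed M" "M \<subseteq> E"
  using M_ideal by (auto simp: M_ideal_def)

lemma ME: "m \<in> M \<Longrightarrow> m \<in> E" using M(3) by blast

lemma two_ball:
  assumes "g \<in> polar E M" "dual_norm E g = 1" "m \<in> M" "norm m \<le> 1" "0 < e"
  obtains x where "x \<in> E" "g x = 1" "norm (x + m) \<le> 1 + e" "norm (x - m) \<le> 1 + e"
proof -
  obtain Q where "L_projection E Q" "Q ` dual_space E = polar E M" using M_ideal unfolding M_ideal_def by blast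
  from M_ideal_two_ball[OF E(1) M(3) this assms] show thesis using that by blast
qed

lemma polar_dual: "g \<in> polar E M \<Longrightarrow> g \<in> dual_space E" and polar_M: "g \<in> polar E M \<Longrightarrow> m \<in> M \<Longrightarrow> g m = 0"
  by (auto simp: polar_def)

lemma polar_cmult: "g \<in> polar E M \<Longrightarrow> (\<lambda>x. c * g x) \<in> polar E M"
  using dual_space_cmult by (auto simp: polar_def)

lemma polar_le: "g \<in> polar E M \<Longrightarrow> dual_norm E g = 1 \<Longrightarrow> x \<in> E \<Longrightarrow> g x \<le> norm x"
  using dual_norm_bound[OF polar_dual E(1), of g x] by simp

lemma polar_normalize:
  assumes g: "g \<in> polar E M" and g0: "dual_norm E g \<noteq> 0"
  shows "(\<lambda>x. 1 / dual_norm E g * g x) \<in> polar E M" "dual_norm E (\<lambda>x. 1 / dual_norm E g * g x) = 1"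
proof -
  show "(\<lambda>x. 1 / dual_norm E g * g x) \<in> polar E M" by (rule polar_cmult[OF g])
  show "dual_norm E (\<lambda>x. 1 / dual_norm E g * g x) = 1"
    unfolding dual_norm_cmult[OF polar_dual[OF g] E(1)] using g0 dual_norm_nonneg[OF polar_dual[OF g] E(1)] by simp
qed

lemma polar_zeroI:
  assumes g: "g \<in> polar E M" and unit: "\<And>h. h \<in> polar E M \<Longrightarrow> dual_norm E h = 1 \<Longrightarrow> h x = 0"
  shows "g x = 0"
proof (cases "dual_norm E g = 0")
  case True
  then show ?thesis using dual_eq_zeroI[OF polar_dual[OF g] E(1)] by simp
next
  case False
  then show ?thesis using unit[OF polar_normalize[OF g False]] by simp
qed

lemma mem_MI:
  assumes "x \<in> E" "\<And>g. g \<in> polar E M \<Longrightarrow> dual_norm E g = 1 \<Longrightarrow> g x = 0"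
  shows "x \<in> M"
  using polar_zeroI[OF _ assms(2)] by (intro in_closed_subspaceI[OF M(1,2) E(1) M(3) assms(1)])

text \<open>The derivation d is applied for time r at x + m and for time - r at x - m. Adding the
  two estimates cancels g (d x) and leaves g (d m), with an error of second order in s.\<close>

lemma derivation_M_unit:
  assumes a: "a \<in> E" "norm a \<le> 1" and b: "b \<in> E" "norm b \<le> 1" and m: "m \<in> M" "norm m \<le> 1"
    and g: "g \<in> polar E M" "dual_norm E g = 1"
  shows "g (tp a b m - tp b a m) = 0"
proof (rule abs_le_small_zero[where C = "2 * dC + 1"])
  define d where "d u = tp a b u - tp b a u" for u
  have dE: "d u \<in> E" if "u \<in> E" for u unfolding d_def using E E_tp_mem a b that by (simp add: subspace_diff)
  fix s :: real assume s: "0 < s" "s \<le> 1 / 3"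
  have s2: "s\<^sup>2 \<le> 1" using s by (simp add: power_le_one)
  obtain x where x: "x \<in> E" "g x = 1" "norm (x + m) \<le> 1 + s\<^sup>2" "norm (x - m) \<le> 1 + s\<^sup>2"
    using two_ball[OF g m, of "s\<^sup>2"] s by auto
  note mE = ME[OF m(1)]
  have est: "g u + r * g (d u) \<le> (1 + dC * s\<^sup>2) * (1 + s\<^sup>2)"
    if u: "u \<in> E" "norm u \<le> 1 + s\<^sup>2" and r: "\<bar>r\<bar> = s" for u r
  proof -
    have "g u + r * g (d u) = g (u + r *\<^sub>R d u)"
      using dual_add[OF polar_dual[OF g(1)] u(1)] dual_scale[OF polar_dual[OF g(1)] dE[OF u(1)]] dE[OF u(1)] E(1) by (simp add: subspace_scale)
    also have "\<dots> \<le> norm (u + r *\<^sub>R d u)" using dE[OF u(1)] u E(1) by (intro polar_le[OF g]) (simp add: subspace_add subspace_scale)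
    also have "\<dots> \<le> (1 + dC * r\<^sup>2) * norm u" unfolding d_def using r s by (intro derivation_first_order a b) auto
    also have "r\<^sup>2 = s\<^sup>2" using r by (metis power2_abs)
    also have "(1 + dC * s\<^sup>2) * norm u \<le> (1 + dC * s\<^sup>2) * (1 + s\<^sup>2)" using u(2) dC0 by (intro mult_left_mono) auto
    finally show ?thesis .
  qed
  have dl: "d (x + m) = d x + d m" "d (x - m) = d x - d m" unfolding d_def by (simp_all add: tp_lin)
  have gl: "g (x + m) = 1" "g (x - m) = 1" "g (d x + d m) = g (d x) + g (d m)" "g (d x - d m) = g (d x) - g (d m)"
    using dual_add[OF polar_dual[OF g(1)]] dual_diff[OF polar_dual[OF g(1)] E(1)] dE x mE polar_M[OF g(1) m(1)] by auto
  have "r * g (d m) \<le> (1 + dC * s\<^sup>2) * (1 + s\<^sup>2) - 1" if r: "\<bar>r\<bar> = s" for r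
  proof -
    have "x + m \<in> E" "x - m \<in> E" using x mE E by (auto simp: subspace_add subspace_diff)
    then have "1 + r * (g (d x) + g (d m)) \<le> (1 + dC * s\<^sup>2) * (1 + s\<^sup>2)" "1 + (- r) * (g (d x) - g (d m)) \<le> (1 + dC * s\<^sup>2) * (1 + s\<^sup>2)"
      using est[of "x + m" r] est[of "x - m" "- r"] x r unfolding dl gl by auto
    then show ?thesis by (simp add: algebra_simps)
  qed
  from this[of s] this[of "- s"] have "s * \<bar>g (d m)\<bar> \<le> (1 + dC * s\<^sup>2) * (1 + s\<^sup>2) - 1"
    using s by (auto simp: abs_if)
  also have "\<dots> = (1 + dC + dC * s\<^sup>2) * s\<^sup>2" by (simp add: algebra_simps)
  also have "\<dots> \<le> (2 * dC + 1) * s\<^sup>2" using mult_left_mono[OF s2 dC0] by (intro mult_right_mono) auto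
  also have "\<dots> = s * ((2 * dC + 1) * s)" by (simp add: power2_eq_square)
  finally show "\<bar>g (tp a b m - tp b a m)\<bar> \<le> (2 * dC + 1) * s" using s unfolding d_def by simp
qed (use dC0 in simp)

lemma derivation_M:
  assumes a: "a \<in> E" and b: "b \<in> E" and m: "m \<in> M"
  shows "tp a b m - tp b a m \<in> M"
proof -
  obtain r a' where 1: "0 < r" "norm a' \<le> 1" "a = r *\<^sub>R a'" "a' = (1 / r) *\<^sub>R a" by (rule unit_scale)
  obtain q b' where 2: "0 < q" "norm b' \<le> 1" "b = q *\<^sub>R b'" "b' = (1 / q) *\<^sub>R b" by (rule unit_scale)
  obtain t m' where 3: "0 < t" "norm m' \<le> 1" "m = t *\<^sub>R m'" "m' = (1 / t) *\<^sub>R m" by (rule unit_scale)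
  have in': "a' \<in> E" "b' \<in> E" "m' \<in> M" using 1(4) 2(4) 3(4) a b m E(1) M(1) by (auto simp: subspace_scale)
  have "tp a' b' m' - tp b' a' m' \<in> M"
  proof (rule mem_MI)
    show "tp a' b' m' - tp b' a' m' \<in> E"
      by (intro subspace_diff[OF E(1)] E_tp_mem in' ME)
    show "g (tp a' b' m' - tp b' a' m') = 0" if "g \<in> polar E M" "dual_norm E g = 1" for g
      by (rule derivation_M_unit[OF in'(1) 1(2) in'(2) 2(2) in'(3) 3(2) that])
  qed
  then have "(r * q * t) *\<^sub>R (tp a' b' m' - tp b' a' m') \<in> M" using M(1) by (simp only: subspace_scale)
  moreover have "tp a b m - tp b a m = (r * q * t) *\<^sub>R (tp a' b' m' - tp b' a' m')"
    unfolding 1(3) 2(3) 3(3) tp_scale1 tp_scale2 tp_scale3 by (simp add: scaleR_diff_right mult_ac)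
  ultimately show ?thesis by simp
qed

text \<open>Collected in \<open>cube_near_one\<close>: the 4 pays for normalizing u, and the factor
  2 bounds (1 + s^2)^3 there.\<close>

definition cC :: real where "cC = 2 * ((1 + K)\<^sup>2 * exp (1 + K) + 2) + 4"

lemma cC0: "0 \<le> cC" by (simp add: cC_def)

text \<open>For the normalized vector v, g is within s^2 of its maximum, and
  \<open>cube_first_order\<close> bounds g (v + s (v - {v, v, v})) by 1 + O(s^2). Division by s
  leaves 1 - g {v, v, v} = O(s); the other inequality is the norm bound.\<close>

lemma cube_near_one:
  assumes g: "g \<in> polar E M" "dual_norm E g = 1" and u: "u \<in> E" "g u = 1" "norm u \<le> 1 + s\<^sup>2" and s: "0 < s" "s \<le> 1 / 3"
  shows "\<bar>g (cb u) - 1\<bar> \<le> cC * s"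
proof -
  define C where "C = (1 + K)\<^sup>2 * exp (1 + K)"
  define e where "e = s\<^sup>2"
  have s2: "s\<^sup>2 \<le> 1 / 3 * s" using s unfolding power2_eq_square by (intro mult_right_mono) auto
  have e: "0 < e" "e \<le> 1 / 9" "e \<le> s" using s s2 unfolding e_def by auto
  define v where "v = (1 / (1 + e)) *\<^sub>R u"
  have v: "v \<in> E" "norm v \<le> 1" "u = (1 + e) *\<^sub>R v" 
  proof -
    show "v \<in> E" unfolding v_def using u(1) E(1) by (simp add: subspace_scale)
    show "u = (1 + e) *\<^sub>R v" unfolding v_def using e by simp
    have "norm v = norm u / (1 + e)" unfolding v_def using e by simp
    then show "norm v \<le> 1" using u(3) e unfolding e_def[symmetric] by simp
  qed
  note gd = polar_dual[OF g(1)]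
  have cbE: "cb v \<in> E" unfolding cb_def using v E_tp_mem by blast
  have gv: "g v = 1 / (1 + e)" unfolding v_def using dual_scale[OF gd u(1)] u(2) by simp
  have "1 - e \<le> 1 / (1 + e)" using e by (simp add: field_simps)
  then have gv1: "1 - e \<le> g v" unfolding gv .
  have up: "g (cb v) \<le> 1"
  proof -
    have "g (cb v) \<le> norm (cb v)" by (rule polar_le[OF g cbE])
    also have "\<dots> \<le> 1" using v(2) by (simp add: norm_cb power_le_one)
    finally show ?thesis .
  qed
  have "g (v + s *\<^sub>R (v - cb v)) = g v + s * (g v - g (cb v))"
    using dual_add[OF gd v(1)] dual_scale[OF gd] dual_diff[OF gd E(1) v(1) cbE] v(1) cbE E(1)
    by (simp add: subspace_diff subspace_scale)
  moreover have "g (v + s *\<^sub>R (v - cb v)) \<le> norm (v + s *\<^sub>R (v - cb v))"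
    using v(1) cbE E(1) by (intro polar_le[OF g]) (simp add: subspace_add subspace_diff subspace_scale)
  moreover have "norm (v + s *\<^sub>R (v - cb v)) \<le> 1 + C * s\<^sup>2"
    unfolding C_def using s by (intro cube_first_order v) auto
  ultimately have "s * (g v - g (cb v)) \<le> e + C * s\<^sup>2" using gv1 by linarith
  also have "\<dots> = s * ((C + 1) * s)" unfolding e_def by (simp add: power2_eq_square algebra_simps)
  finally have "g v - g (cb v) \<le> (C + 1) * s" using s(1) by simp
  then have low: "1 - g (cb v) \<le> (C + 2) * s" using gv1 e(3) by (simp add: algebra_simps)
  define \<rho> where "\<rho> = (1 + e) ^ 3"
  have \<rho>: "\<rho> \<le> 1 + 4 * e" "1 \<le> \<rho>"
  proof -
    have "e * e \<le> 1 / 9 * e" using e by (intro mult_right_mono) auto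
    moreover have "e * e * e \<le> 1 / 9 * e"
    proof -
      have "e * e \<le> 1 / 9 * 1" using e by (intro mult_mono) auto
      then show ?thesis using e by (intro mult_right_mono) auto
    qed
    moreover have "\<rho> = 1 + 3 * e + 3 * (e * e) + e * e * e" unfolding \<rho>_def by (simp add: power3_eq_cube algebra_simps)
    ultimately show "\<rho> \<le> 1 + 4 * e" using e by linarith
    show "1 \<le> \<rho>" unfolding \<rho>_def using e by (simp add: one_le_power)
  qed
  have "g (cb u) = \<rho> * g (cb v)"
  proof -
    have "cb u = \<rho> *\<^sub>R cb v" unfolding v(3) cb_def \<rho>_def by (simp add: tp_lin power3_eq_cube)
    then show ?thesis using dual_scale[OF gd cbE] by simp
  qed
  then have eq: "g (cb u) - 1 = (\<rho> - 1) - \<rho> * (1 - g (cb v))" by (simp add: algebra_simps)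
  have "0 \<le> \<rho> * (1 - g (cb v))" using \<rho> up by simp
  moreover have "\<rho> * (1 - g (cb v)) \<le> 2 * ((C + 2) * s)" using \<rho> e up low by (intro mult_mono) auto
  ultimately have "\<bar>g (cb u) - 1\<bar> \<le> 4 * s + 2 * ((C + 2) * s)" unfolding eq using \<rho> e by linarith
  then show ?thesis unfolding cC_def C_def[symmetric] by (simp add: algebra_simps)
qed

text \<open>The polynomial g (cb (x + t m)) of degree 3 in t is nearly constant on [-1, 1], so its coefficients are small.\<close>

lemma cube_coefficients:
  assumes g: "g \<in> polar E M" "dual_norm E g = 1" and m: "m \<in> M" and x: "x \<in> E" "g x = 1"
    and nx: "norm (x + m) \<le> 1 + s\<^sup>2" "norm (x - m) \<le> 1 + s\<^sup>2" and s: "0 < s" "s \<le> 1 / 3"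
  shows "\<bar>g (cb m)\<bar> \<le> 4 * cC * s" "\<bar>g (tp m m x)\<bar> \<le> cC * s"
proof -
  note gd = polar_dual[OF g(1)] and mE = ME[OF m]
  note ga = dual_add[OF gd] and gs = dual_scale[OF gd]
  have one: "\<bar>g (cb (x + t *\<^sub>R m)) - 1\<bar> \<le> cC * s" if t: "\<bar>t\<bar> \<le> 1" for t
  proof (rule cube_near_one[OF g _ _ _ s])
    show "x + t *\<^sub>R m \<in> E" using x mE E(1) by (simp add: subspace_add subspace_scale)
    have "g (x + t *\<^sub>R m) = g x + t * g m"
      using x mE E(1) ga[of x "t *\<^sub>R m"] gs[OF mE, of t] by (simp add: subspace_scale)
    then show "g (x + t *\<^sub>R m) = 1" using x(2) polar_M[OF g(1) m] by simp
    have ab: "a + b + (c - d) = (a + c) + (b - d)" for a b c d :: 'a by simp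
    have "((1 + t) / 2) *\<^sub>R (x + m) + ((1 - t) / 2) *\<^sub>R (x - m)
        = ((1 + t) / 2 + (1 - t) / 2) *\<^sub>R x + ((1 + t) / 2 - (1 - t) / 2) *\<^sub>R m"
      unfolding scaleR_add_right scaleR_diff_right scaleR_add_left scaleR_diff_left by (rule ab)
    moreover have "(1 + t) / 2 + (1 - t) / 2 = 1" "(1 + t) / 2 - (1 - t) / 2 = t" by (simp_all add: field_simps)
    ultimately have "x + t *\<^sub>R m = ((1 + t) / 2) *\<^sub>R (x + m) + ((1 - t) / 2) *\<^sub>R (x - m)" by simp
    then have "norm (x + t *\<^sub>R m) \<le> norm (((1 + t) / 2) *\<^sub>R (x + m)) + norm (((1 - t) / 2) *\<^sub>R (x - m))"
      by (simp only: norm_triangle_ineq)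
    also have "\<dots> = (1 + t) / 2 * norm (x + m) + (1 - t) / 2 * norm (x - m)" using t by simp
    also have "\<dots> \<le> (1 + t) / 2 * (1 + s\<^sup>2) + (1 - t) / 2 * (1 + s\<^sup>2)"
      using t nx by (intro add_mono mult_left_mono) auto
    also have "\<dots> = 1 + s\<^sup>2" by (simp add: field_simps)
    finally show "norm (x + t *\<^sub>R m) \<le> 1 + s\<^sup>2" .
  qed
  define p1 where "p1 = g (2 *\<^sub>R tp m x x + tp x m x)"
  define p2 where "p2 = g (2 *\<^sub>R tp m m x + tp m x m)"
  have expand: "g (cb (x + t *\<^sub>R m)) = g (cb x) + t * p1 + t\<^sup>2 * p2 + t ^ 3 * g (cb m)" for t
  proof -
    have mem: "cb x \<in> E" "2 *\<^sub>R tp m x x + tp x m x \<in> E" "2 *\<^sub>R tp m m x + tp m x m \<in> E" "cb m \<in> E"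
      unfolding cb_def using x mE E_tp_mem E(1) by (auto simp: subspace_add subspace_scale)
    have "cb (x + t *\<^sub>R m) = cb x + t *\<^sub>R (2 *\<^sub>R tp m x x + tp x m x) + t\<^sup>2 *\<^sub>R (2 *\<^sub>R tp m m x + tp m x m) + t ^ 3 *\<^sub>R cb m"
      unfolding cb_def using tp_sym[of x x m] tp_sym[of x m m]
      by (simp add: tp_lin power2_eq_square power3_eq_cube scaleR_add_right scaleR_2 mult_ac)
    then show ?thesis unfolding p1_def p2_def using mem E(1) by (simp add: ga gs subspace_add subspace_scale)
  qed
  \<comment> \<open>The points 1, - 1, 1 / 2, - 1 / 2 isolate the cubic coefficient in the odd part,
    with the factor 4; the points 1, - 1, 0 isolate the quadratic one.\<close>
  have v: "g (cb x) + p1 + p2 + g (cb m) - 1 \<le> cC * s" "- (cC * s) \<le> g (cb x) + p1 + p2 + g (cb m) - 1"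
    "g (cb x) - p1 + p2 - g (cb m) - 1 \<le> cC * s" "- (cC * s) \<le> g (cb x) - p1 + p2 - g (cb m) - 1"
    "g (cb x) + p1 / 2 + p2 / 4 + g (cb m) / 8 - 1 \<le> cC * s" "- (cC * s) \<le> g (cb x) + p1 / 2 + p2 / 4 + g (cb m) / 8 - 1"
    "g (cb x) - p1 / 2 + p2 / 4 - g (cb m) / 8 - 1 \<le> cC * s" "- (cC * s) \<le> g (cb x) - p1 / 2 + p2 / 4 - g (cb m) / 8 - 1"
    "g (cb x) - 1 \<le> cC * s" "- (cC * s) \<le> g (cb x) - 1"
    using one[of 1] one[of "- 1"] one[of "1 / 2"] one[of "- 1 / 2"] one[of 0] unfolding expand abs_le_iff
    by (simp_all add: power2_eq_square power3_eq_cube)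
  show "\<bar>g (cb m)\<bar> \<le> 4 * cC * s" using v unfolding abs_le_iff by linarith
  \<comment> \<open>Modulo M the two kinds of quadratic terms agree, so the quadratic coefficient
    becomes 3 g (tp m m x).\<close>
  have "tp m x m - tp x m m \<in> M" by (rule derivation_M[OF mE x(1) m])
  then have "g (tp m x m - tp x m m) = 0" by (rule polar_M[OF g(1)])
  then have "g (tp m x m) = g (tp m m x)"
    using dual_diff[OF gd E(1), of "tp m x m" "tp x m m"] E_tp_mem mE x(1) tp_sym[of x m m] by simp
  then have "p2 = 3 * g (tp m m x)"
    unfolding p2_def using E_tp_mem mE x(1) E(1) by (simp add: ga gs subspace_scale)
  moreover have "\<bar>p2\<bar> \<le> 2 * (cC * s)" using v unfolding abs_le_iff by linarith
  moreover have "0 \<le> cC * s" using cC0 s by simp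
  ultimately show "\<bar>g (tp m m x)\<bar> \<le> cC * s" by linarith
qed

lemma cb_M: assumes m: "m \<in> M" shows "cb m \<in> M"
proof -
  obtain r n where n: "0 < r" "norm n \<le> 1" "m = r *\<^sub>R n" "n = (1 / r) *\<^sub>R m" by (rule unit_scale)
  have nM: "n \<in> M" using n(4) m M(1) by (simp add: subspace_scale)
  have "cb n \<in> M"
  proof (rule mem_MI)
    show "cb n \<in> E" unfolding cb_def using E_tp_mem ME[OF nM] by blast
    fix g assume g: "g \<in> polar E M" "dual_norm E g = 1"
    show "g (cb n) = 0"
    proof (rule abs_le_small_zero[where C = "4 * cC"])
      fix s :: real assume s: "0 < s" "s \<le> 1 / 3"
      obtain x where "x \<in> E" "g x = 1" "norm (x + n) \<le> 1 + s\<^sup>2" "norm (x - n) \<le> 1 + s\<^sup>2"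
        using two_ball[OF g nM n(2), of "s\<^sup>2"] s by auto
      from cube_coefficients(1)[OF g nM this s] show "\<bar>g (cb n)\<bar> \<le> 4 * cC * s" .
    qed (use cC0 in simp)
  qed
  moreover have "cb m = r ^ 3 *\<^sub>R cb n" unfolding n(3) cb_def by (simp add: tp_lin power3_eq_cube)
  ultimately show ?thesis using M(1) by (simp add: subspace_scale)
qed

text \<open>With D = \<open>tp m m\<close> and Q n = \<open>tp m n m\<close>, polarizing the cube
  gives 4 D n + 2 Q n, and \<open>derivation_M\<close> exchanges Q n for D n modulo M.\<close>

lemma tp_M:
  assumes m: "m \<in> M" and n: "n \<in> M" shows "tp m m n \<in> M"
proof -
  have "cb (m + n) - cb (m - n) - 2 *\<^sub>R cb n \<in> M"
    using cb_M[OF subspace_add[OF M(1) m n]] cb_M[OF subspace_diff[OF M(1) m n]] cb_M[OF n] M(1)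
    by (simp add: subspace_diff subspace_scale)
  moreover have "tp m n m - tp n m m \<in> M" using ME m n by (intro derivation_M) auto
  ultimately have "(cb (m + n) - cb (m - n) - 2 *\<^sub>R cb n) - 2 *\<^sub>R (tp m n m - tp n m m) \<in> M"
    using M(1) by (simp add: subspace_diff subspace_scale)
  moreover have "(cb (m + n) - cb (m - n) - 2 *\<^sub>R cb n) - 2 *\<^sub>R (tp m n m - tp n m m) = 6 *\<^sub>R tp m m n"
  proof -
    have e: "cb (m + n) - cb (m - n) - 2 *\<^sub>R cb n = 2 *\<^sub>R (tp m m n + tp m m n + tp m n m)"
      unfolding cb_def using tp_sym[of n m m] tp_sym[of n n m] by (simp add: tp_lin scaleR_2)
    show ?thesis unfolding e using tp_sym[of n m m] by (simp add: algebra_simps) (simp flip: scaleR_add_left)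
  qed
  ultimately have "(1 / 6) *\<^sub>R 6 *\<^sub>R tp m m n \<in> M" using M(1) by (simp only: subspace_scale)
  then show ?thesis by simp
qed

section \<open>The adjoint of the semigroup on the polar\<close>

definition pull :: "'a \<Rightarrow> real \<Rightarrow> ('a \<Rightarrow> real) \<Rightarrow> 'a \<Rightarrow> real" where
  "pull m t g = (\<lambda>x. if x \<in> E then g (R m t x) else 0)"

lemma R_M: "m \<in> M \<Longrightarrow> n \<in> M \<Longrightarrow> R m t n \<in> M"
  using M tp_M by (intro R_mem) auto

lemma polarI:
  assumes "\<And>x y. x \<in> E \<Longrightarrow> y \<in> E \<Longrightarrow> f (x + y) = f x + f y" "\<And>c x. x \<in> E \<Longrightarrow> f (c *\<^sub>R x) = c * f x"
    "\<And>x. x \<in> E \<Longrightarrow> \<bar>f x\<bar> \<le> B * norm x" "\<And>x. x \<notin> E \<Longrightarrow> f x = 0" "\<And>x. x \<in> M \<Longrightarrow> f x = 0"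
  shows "f \<in> polar E M"
  unfolding polar_def dual_space_def using assms by blast

lemma polar_comp:
  assumes g: "g \<in> polar E M" and T: "bounded_linear T" "\<And>x. x \<in> E \<Longrightarrow> T x \<in> E" "\<And>x. x \<in> M \<Longrightarrow> T x \<in> M"
  shows "(\<lambda>x. if x \<in> E then g (T x) else 0) \<in> polar E M"
proof -
  note gd = polar_dual[OF g]
  interpret T: bounded_linear T by (rule T(1))
  obtain B where B: "\<And>x. norm (T x) \<le> norm x * B" using T.bounded by blast
  show ?thesis
  proof (rule polarI[where B = "dual_norm E g * B"])
    fix x assume x: "x \<in> E"
    have "\<bar>g (T x)\<bar> \<le> dual_norm E g * norm (T x)" by (rule dual_norm_bound[OF gd E(1) T(2)[OF x]])
    also have "\<dots> \<le> dual_norm E g * (norm x * B)" using B dual_norm_nonneg[OF gd E(1)] by (rule mult_left_mono)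
    finally show "\<bar>if x \<in> E then g (T x) else 0\<bar> \<le> dual_norm E g * B * norm x" using x by (simp add: mult_ac)
  next
    show "(if x \<in> E then g (T x) else 0) = 0" if "x \<in> M" for x
      using polar_M[OF g T(3)[OF that]] by simp
  qed (use E(1) dual_add[OF gd] dual_scale[OF gd] T(2) in \<open>simp_all add: T.add T.scaleR subspace_add subspace_scale\<close>)
qed

lemma pull_polar: "g \<in> polar E M \<Longrightarrow> m \<in> M \<Longrightarrow> pull m t g \<in> polar E M"
  unfolding pull_def using R_E R_M ME bounded_linear_R by (intro polar_comp) auto

lemma pull_pull: "m \<in> M \<Longrightarrow> pull m s (pull m t g) = pull m (t + s) g"
  using R_E[OF ME] by (auto simp: pull_def R_add)

text \<open>The three summands stem from the first-order term, from the remainder of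
  \<open>R_first_order\<close> with norm x \<le> 2, and from dividing by norm x \<le> 1 +
  s^2.\<close>

definition rC :: real where "rC = cC + 2 * (K\<^sup>2 * exp K) + 1"

lemma rC: "0 \<le> rC" using cC0 by (simp add: rC_def)

text \<open>The two-ball vector x nearly norms g, and g (tp m m x) = O(s) by
  \<open>cube_coefficients\<close>. So the first-order change of g along \<open>R m s x\<close> is
  itself O(s^2), and g keeps the value 1 - O(s^2).\<close>

lemma pull_lower_unit:
  assumes g: "g \<in> polar E M" "dual_norm E g = 1" and m: "m \<in> M" "norm m \<le> 1" and s: "0 < s" "s \<le> 1 / 3"
  shows "1 - rC * s\<^sup>2 \<le> dual_norm E (pull m s g)"
proof -
  define A where "A = cC + 2 * (K\<^sup>2 * exp K)"
  have A0: "0 \<le> A" unfolding A_def using cC0 by simp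
  define N where "N = dual_norm E (pull m s g)"
  note gd = polar_dual[OF g(1)] and mE = ME[OF m(1)]
  have pd: "pull m s g \<in> dual_space E" by (rule polar_dual[OF pull_polar[OF g(1) m(1)]])
  have N0: "0 \<le> N" unfolding N_def by (rule dual_norm_nonneg[OF pd E(1)])
  obtain x where x: "x \<in> E" "g x = 1" "norm (x + m) \<le> 1 + s\<^sup>2" "norm (x - m) \<le> 1 + s\<^sup>2"
    using two_ball[OF g m, of "s\<^sup>2"] s by auto
  have s2: "s\<^sup>2 \<le> 1" using s by (simp add: power_le_one)
  have "2 *\<^sub>R x = (x + m) + (x - m)" by (simp add: scaleR_2)
  then have "norm (2 *\<^sub>R x) \<le> norm (x + m) + norm (x - m)" by (simp only: norm_triangle_ineq)
  then have nx: "norm x \<le> 1 + s\<^sup>2" using x by simp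
  define D where "D = R m s x - (x - s *\<^sub>R tp m m x)"
  have mem: "tp m m x \<in> E" "R m s x \<in> E" using E_tp_mem R_E mE x(1) by auto
  then have mem': "s *\<^sub>R tp m m x \<in> E" "x - s *\<^sub>R tp m m x \<in> E" "D \<in> E"
    unfolding D_def using E(1) x(1) by (auto simp: subspace_diff subspace_scale)
  have "norm D \<le> K\<^sup>2 * exp K * s\<^sup>2 * norm x" unfolding D_def using m(2) s by (intro R_first_order) auto
  also have "\<dots> \<le> K\<^sup>2 * exp K * s\<^sup>2 * 2" using nx s2 by (intro mult_left_mono) auto
  finally have "\<bar>g D\<bar> \<le> 2 * (K\<^sup>2 * exp K) * s\<^sup>2" using dual_norm_bound[OF gd E(1) mem'(3)] g(2) by simp
  moreover have "g D = g (R m s x) - (1 - s * g (tp m m x))"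
    unfolding D_def using dual_diff[OF gd E(1)] dual_scale[OF gd mem(1)] mem mem' x by simp
  moreover have "s * g (tp m m x) \<le> cC * s\<^sup>2"
    using mult_left_mono[OF cube_coefficients(2)[OF g m(1) x s], of s] s
    by (simp add: abs_le_iff power2_eq_square mult_ac)
  ultimately have "1 - A * s\<^sup>2 \<le> g (R m s x)" unfolding A_def by (simp add: abs_le_iff algebra_simps)
  also have "\<dots> \<le> N * norm x"
    using dual_norm_bound[OF pd E(1) x(1)] x(1) unfolding N_def by (simp add: pull_def abs_le_iff)
  also have "\<dots> \<le> N * (1 + s\<^sup>2)" using nx N0 by (rule mult_left_mono)
  finally have "1 - A * s\<^sup>2 \<le> N * (1 + s\<^sup>2)" .
  moreover have "(1 - (A + 1) * s\<^sup>2) * (1 + s\<^sup>2) = 1 - A * s\<^sup>2 - (A + 1) * (s\<^sup>2 * s\<^sup>2)" by (simp add: algebra_simps)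
  moreover have "0 \<le> (A + 1) * (s\<^sup>2 * s\<^sup>2)" using A0 by simp
  ultimately have "(1 - (A + 1) * s\<^sup>2) * (1 + s\<^sup>2) \<le> N * (1 + s\<^sup>2)" by linarith
  then have "1 - (A + 1) * s\<^sup>2 \<le> N" by (rule mult_right_le_imp_le) (simp add: add_pos_nonneg)
  then show ?thesis unfolding A_def N_def rC_def .
qed

lemma pull_lower:
  assumes g: "g \<in> polar E M" and m: "m \<in> M" "norm m \<le> 1" and s: "0 < s" "s \<le> 1 / 3"
  shows "(1 - rC * s\<^sup>2) * dual_norm E g \<le> dual_norm E (pull m s g)"
proof (cases "dual_norm E g = 0")
  case True
  then show ?thesis using dual_norm_nonneg[OF polar_dual[OF pull_polar[OF g m(1)]] E(1)] by simp
next
  case False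
  define d where "d = dual_norm E g"
  have d: "d > 0" unfolding d_def using False dual_norm_nonneg[OF polar_dual[OF g] E(1)] by simp
  have "1 - rC * s\<^sup>2 \<le> dual_norm E (pull m s (\<lambda>x. 1 / d * g x))"
    unfolding d_def by (rule pull_lower_unit[OF polar_normalize[OF g False] m s])
  also have "pull m s (\<lambda>x. 1 / d * g x) = (\<lambda>x. 1 / d * pull m s g x)" by (simp add: pull_def fun_eq_iff)
  also have "dual_norm E \<dots> = 1 / d * dual_norm E (pull m s g)"
    using dual_norm_cmult[OF polar_dual[OF pull_polar[OF g m(1)]] E(1), of "1 / d" s] d by simp
  finally show ?thesis using d unfolding d_def[symmetric] by (simp add: pos_le_divide_eq)
qed

text \<open>A step of length t / n loses only a factor 1 - O(1 / n^2), so n steps lose nothing in the limit.\<close>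

lemma pull_isometric:
  assumes g: "g \<in> polar E M" and m: "m \<in> M" "norm m \<le> 1" and t: "0 < t"
  shows "dual_norm E g \<le> dual_norm E (pull m t g)"
proof -
  define d where "d = dual_norm E g"
  have d0: "0 \<le> d" unfolding d_def by (rule dual_norm_nonneg[OF polar_dual[OF g] E(1)])
  have step: "(1 - rC * t\<^sup>2 / real n) * d \<le> dual_norm E (pull m t g)"
    if n: "n \<ge> 1" "3 * t \<le> real n" "rC * t\<^sup>2 \<le> real n" for n
  proof -
    define s where "s = t / real n"
    have s: "0 < s" "s \<le> 1 / 3" unfolding s_def using t n by (auto simp: field_simps)
    have ns: "real n * s\<^sup>2 = t\<^sup>2 / real n" unfolding s_def using n by (simp add: power2_eq_square)
    have "rC * s\<^sup>2 \<le> 1"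
    proof -
      have "real n * (rC * s\<^sup>2) = rC * (real n * s\<^sup>2)" by (rule mult.left_commute)
      also have "\<dots> = rC * t\<^sup>2 / real n" unfolding ns by simp
      also have "\<dots> \<le> 1" using n by simp
      also have "\<dots> \<le> real n" using n by simp
      finally show ?thesis using n by simp
    qed
    then have nonneg: "0 \<le> 1 - rC * s\<^sup>2" by simp
    have "(1 - rC * s\<^sup>2) ^ k * d \<le> dual_norm E (pull m (real k * s) g)" for k
    proof (induction k)
      case 0
      have "pull m 0 g = g" using dual_outside[OF polar_dual[OF g]] by (auto simp: pull_def)
      then show ?case by (simp add: d_def)
    next
      case (Suc k)
      have "(1 - rC * s\<^sup>2) ^ Suc k * d \<le> (1 - rC * s\<^sup>2) * dual_norm E (pull m (real k * s) g)"
        using mult_left_mono[OF Suc.IH nonneg] by (simp only: power_Suc mult.assoc)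
      also have "\<dots> \<le> dual_norm E (pull m s (pull m (real k * s) g))"
        by (rule pull_lower[OF pull_polar[OF g m(1)] m s])
      also have "pull m s (pull m (real k * s) g) = pull m (real (Suc k) * s) g"
        unfolding pull_pull[OF m(1)] by (simp add: algebra_simps)
      finally show ?case .
    qed
    from this[of n] have "(1 - rC * s\<^sup>2) ^ n * d \<le> dual_norm E (pull m t g)" using n by (simp add: s_def)
    moreover have "1 - rC * t\<^sup>2 / real n \<le> (1 - rC * s\<^sup>2) ^ n"
    proof -
      have "1 + real n * (- (rC * s\<^sup>2)) \<le> (1 + - (rC * s\<^sup>2)) ^ n" using nonneg by (intro Bernoulli_inequality) simp
      moreover have "real n * (- (rC * s\<^sup>2)) = - (rC * (real n * s\<^sup>2))" by simp
      ultimately show ?thesis unfolding ns by simp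
    qed
    then have "(1 - rC * t\<^sup>2 / real n) * d \<le> (1 - rC * s\<^sup>2) ^ n * d" using d0 by (rule mult_right_mono)
    ultimately show ?thesis by linarith
  qed
  have "(\<lambda>n. (1 - rC * t\<^sup>2 / real n) * d) \<longlonglongrightarrow> (1 - 0) * d"
    by (intro tendsto_mult tendsto_diff tendsto_const lim_const_over_n)
  then have lim: "(\<lambda>n. (1 - rC * t\<^sup>2 / real n) * d) \<longlonglongrightarrow> d" by simp
  obtain k where k: "3 * t + rC * t\<^sup>2 + 1 \<le> real k" using real_arch_simple by blast
  have "d \<le> dual_norm E (pull m t g)"
  proof (rule LIMSEQ_le_const2[OF lim], intro exI allI impI)
    fix n assume "k \<le> n"
    then have "3 * t + rC * t\<^sup>2 + 1 \<le> real n" using k by simp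
    moreover have "0 \<le> rC * t\<^sup>2" using rC by simp
    ultimately show "(1 - rC * t\<^sup>2 / real n) * d \<le> dual_norm E (pull m t g)" using t by (intro step) auto
  qed
  then show ?thesis unfolding d_def .
qed

text \<open>Composition with R is isometric on the polar, whereas D R tends to 0 for D = tp m m.\<close>

lemma square_M:
  assumes m: "m \<in> M" and a: "a \<in> E" shows "tp m m a \<in> M"
proof -
  obtain r n where n: "0 < r" "norm n \<le> 1" "m = r *\<^sub>R n" "n = (1 / r) *\<^sub>R m" by (rule unit_scale)
  have nM: "n \<in> M" using n(4) m M(1) by (simp add: subspace_scale)
  have "tp n n a \<in> M"
  proof (rule mem_MI)
    show "tp n n a \<in> E" using E_tp_mem ME[OF nM] a by blast
    fix g assume g: "g \<in> polar E M" "dual_norm E g = 1"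
    define h where "h = (\<lambda>x. if x \<in> E then g (tp n n x) else 0)"
    have h: "h \<in> polar E M" unfolding h_def using E_tp_mem[OF ME[OF nM] ME[OF nM]] tp_M[OF nM]
      by (intro polar_comp[OF g(1) bl3]) auto
    have hd: "h \<in> dual_space E" by (rule polar_dual[OF h])
    have "dual_norm E h \<le> 0 + e" if e: "0 < e" for e
    proof -
      have t: "0 < 1 / e" using e by simp
      have pd: "pull n (1 / e) h \<in> dual_space E" by (rule polar_dual[OF pull_polar[OF h nM]])
      have "dual_norm E (pull n (1 / e) h) \<le> e"
      proof (rule dual_norm_leI[OF E(1) _ pd])
        fix x assume x: "x \<in> E" "norm x \<le> 1"
        have RE: "R n (1 / e) x \<in> E" by (rule R_E[OF ME[OF nM] x(1)])
        have "pull n (1 / e) h x = g (tp n n (R n (1 / e) x))" using x(1) RE by (simp add: pull_def h_def)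
        also have "\<dots> \<le> norm (tp n n (R n (1 / e) x))" by (rule polar_le[OF g E_tp_mem[OF ME[OF nM] ME[OF nM] RE]])
        also have "\<dots> \<le> norm x / (1 / e)" by (rule R_decay1[OF t])
        also have "\<dots> \<le> e" using x(2) e by (simp add: mult_left_le_one_le)
        finally show "pull n (1 / e) h x \<le> e" .
      qed
      with pull_isometric[OF h nM n(2) t] show ?thesis by simp
    qed
    then have "dual_norm E h \<le> 0" by (rule field_le_epsilon)
    then have "h a = 0" by (rule dual_eq_zeroI[OF hd E(1)])
    then show "g (tp n n a) = 0" using a by (simp add: h_def)
  qed
  moreover have "tp m m a = (r * r) *\<^sub>R tp n n a" unfolding n(3) by (simp add: tp_lin)
  ultimately show ?thesis using M(1) by (simp add: subspace_scale)
qed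

text \<open>By \<open>derivation_M\<close> the products \<open>tp m n a\<close>,
  \<open>tp n m a\<close> and \<open>tp m a n\<close> are congruent modulo M, and by polarizing
  \<open>square_M\<close> the first two add up to an element of M.\<close>

lemma two_M:
  assumes m: "m \<in> M" and n: "n \<in> M" and a: "a \<in> E"
  shows "tp m n a \<in> M" "tp m a n \<in> M"
proof -
  have sum: "tp m n a + tp n m a \<in> M"
  proof -
    have "tp (m + n) (m + n) a - tp m m a - tp n n a \<in> M"
      using square_M[OF _ a] m n M(1) by (simp add: subspace_add subspace_diff)
    moreover have "tp (m + n) (m + n) a - tp m m a - tp n n a = tp m n a + tp n m a" by (simp add: tp_lin)
    ultimately show ?thesis by simp
  qed
  have d: "tp n m a - tp m a n \<in> M" "tp m n a - tp m a n \<in> M"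
    using derivation_M[OF a ME[OF m] n] derivation_M[OF a ME[OF n] m] tp_sym[of a m n] tp_sym[of a n m] tp_sym[of n a m] by simp_all
  have "(tp m n a + tp n m a) + ((tp m n a - tp m a n) - (tp n m a - tp m a n)) \<in> M"
    using sum d M(1) by (simp only: subspace_add subspace_diff)
  then have "2 *\<^sub>R tp m n a \<in> M" by (simp add: scaleR_2)
  then have "(1 / 2) *\<^sub>R 2 *\<^sub>R tp m n a \<in> M" using M(1) by (simp only: subspace_scale)
  then show 1: "tp m n a \<in> M" by simp
  have "tp m n a - (tp m n a - tp m a n) \<in> M" by (rule subspace_diff[OF M(1) 1 d(2)])
  then show "tp m a n \<in> M" by simp
qed

text \<open>Triple products of elements of M multiply E into M, and every m in M is a limit
  of sums of such products.\<close>

theorem M_ideal_ideal: "triple_ideal tp E M"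
proof -
  \<comment> \<open>The elements of M that E multiplies into M, in either position. This set is a
    closed subspace, so it suffices to find enough of its elements.\<close>
  define V where "V = M \<inter> (\<Inter>a\<in>E. \<Inter>b\<in>E. (\<lambda>v. tp a b v) -` M \<inter> (\<lambda>v. tp a v b) -` M)"
  have V_iff: "v \<in> V \<longleftrightarrow> v \<in> M \<and> (\<forall>a\<in>E. \<forall>b\<in>E. tp a b v \<in> M \<and> tp a v b \<in> M)" for v
    unfolding V_def by auto
  have V: "subspace V"
    by (rule subspaceI) (use M(1) in \<open>auto simp: V_iff subspace_0 subspace_add subspace_scale tp_lin
        linear_0[OF bounded_linear.linear[OF bl2]] linear_0[OF bounded_linear.linear[OF bl3]]\<close>)
  have cV: "closed V"
    unfolding V_def by (intro closed_Int closed_INT ballI closed_vimage M(2) linear_continuous_on bl2 bl3)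
  have prod: "tp m n p \<in> V" if mnp: "m \<in> M" "n \<in> M" "p \<in> M" for m n p
    unfolding V_iff
  proof (intro conjI ballI)
    note e = ME[OF mnp(1)] ME[OF mnp(2)] ME[OF mnp(3)]
    show "tp m n p \<in> M" by (rule two_M(1)[OF mnp(1,2) e(3)])
    fix a b assume a: "a \<in> E" and b: "b \<in> E"
    have "tp (tp a b m) n p \<in> M"
      using two_M(1)[OF mnp(3,2) E_tp_mem[OF a b e(1)]] tp_sym[of p n] by simp
    moreover have "tp m (tp b a n) p \<in> M" by (rule two_M(2)[OF mnp(1,3) E_tp_mem[OF b a e(2)]])
    moreover have "tp m n (tp a b p) \<in> M" by (rule two_M(1)[OF mnp(1,2) E_tp_mem[OF a b e(3)]])
    ultimately show "tp a b (tp m n p) \<in> M" unfolding JI[of a b m n p] using M(1) by (simp add: subspace_add subspace_diff)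
    have na: "tp n m a \<in> M" "tp n m b \<in> M" using two_M(1)[OF mnp(2,1)] a b by auto
    have "tp (tp n m a) p b \<in> M" by (rule two_M(1)[OF na(1) mnp(3) b])
    moreover have "tp a p (tp n m b) \<in> M" using two_M(1)[OF na(2) mnp(3) a] tp_sym[of a p] by simp
    moreover have "tp n m (tp a p b) \<in> M" by (rule two_M(1)[OF mnp(2,1) E_tp_mem[OF a e(3) b]])
    ultimately show "tp a (tp m n p) b \<in> M" unfolding JI_mid[of a m n p b] using M(1) by (simp add: subspace_add subspace_diff)
  qed
  have unit: "m \<in> V" if m: "m \<in> M" "norm m \<le> 1" for m
  proof -
    \<comment> \<open>The series of R m t m - m starts with the product {m, m, m}, which lies in V,
      and R m t m tends to 0; thus the limit - m lies in V.\<close>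
    have mem: "R m t m - m \<in> V" for t
      by (rule R_minus_mem[OF V cV prod[OF m(1) m(1) m(1)]]) (use prod m V_iff in blast)
    have "- m \<in> V"
    proof (rule closed_sequentially[OF cV, of "\<lambda>k. R m (real k) m - m"])
      show "(\<lambda>k. R m (real k) m - m) \<longlonglongrightarrow> - m"
        unfolding LIMSEQ_iff
      proof (intro allI impI)
        fix r :: real assume "0 < r"
        then have "0 < r / 2" by simp
        from R_self_small[OF this] obtain S where S: "S > 0" "\<And>t n. S \<le> t \<Longrightarrow> norm n \<le> 1 \<Longrightarrow> norm (R n t n) \<le> r / 2" by blast
        obtain k where "S \<le> real k" using real_arch_simple by blast
        then have "norm (R m (real n) m - m - - m) < r" if "n \<ge> k" for n
          using S(2)[of "real n" m] m(2) that \<open>0 < r\<close> by simp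
        then show "\<exists>no. \<forall>n\<ge>no. norm (R m (real n) m - m - - m) < r" by blast
      qed
    qed (rule mem)
    then show ?thesis using subspace_neg[OF V, of "- m"] by simp
  qed
  have "m \<in> V" if m: "m \<in> M" for m
  proof -
    obtain r n where n: "0 < r" "norm n \<le> 1" "m = r *\<^sub>R n" "n = (1 / r) *\<^sub>R m" by (rule unit_scale)
    have "n \<in> M" using n(4) m M(1) by (simp add: subspace_scale)
    then have "n \<in> V" using n(2) by (rule unit)
    then show ?thesis unfolding n(3) by (rule subspace_scale[OF V])
  qed
  then show ?thesis unfolding triple_ideal_def using M V_iff by blast
qed

end

theorem theorem5p5:
  fixes J :: "'a::banach \<Rightarrow> 'a" and tp :: "'a \<Rightarrow> 'a \<Rightarrow> 'a \<Rightarrow> 'a"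
    and E M :: "'a set"
  assumes "real_JBstar_triple J tp E"
    and "subspace M" and "M \<subseteq> E"
  shows "M_ideal E M \<longleftrightarrow> triple_ideal tp E M"
proof -
  have triple: "complex_JBstar_triple J tp" and E: "subspace E" "closed E"
    and mem: "\<And>x y z. x \<in> E \<Longrightarrow> y \<in> E \<Longrightarrow> z \<in> E \<Longrightarrow> tp x y z \<in> E"
    using assms(1) unfolding real_JBstar_triple_def by blast+
  have J: "complex_structure J" using triple unfolding complex_JBstar_triple_def by (rule conjunct1)
  interpret real_jb J tp E by unfold_locales (fact J triple E mem)+
  show ?thesis
  proof
    assume "M_ideal E M"
    then interpret M_ideal_in J tp E M by unfold_locales
    show "triple_ideal tp E M" by (rule M_ideal_ideal)
  next
    assume "triple_ideal tp E M"
    then interpret triple_ideal_in J tp E M by unfold_locales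
    show "M_ideal E M" by (rule ideal_M_ideal)
  qed
qed

end
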